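(* Let $A$ be a Banach algebra, $E$ a Banach $A$-bimodule, and $T,T'\in Z_K^2(A,E)$. Then: (a) $\Sigma_T$ cf-splits strongly. (b) If $T-T'\in\widetilde N_K^2(A,E)$, then $\Sigma_T$ is equivalent to $\Sigma_{T'}$. Moreover, $T+\widetilde N_K^2(A,E)\mapsto[\Sigma_T]$ is a bijection from $\widetilde H_K^2(A,E)$ to the family of equivalence classes $C$, with respect to equivalence, of singular, admissible Banach extensions of $A$ by $E$ such that $C$ contains an extension that cf-splits (or, equivalently, contains an extension that cf-splits strongly). (c) If $T-T'\in N_K^2(A,E)$, then $\Sigma_T$ is strongly equivalent to $\Sigma_{T'}$. Moreover, $T+N_K^2(A,E)\mapsto[\Sigma_T]_s$ is a bijection from $H_K^2(A,E)$ to the family of equivalence classes, with respect to strong equivalence, of singular, admissible Banach extensions of $A$ by $E$ that cf-split strongly.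
   Context: Cocycles. Let $A$ be a Banach algebra and $E$ a Banach $A$-bimodule. For a linear map $S:A\to E$ put $\delta^1S(a,b)=a\cdot S(b)-S(ab)+S(a)\cdot b$; for a bilinear map $T:A\times A\to E$ put $\delta^2T(a,b,c)=a\cdot T(b,c)-T(ab,c)+T(a,bc)-T(a,b)\cdot c$. A bilinear map $T:A\times A\to E$ is compact if the norm closure of $\{T(a,b):\|a\|<1,\|b\|<1\}$ is compact. Set: $Z_K^2(A,E)$ = the compact bilinear $T$ with $\delta^2T=0$; $N_K^2(A,E)$ = the compact bilinear maps of the form $\delta^1S$ with $S:A\to E$ bounded linear; $\widetilde N_K^2(A,E)$ = the compact bilinear maps of the form $\delta^1S$ with $S:A\to E$ linear (not necessarily bounded); $H_K^2(A,E)=Z_K^2(A,E)/N_K^2(A,E)$; $\widetilde H_K^2(A,E)=Z_K^2(A,E)/\widetilde N_K^2(A,E)$. Extensions. A Banach extension of $A$ by $I$ is a short exact sequence $\Sigma:0\to I\xrightarrow{\iota}\mathfrak A\xrightarrow{q}A\to0$ of Banach algebras and bounded homomorphisms, with $\iota(I)$ a closed ideal in $\mathfrak A$. It is singular if $I^2=0$, and admissible if there is a bounded linear map $Q:A\to\mathfrak A$ with $q\circ Q=\mathrm{id}_A$. If $\Sigma$ is singular, $I$ becomes an $A$-bimodule via $x\cdot q(a)=\iota(x)a$, $q(a)\cdot x=a\iota(x)$ (identifying $I$ with $\iota(I)$); $\Sigma$ is a singular Banach extension of $A$ by $E$ if $I$ with these operations is isomorphic to $E$ as a Banach $A$-bimodule,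 and $I$ is then identified with $E$. Two Banach extensions $0\to I\xrightarrow{\iota_{\mathfrak A}}\mathfrak A\xrightarrow{q_{\mathfrak A}}A\to0$ and $0\to I\xrightarrow{\iota_{\mathfrak B}}\mathfrak B\xrightarrow{q_{\mathfrak B}}A\to0$ are equivalent if there is an algebra isomorphism $\psi:\mathfrak A\to\mathfrak B$ (not necessarily continuous) with $\psi\circ\iota_{\mathfrak A}=\iota_{\mathfrak B}$ and $q_{\mathfrak B}\circ\psi=q_{\mathfrak A}$, and strongly equivalent if $\psi$ can be taken continuous. $[\Sigma]$ and $[\Sigma]_s$ denote the classes of $\Sigma$ for equivalence and strong equivalence. cf-splitting. For a linear map $Q:A\to\mathfrak A$ of Banach algebras let $S_Q(a,b)=Q(a)Q(b)-Q(ab)$; $Q$ is a cf-homomorphism if the bilinear map $S_Q$ is compact. $\Sigma$ cf-splits if there is a cf-homomorphism $Q:A\to\mathfrak A$ with $q\circ Q=\mathrm{id}_A$, and cf-splits strongly if such a $Q$ can be chosen bounded. The extension $\Sigma_T$. For a bounded bilinear $T:A\times A\to E$ with $\delta^2T=0$, let $\mathfrak A_T=A\oplus E$ with product $(a,x)(b,y)=(ab,\,a\cdot y+x\cdot b+T(a,b))$, made a Banach algebra by an algebra norm equivalent to $\|(a,x)\|_1=\|a\|+\|x\|$. $\Sigma_T$ is the singular admissible Banach extension $0\to E\xrightarrow{\iota_T}\mathfrak A_T\xrightarrow{q_T}A\to0$ of $A$ by $E$, with $\iota_T(x)=(0,x)$ and $q_T((a,x))=a$. *)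

theory Defs
  imports "HOL-Analysis.Analysis" "HOL-Algebra.Module"
begin

section \<open>Banach spaces, Banach algebras and Banach bimodules on carrier sets\<close>

text \<open>
  A Banach extension of \<open>A\<close> involves an arbitrary further Banach algebra, and families of extensions
  have to be formed, so Banach algebras are records over the carrier-based modules of HOL-Algebra
  rather than type-class instances. As for \<^locale>\<open>module\<close>, the field \<open>one\<close> is never
  constrained (algebras need not be unital), and \<open>mult\<close> is ignored when only the normed space
  structure is meant. A type \<open>'k\<close> of class \<^class>\<open>real_normed_field\<close> is, by the
  Gelfand-Mazur theorem, the real or the complex field, so both kinds of scalars are covered.
\<close>

record ('k, 'v) normed_alg = "('k, 'v) module" +
  nrm :: "'v \<Rightarrow> real"

definition scalars :: "'k::real_normed_field ring" where
  "scalars = \<lparr>carrier = UNIV, mult = (*), one = 1, zero = 0, add = (+)\<rparr>"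

locale normed_space = Module.module scalars V
  for V :: "('k::real_normed_field, 'v, 'z) normed_alg_scheme" (structure) +
  assumes nrm_nonneg: "x \<in> carrier V \<Longrightarrow> 0 \<le> nrm V x"
    and nrm_eq_zero: "x \<in> carrier V \<Longrightarrow> nrm V x = 0 \<longleftrightarrow> x = \<zero>"
    and nrm_triangle: "\<lbrakk>x \<in> carrier V; y \<in> carrier V\<rbrakk> \<Longrightarrow> nrm V (x \<oplus> y) \<le> nrm V x + nrm V y"
    and nrm_smult: "x \<in> carrier V \<Longrightarrow> nrm V (c \<odot> x) = norm c * nrm V x"

(* The value outside the carrier is set to 0 because the library locale Metric_space demands
   nonnegativity and symmetry of the distance everywhere. *)
definition ndist :: "('k, 'v, 'z) normed_alg_scheme \<Rightarrow> 'v \<Rightarrow> 'v \<Rightarrow> real" where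
  "ndist V x y = (if x \<in> carrier V \<and> y \<in> carrier V then nrm V (x \<ominus>\<^bsub>V\<^esub> y) else 0)"

definition ntop :: "('k, 'v, 'z) normed_alg_scheme \<Rightarrow> 'v topology" where
  "ntop V = Metric_space.mtopology (carrier V) (ndist V)"

locale banach_space = normed_space +
  assumes complete: "Metric_space.mcomplete (carrier V) (ndist V)"

definition linear_on ::
  "('k, 'v, 'y) normed_alg_scheme \<Rightarrow> ('k, 'w, 'z) normed_alg_scheme \<Rightarrow> ('v \<Rightarrow> 'w) \<Rightarrow> bool" where
  "linear_on V W f \<longleftrightarrow> f \<in> carrier V \<rightarrow> carrier W \<and>
     (\<forall>x\<in>carrier V. \<forall>y\<in>carrier V. f (x \<oplus>\<^bsub>V\<^esub> y) = f x \<oplus>\<^bsub>W\<^esub> f y) \<and>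
     (\<forall>c. \<forall>x\<in>carrier V. f (c \<odot>\<^bsub>V\<^esub> x) = c \<odot>\<^bsub>W\<^esub> f x)"

definition bounded_linear_on ::
  "('k, 'v, 'y) normed_alg_scheme \<Rightarrow> ('k, 'w, 'z) normed_alg_scheme \<Rightarrow> ('v \<Rightarrow> 'w) \<Rightarrow> bool" where
  "bounded_linear_on V W f \<longleftrightarrow> linear_on V W f \<and> (\<exists>K. \<forall>x\<in>carrier V. nrm W (f x) \<le> K * nrm V x)"

definition bilinear_on ::
  "('k, 'u, 'x) normed_alg_scheme \<Rightarrow> ('k, 'v, 'y) normed_alg_scheme \<Rightarrow>
   ('k, 'w, 'z) normed_alg_scheme \<Rightarrow> ('u \<Rightarrow> 'v \<Rightarrow> 'w) \<Rightarrow> bool" where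
  "bilinear_on U V W f \<longleftrightarrow>
     (\<forall>x\<in>carrier U. linear_on V W (f x)) \<and> (\<forall>y\<in>carrier V. linear_on U W (\<lambda>x. f x y))"

locale banach_algebra = banach_space A
  for A :: "('k::real_normed_field, 'a, 'z) normed_alg_scheme" (structure) +
  assumes mult_bilinear: "bilinear_on A A A (\<otimes>)"
    and mult_assoc: "\<lbrakk>a \<in> carrier A; b \<in> carrier A; c \<in> carrier A\<rbrakk> \<Longrightarrow> (a \<otimes> b) \<otimes> c = a \<otimes> (b \<otimes> c)"
    and nrm_mult: "\<lbrakk>a \<in> carrier A; b \<in> carrier A\<rbrakk> \<Longrightarrow> nrm A (a \<otimes> b) \<le> nrm A a * nrm A b"

record ('k, 'a, 'e) bimodule = "('k, 'e) normed_alg" +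
  lact :: "'a \<Rightarrow> 'e \<Rightarrow> 'e"
  ract :: "'e \<Rightarrow> 'a \<Rightarrow> 'e"

locale banach_bimodule = banach_algebra A + E: banach_space E
  for A :: "('k::real_normed_field, 'a) normed_alg" and E :: "('k, 'a, 'e) bimodule" +
  assumes lact_bilinear: "bilinear_on A E E (lact E)"
    and ract_bilinear: "bilinear_on E A E (ract E)"
    and lact_lact: "\<lbrakk>a \<in> carrier A; b \<in> carrier A; x \<in> carrier E\<rbrakk> \<Longrightarrow>
      lact E a (lact E b x) = lact E (a \<otimes>\<^bsub>A\<^esub> b) x"
    and ract_ract: "\<lbrakk>a \<in> carrier A; b \<in> carrier A; x \<in> carrier E\<rbrakk> \<Longrightarrow>
      ract E (ract E x a) b = ract E x (a \<otimes>\<^bsub>A\<^esub> b)"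
    and lact_ract: "\<lbrakk>a \<in> carrier A; b \<in> carrier A; x \<in> carrier E\<rbrakk> \<Longrightarrow>
      lact E a (ract E x b) = ract E (lact E a x) b"
    and act_bounded: "\<exists>K. \<forall>a\<in>carrier A. \<forall>x\<in>carrier E.
      nrm E (lact E a x) \<le> K * nrm A a * nrm E x \<and> nrm E (ract E x a) \<le> K * nrm A a * nrm E x"


section \<open>Compact cocycles\<close>

text \<open>
  Bilinear maps on \<open>A\<close> are given in uncurried form. The elements of the cochain spaces are required
  to be \<^const>\<open>extensional\<close>, so that distinct functions are distinct maps on the carrier.
\<close>

definition delta1 ::
  "('k, 'a) normed_alg \<Rightarrow> ('k, 'a, 'e) bimodule \<Rightarrow> ('a \<Rightarrow> 'e) \<Rightarrow> 'a \<Rightarrow> 'a \<Rightarrow> 'e" where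
  "delta1 A E S a b = lact E a (S b) \<ominus>\<^bsub>E\<^esub> S (a \<otimes>\<^bsub>A\<^esub> b) \<oplus>\<^bsub>E\<^esub> ract E (S a) b"

definition delta2 ::
  "('k, 'a) normed_alg \<Rightarrow> ('k, 'a, 'e) bimodule \<Rightarrow> ('a \<times> 'a \<Rightarrow> 'e) \<Rightarrow> 'a \<Rightarrow> 'a \<Rightarrow> 'a \<Rightarrow> 'e" where
  "delta2 A E T a b c =
     lact E a (T (b, c)) \<ominus>\<^bsub>E\<^esub> T (a \<otimes>\<^bsub>A\<^esub> b, c) \<oplus>\<^bsub>E\<^esub> T (a, b \<otimes>\<^bsub>A\<^esub> c) \<ominus>\<^bsub>E\<^esub> ract E (T (a, b)) c"

definition compact_bilinear ::
  "('k, 'a, 'y) normed_alg_scheme \<Rightarrow> ('k, 'e, 'z) normed_alg_scheme \<Rightarrow> ('a \<times> 'a \<Rightarrow> 'e) \<Rightarrow> bool" where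
  "compact_bilinear A E T \<longleftrightarrow> bilinear_on A A E (curry T) \<and>
     compactin (ntop E) (ntop E closure_of
       {T (a, b) |a b. a \<in> carrier A \<and> b \<in> carrier A \<and> nrm A a < 1 \<and> nrm A b < 1})"

definition K2 :: "('k, 'a) normed_alg \<Rightarrow> ('k, 'a, 'e) bimodule \<Rightarrow> ('a \<times> 'a \<Rightarrow> 'e) set" where
  "K2 A E = {T \<in> extensional (carrier A \<times> carrier A). compact_bilinear A E T}"

definition Z2K :: "('k, 'a) normed_alg \<Rightarrow> ('k, 'a, 'e) bimodule \<Rightarrow> ('a \<times> 'a \<Rightarrow> 'e) set" where
  "Z2K A E = {T \<in> K2 A E.
     \<forall>a\<in>carrier A. \<forall>b\<in>carrier A. \<forall>c\<in>carrier A. delta2 A E T a b c = \<zero>\<^bsub>E\<^esub>}"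

definition N2K :: "('k, 'a) normed_alg \<Rightarrow> ('k, 'a, 'e) bimodule \<Rightarrow> ('a \<times> 'a \<Rightarrow> 'e) set" where
  "N2K A E = {T \<in> K2 A E. \<exists>S. bounded_linear_on A E S \<and>
     (\<forall>a\<in>carrier A. \<forall>b\<in>carrier A. T (a, b) = delta1 A E S a b)}"

definition N2K_tilde :: "('k, 'a) normed_alg \<Rightarrow> ('k, 'a, 'e) bimodule \<Rightarrow> ('a \<times> 'a \<Rightarrow> 'e) set" where
  "N2K_tilde A E = {T \<in> K2 A E. \<exists>S. linear_on A E S \<and>
     (\<forall>a\<in>carrier A. \<forall>b\<in>carrier A. T (a, b) = delta1 A E S a b)}"

definition cochain_add :: "('k, 'a) normed_alg \<Rightarrow> ('k, 'a, 'e) bimodule \<Rightarrow>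
    ('a \<times> 'a \<Rightarrow> 'e) \<Rightarrow> ('a \<times> 'a \<Rightarrow> 'e) \<Rightarrow> 'a \<times> 'a \<Rightarrow> 'e" where
  "cochain_add A E T T' = (\<lambda>p\<in>carrier A \<times> carrier A. T p \<oplus>\<^bsub>E\<^esub> T' p)"

definition cochain_diff :: "('k, 'a) normed_alg \<Rightarrow> ('k, 'a, 'e) bimodule \<Rightarrow>
    ('a \<times> 'a \<Rightarrow> 'e) \<Rightarrow> ('a \<times> 'a \<Rightarrow> 'e) \<Rightarrow> 'a \<times> 'a \<Rightarrow> 'e" where
  "cochain_diff A E T T' = (\<lambda>p\<in>carrier A \<times> carrier A. T p \<ominus>\<^bsub>E\<^esub> T' p)"

definition cochain_coset :: "('k, 'a) normed_alg \<Rightarrow> ('k, 'a, 'e) bimodule \<Rightarrow>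
    ('a \<times> 'a \<Rightarrow> 'e) \<Rightarrow> ('a \<times> 'a \<Rightarrow> 'e) set \<Rightarrow> ('a \<times> 'a \<Rightarrow> 'e) set" where
  "cochain_coset A E T N = cochain_add A E T ` N"

definition H2K :: "('k, 'a) normed_alg \<Rightarrow> ('k, 'a, 'e) bimodule \<Rightarrow> ('a \<times> 'a \<Rightarrow> 'e) set set" where
  "H2K A E = {cochain_coset A E T (N2K A E) |T. T \<in> Z2K A E}"

definition H2K_tilde ::
  "('k, 'a) normed_alg \<Rightarrow> ('k, 'a, 'e) bimodule \<Rightarrow> ('a \<times> 'a \<Rightarrow> 'e) set set" where
  "H2K_tilde A E = {cochain_coset A E T (N2K_tilde A E) |T. T \<in> Z2K A E}"


section \<open>Banach extensions\<close>

record ('k, 'a, 'i, 'm) extension =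
  ext_alg :: "('k, 'm) normed_alg"
  ext_incl :: "'i \<Rightarrow> 'm"
  ext_quot :: "'m \<Rightarrow> 'a"

definition algebra_hom ::
  "('k, 'v, 'y) normed_alg_scheme \<Rightarrow> ('k, 'w, 'z) normed_alg_scheme \<Rightarrow> ('v \<Rightarrow> 'w) \<Rightarrow> bool" where
  "algebra_hom A B f \<longleftrightarrow> linear_on A B f \<and>
     (\<forall>a\<in>carrier A. \<forall>b\<in>carrier A. f (a \<otimes>\<^bsub>A\<^esub> b) = f a \<otimes>\<^bsub>B\<^esub> f b)"

definition closed_ideal :: "('k, 'm) normed_alg \<Rightarrow> 'm set \<Rightarrow> bool" where
  "closed_ideal B J \<longleftrightarrow> closedin (ntop B) J \<and> \<zero>\<^bsub>B\<^esub> \<in> J \<and>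
     (\<forall>x\<in>J. \<forall>y\<in>J. x \<oplus>\<^bsub>B\<^esub> y \<in> J) \<and> (\<forall>c. \<forall>x\<in>J. c \<odot>\<^bsub>B\<^esub> x \<in> J) \<and>
     (\<forall>u\<in>carrier B. \<forall>x\<in>J. u \<otimes>\<^bsub>B\<^esub> x \<in> J \<and> x \<otimes>\<^bsub>B\<^esub> u \<in> J)"

definition banach_extension :: "('k::real_normed_field, 'a) normed_alg \<Rightarrow>
    ('k, 'i, 'z) normed_alg_scheme \<Rightarrow> ('k, 'a, 'i, 'm) extension \<Rightarrow> bool" where
  "banach_extension A I X \<longleftrightarrow>
     banach_algebra A \<and> banach_algebra I \<and> banach_algebra (ext_alg X) \<and>
     algebra_hom I (ext_alg X) (ext_incl X) \<and> bounded_linear_on I (ext_alg X) (ext_incl X) \<and>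
     algebra_hom (ext_alg X) A (ext_quot X) \<and> bounded_linear_on (ext_alg X) A (ext_quot X) \<and>
     inj_on (ext_incl X) (carrier I) \<and>
     ext_incl X ` carrier I = {u \<in> carrier (ext_alg X). ext_quot X u = \<zero>\<^bsub>A\<^esub>} \<and>
     ext_quot X ` carrier (ext_alg X) = carrier A \<and>
     closed_ideal (ext_alg X) (ext_incl X ` carrier I)"

definition singular :: "('k, 'i, 'z) normed_alg_scheme \<Rightarrow> bool" where
  "singular I \<longleftrightarrow> (\<forall>x\<in>carrier I. \<forall>y\<in>carrier I. x \<otimes>\<^bsub>I\<^esub> y = \<zero>\<^bsub>I\<^esub>)"

definition admissible :: "('k, 'a) normed_alg \<Rightarrow> ('k, 'a, 'i, 'm) extension \<Rightarrow> bool" where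
  "admissible A X \<longleftrightarrow>
     (\<exists>Q. bounded_linear_on A (ext_alg X) Q \<and> (\<forall>a\<in>carrier A. ext_quot X (Q a) = a))"

definition zero_mult :: "('k, 'a, 'e) bimodule \<Rightarrow> ('k, 'a, 'e) bimodule" where
  "zero_mult E = E\<lparr>mult := \<lambda>_ _. \<zero>\<^bsub>E\<^esub>\<rparr>"

(* The kernel I is identified with E: as a Banach algebra it is E with the zero product, and its
   two module operations x . q(u) = i(x) u and q(u) . x = u i(x) are those of E. *)
definition singular_extension_by :: "('k::real_normed_field, 'a) normed_alg \<Rightarrow>
    ('k, 'a, 'e) bimodule \<Rightarrow> ('k, 'a, 'e, 'm) extension \<Rightarrow> bool" where
  "singular_extension_by A E X \<longleftrightarrow>
     banach_extension A (zero_mult E) X \<and> singular (zero_mult E) \<and>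
     (\<forall>x\<in>carrier E. \<forall>u\<in>carrier (ext_alg X).
        ext_incl X (ract E x (ext_quot X u)) = ext_incl X x \<otimes>\<^bsub>ext_alg X\<^esub> u \<and>
        ext_incl X (lact E (ext_quot X u) x) = u \<otimes>\<^bsub>ext_alg X\<^esub> ext_incl X x)"

definition SA_extensions :: "('k::real_normed_field, 'a) normed_alg \<Rightarrow>
    ('k, 'a, 'e) bimodule \<Rightarrow> ('k, 'a, 'e, 'm) extension set" where
  "SA_extensions A E = {X. singular_extension_by A E X \<and> admissible A X}"

definition equivalence_map :: "('k, 'a, 'i, 'z) bimodule_scheme \<Rightarrow>
    ('k, 'a, 'i, 'm) extension \<Rightarrow> ('k, 'a, 'i, 'n) extension \<Rightarrow> ('m \<Rightarrow> 'n) \<Rightarrow> bool" where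
  "equivalence_map I X Y \<psi> \<longleftrightarrow>
     algebra_hom (ext_alg X) (ext_alg Y) \<psi> \<and>
     bij_betw \<psi> (carrier (ext_alg X)) (carrier (ext_alg Y)) \<and>
     (\<forall>x\<in>carrier I. \<psi> (ext_incl X x) = ext_incl Y x) \<and>
     (\<forall>u\<in>carrier (ext_alg X). ext_quot Y (\<psi> u) = ext_quot X u)"

definition equivalent_ext :: "('k, 'a, 'i, 'z) bimodule_scheme \<Rightarrow>
    ('k, 'a, 'i, 'm) extension \<Rightarrow> ('k, 'a, 'i, 'n) extension \<Rightarrow> bool" where
  "equivalent_ext I X Y \<longleftrightarrow> (\<exists>\<psi>. equivalence_map I X Y \<psi>)"

definition strongly_equivalent_ext :: "('k, 'a, 'i, 'z) bimodule_scheme \<Rightarrow>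
    ('k, 'a, 'i, 'm) extension \<Rightarrow> ('k, 'a, 'i, 'n) extension \<Rightarrow> bool" where
  "strongly_equivalent_ext I X Y \<longleftrightarrow>
     (\<exists>\<psi>. equivalence_map I X Y \<psi> \<and> continuous_map (ntop (ext_alg X)) (ntop (ext_alg Y)) \<psi>)"

text \<open>
  Classes consist of extensions whose algebra has its carrier in the type \<open>'n\<close>. The representing
  extension may live over another type \<open>'m\<close>, so that the class of an extension with
  carrier \<open>A \<times> E\<close> can be formed in any universe \<open>'n\<close>; it is nonempty as soon as
  \<open>A \<times> E\<close> injects into \<open>'n\<close>.
\<close>

definition ext_class :: "('k::real_normed_field, 'a) normed_alg \<Rightarrow> ('k, 'a, 'e) bimodule \<Rightarrow>
    ('k, 'a, 'e, 'm) extension \<Rightarrow> ('k, 'a, 'e, 'n) extension set" where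
  "ext_class A E X = {Y \<in> SA_extensions A E. equivalent_ext E X Y}"

definition strong_ext_class :: "('k::real_normed_field, 'a) normed_alg \<Rightarrow> ('k, 'a, 'e) bimodule \<Rightarrow>
    ('k, 'a, 'e, 'm) extension \<Rightarrow> ('k, 'a, 'e, 'n) extension set" where
  "strong_ext_class A E X = {Y \<in> SA_extensions A E. strongly_equivalent_ext E X Y}"


section \<open>Splitting by cf-homomorphisms\<close>

definition cf_homomorphism ::
  "('k, 'a) normed_alg \<Rightarrow> ('k, 'm) normed_alg \<Rightarrow> ('a \<Rightarrow> 'm) \<Rightarrow> bool" where
  "cf_homomorphism A B Q \<longleftrightarrow> linear_on A B Q \<and>
     compact_bilinear A B (\<lambda>(a, b). Q a \<otimes>\<^bsub>B\<^esub> Q b \<ominus>\<^bsub>B\<^esub> Q (a \<otimes>\<^bsub>A\<^esub> b))"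

definition cf_splits :: "('k, 'a) normed_alg \<Rightarrow> ('k, 'a, 'i, 'm) extension \<Rightarrow> bool" where
  "cf_splits A X \<longleftrightarrow>
     (\<exists>Q. cf_homomorphism A (ext_alg X) Q \<and> (\<forall>a\<in>carrier A. ext_quot X (Q a) = a))"

definition cf_splits_strongly :: "('k, 'a) normed_alg \<Rightarrow> ('k, 'a, 'i, 'm) extension \<Rightarrow> bool" where
  "cf_splits_strongly A X \<longleftrightarrow>
     (\<exists>Q. cf_homomorphism A (ext_alg X) Q \<and> bounded_linear_on A (ext_alg X) Q \<and>
       (\<forall>a\<in>carrier A. ext_quot X (Q a) = a))"


section \<open>The extension defined by a cocycle\<close>

definition cocycle_mult :: "('k, 'a) normed_alg \<Rightarrow> ('k, 'a, 'e) bimodule \<Rightarrow> ('a \<times> 'a \<Rightarrow> 'e) \<Rightarrow>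
    'a \<times> 'e \<Rightarrow> 'a \<times> 'e \<Rightarrow> 'a \<times> 'e" where
  "cocycle_mult A E T = (\<lambda>(a, x) (b, y).
     (a \<otimes>\<^bsub>A\<^esub> b, lact E a y \<oplus>\<^bsub>E\<^esub> ract E x b \<oplus>\<^bsub>E\<^esub> T (a, b)))"

definition sum_nrm :: "('k, 'a) normed_alg \<Rightarrow> ('k, 'a, 'e) bimodule \<Rightarrow> 'a \<times> 'e \<Rightarrow> real" where
  "sum_nrm A E = (\<lambda>(a, x). nrm A a + nrm E x)"

(* If the product p satisfies sum_nrm (p u v) \<le> C * sum_nrm u * sum_nrm v with C > 0, then
   C * sum_nrm is submultiplicative; C is taken to be the norm of p, or 1 if that is larger. *)
definition cocycle_const ::
  "('k, 'a) normed_alg \<Rightarrow> ('k, 'a, 'e) bimodule \<Rightarrow> ('a \<times> 'a \<Rightarrow> 'e) \<Rightarrow> real" where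
  "cocycle_const A E T = max 1 (Sup {sum_nrm A E (cocycle_mult A E T u v) |u v.
     u \<in> carrier A \<times> carrier E \<and> v \<in> carrier A \<times> carrier E \<and>
     sum_nrm A E u \<le> 1 \<and> sum_nrm A E v \<le> 1})"

definition cocycle_algebra ::
  "('k, 'a) normed_alg \<Rightarrow> ('k, 'a, 'e) bimodule \<Rightarrow> ('a \<times> 'a \<Rightarrow> 'e) \<Rightarrow> ('k, 'a \<times> 'e) normed_alg" where
  "cocycle_algebra A E T = \<lparr>
     carrier = carrier A \<times> carrier E,
     mult = cocycle_mult A E T,
     one = undefined,
     zero = (\<zero>\<^bsub>A\<^esub>, \<zero>\<^bsub>E\<^esub>),
     add = (\<lambda>(a, x) (b, y). (a \<oplus>\<^bsub>A\<^esub> b, x \<oplus>\<^bsub>E\<^esub> y)),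
     smult = (\<lambda>c (a, x). (c \<odot>\<^bsub>A\<^esub> a, c \<odot>\<^bsub>E\<^esub> x)),
     nrm = (\<lambda>u. cocycle_const A E T * sum_nrm A E u)\<rparr>"

definition cocycle_extension :: "('k, 'a) normed_alg \<Rightarrow> ('k, 'a, 'e) bimodule \<Rightarrow>
    ('a \<times> 'a \<Rightarrow> 'e) \<Rightarrow> ('k, 'a, 'e, 'a \<times> 'e) extension" where
  "cocycle_extension A E T = \<lparr>
     ext_alg = cocycle_algebra A E T,
     ext_incl = (\<lambda>x. (\<zero>\<^bsub>A\<^esub>, x)),
     ext_quot = fst\<rparr>"

end

theory Submission
  imports Defs
begin

text \<open>
  If \<open>Q\<close> is a linear section of a singular admissible extension \<open>X\<close>, then \<open>Q a Q b - Q (a b)\<close> lies in the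
  kernel and is a 2-cocycle \<open>T\<close>; the map \<open>(a, x) \<mapsto> Q a + \<iota> x\<close> is an equivalence from \<open>\<Sigma>(T)\<close> to \<open>X\<close>, continuous
  as soon as \<open>Q\<close> is bounded. Taking \<open>X = \<Sigma>(T')\<close> and \<open>Q a = (a, S a)\<close>, this is an equivalence exactly when
  \<open>T - T' = \<delta>\<^sup>1 S\<close>. Analysis enters twice, each time through the bounded inverse theorem: inverses of strong
  equivalences are continuous, and admissibility yields a bounded retraction of \<open>X\<close> onto \<open>E\<close>, which turns
  compactness of \<open>Q a Q b - Q (a b)\<close> in \<open>X\<close> into compactness of \<open>T\<close> in \<open>E\<close>.
\<close>

section \<open>Normed spaces on carrier sets\<close>

text \<open>Classes consist of extensions whose algebra lives in one type \<open>'m\<close>, while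
  \<open>\<Sigma>T\<close> lives on pairs and so need not belong to its own class. If
  \<open>'m\<close> were too small, all classes could be empty and injectivity would fail. The
  injection \<open>univ\<close> prevents this: each \<open>\<Sigma>T\<close> is transported
  isometrically along it, and classes are compared through such copies. A cf-section
  \<open>Q\<close> may be unbounded, so it cannot supply the bounded retraction onto
  \<open>E\<close>; that comes from the section which admissibility provides. For the same reason an
  unbounded \<open>Q\<close> yields only an algebraic equivalence with some
  \<open>\<Sigma>T\<close>. But \<open>\<Sigma>T\<close> itself cf-splits strongly by its zero
  section, and this is why, up to plain equivalence, cf-splitting and strong cf-splitting single out
  the same classes. Compactness is handled as total boundedness of the image of the open unit balls,
  which passes to images, differences and subsets without closures. It also makes a compact cocycle
  bounded, hence the product on \<open>A \<oplus> E\<close> continuous.\<close>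

lemma cring_scalars: "cring (scalars :: 'k::real_normed_field ring)"
proof (rule cringI)
  show "abelian_group (scalars :: 'k ring)"
    by (rule abelian_groupI)
       (auto simp: scalars_def algebra_simps intro: exI[of _ "- x" for x])
  show "comm_monoid (scalars :: 'k ring)"
    by (rule comm_monoidI) (auto simp: scalars_def algebra_simps)
qed (auto simp: scalars_def algebra_simps)

text \<open>States the axioms with the operations of the scalar type, so that the three spaces built
  later (the sum \<open>A \<oplus> E\<close>, \<open>zero_mult E\<close> and a transported algebra)
  need no reasoning about the ring \<open>scalars\<close>.\<close>

lemma normed_spaceI:
  fixes V (structure)
  assumes "abelian_group V"
    and "\<And>c x. x \<in> carrier V \<Longrightarrow> c \<odot> x \<in> carrier V"
    and "\<And>c d x. x \<in> carrier V \<Longrightarrow> (c + d) \<odot> x = c \<odot> x \<oplus> d \<odot> x"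
    and "\<And>c x y. \<lbrakk>x \<in> carrier V; y \<in> carrier V\<rbrakk> \<Longrightarrow> c \<odot> (x \<oplus> y) = c \<odot> x \<oplus> c \<odot> y"
    and "\<And>c d x. x \<in> carrier V \<Longrightarrow> (c * d) \<odot> x = c \<odot> (d \<odot> x)"
    and "\<And>x. x \<in> carrier V \<Longrightarrow> 1 \<odot> x = x"
    and "\<And>x. x \<in> carrier V \<Longrightarrow> 0 \<le> nrm V x"
    and "\<And>x. x \<in> carrier V \<Longrightarrow> nrm V x = 0 \<longleftrightarrow> x = \<zero>"
    and "\<And>x y. \<lbrakk>x \<in> carrier V; y \<in> carrier V\<rbrakk> \<Longrightarrow> nrm V (x \<oplus> y) \<le> nrm V x + nrm V y"
    and "\<And>c x. x \<in> carrier V \<Longrightarrow> nrm V (c \<odot> x) = norm c * nrm V x"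
  shows "normed_space V"
proof -
  have "Module.module scalars V"
    by (rule moduleI[OF cring_scalars assms(1)]) (use assms(2-6) in \<open>auto simp: scalars_def\<close>)
  then show ?thesis
    unfolding normed_space_def normed_space_axioms_def using assms(7-10) by blast
qed

context normed_space
begin

lemma smul_closed [simp, intro]: "x \<in> carrier V \<Longrightarrow> c \<odot> x \<in> carrier V"
  using smult_closed[of c x] by (simp add: scalars_def)

lemma smul_add_left: "x \<in> carrier V \<Longrightarrow> (c + d) \<odot> x = c \<odot> x \<oplus> d \<odot> x"
  using smult_l_distr[of c d x] by (simp add: scalars_def)

lemma smul_add_right:
  "\<lbrakk>x \<in> carrier V; y \<in> carrier V\<rbrakk> \<Longrightarrow> c \<odot> (x \<oplus> y) = c \<odot> x \<oplus> c \<odot> y"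
  using smult_r_distr[of c x y] by (simp add: scalars_def)

lemma smul_smul: "x \<in> carrier V \<Longrightarrow> c \<odot> (d \<odot> x) = (c * d) \<odot> x"
  using smult_assoc1[of c d x] by (simp add: scalars_def)

lemma smul_one [simp]: "x \<in> carrier V \<Longrightarrow> 1 \<odot> x = x"
  using smult_one[of x] by (simp add: scalars_def)

lemma smul_zero_left [simp]: "x \<in> carrier V \<Longrightarrow> 0 \<odot> x = \<zero>"
  using smult_l_null[of x] by (simp add: scalars_def)

lemma smul_zero_right [simp]: "c \<odot> \<zero> = \<zero>"
  using smult_r_null[of c] by (simp add: scalars_def)

lemma minus_eq_smul: "x \<in> carrier V \<Longrightarrow> \<ominus> x = (-1) \<odot> x"
  using smul_add_left[of x "-1" 1] by (intro minus_equality) auto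

lemma smul_minus: "x \<in> carrier V \<Longrightarrow> c \<odot> (\<ominus> x) = \<ominus> (c \<odot> x)"
  by (simp add: minus_eq_smul smul_smul)

lemma smul_diff:
  "\<lbrakk>x \<in> carrier V; y \<in> carrier V\<rbrakk> \<Longrightarrow> c \<odot> (x \<ominus> y) = c \<odot> x \<ominus> c \<odot> y"
  by (simp add: a_minus_def smul_add_right smul_minus)

lemma nrm_zero [simp]: "nrm V \<zero> = 0"
  by (simp add: nrm_eq_zero)

lemma nrm_minus [simp]: "x \<in> carrier V \<Longrightarrow> nrm V (\<ominus> x) = nrm V x"
  by (simp add: minus_eq_smul nrm_smult)

lemma diff_self [simp]: "x \<in> carrier V \<Longrightarrow> x \<ominus> x = \<zero>"
  by (simp add: a_minus_def r_neg)

lemma diff_zero [simp]: "x \<in> carrier V \<Longrightarrow> x \<ominus> \<zero> = x"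
  by (simp add: a_minus_def)

lemma minus_diff: "\<lbrakk>x \<in> carrier V; y \<in> carrier V\<rbrakk> \<Longrightarrow> \<ominus> (x \<ominus> y) = y \<ominus> x"
  by (simp add: a_minus_def minus_add a_comm)

lemma diff_add_diff:
  "\<lbrakk>x \<in> carrier V; y \<in> carrier V; z \<in> carrier V\<rbrakk> \<Longrightarrow> (x \<ominus> y) \<oplus> (y \<ominus> z) = x \<ominus> z"
  by (simp add: a_minus_def a_assoc r_neg1)

lemma add_diff_cancel [simp]:
  "\<lbrakk>x \<in> carrier V; y \<in> carrier V\<rbrakk> \<Longrightarrow> x \<oplus> y \<ominus> y = x"
  by (simp add: a_minus_def a_assoc r_neg)

lemma diff_add_cancel [simp]:
  "\<lbrakk>x \<in> carrier V; y \<in> carrier V\<rbrakk> \<Longrightarrow> x \<ominus> y \<oplus> y = x"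
  by (simp add: a_minus_def a_assoc l_neg)

lemma diff_eq_iff:
  "\<lbrakk>x \<in> carrier V; y \<in> carrier V; z \<in> carrier V\<rbrakk> \<Longrightarrow> x \<ominus> y = z \<longleftrightarrow> x = z \<oplus> y"
  by auto

lemma diff_eq_zero_iff: "\<lbrakk>x \<in> carrier V; y \<in> carrier V\<rbrakk> \<Longrightarrow> x \<ominus> y = \<zero> \<longleftrightarrow> x = y"
  by (simp add: diff_eq_iff)

lemma add_diff_add:
  "\<lbrakk>x \<in> carrier V; y \<in> carrier V; x' \<in> carrier V; y' \<in> carrier V\<rbrakk> \<Longrightarrow>
    (x \<oplus> y) \<ominus> (x' \<oplus> y') = (x \<ominus> x') \<oplus> (y \<ominus> y')"
  by (simp add: a_minus_def minus_add a_ac)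

lemma diff_diff_diff:
  "\<lbrakk>x \<in> carrier V; y \<in> carrier V; x' \<in> carrier V; y' \<in> carrier V\<rbrakk> \<Longrightarrow>
    (x \<ominus> y) \<ominus> (x' \<ominus> y') = (x \<ominus> x') \<ominus> (y \<ominus> y')"
  by (simp add: a_minus_def minus_add a_ac)

lemma nrm_diff_commute:
  "\<lbrakk>x \<in> carrier V; y \<in> carrier V\<rbrakk> \<Longrightarrow> nrm V (x \<ominus> y) = nrm V (y \<ominus> x)"
  by (metis minus_closed minus_diff nrm_minus)

lemma nrm_diff_triangle:
  "\<lbrakk>x \<in> carrier V; y \<in> carrier V; z \<in> carrier V\<rbrakk> \<Longrightarrow>
    nrm V (x \<ominus> z) \<le> nrm V (x \<ominus> y) + nrm V (y \<ominus> z)"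
  by (metis minus_closed diff_add_diff nrm_triangle)

lemma nrm_diff_le: "\<lbrakk>x \<in> carrier V; y \<in> carrier V\<rbrakk> \<Longrightarrow> nrm V (x \<ominus> y) \<le> nrm V x + nrm V y"
  by (metis a_inv_closed a_minus_def nrm_minus nrm_triangle)

lemma Metric_space_ndist: "Metric_space (carrier V) (ndist V)"
  by unfold_locales
    (auto simp: ndist_def nrm_nonneg nrm_diff_commute nrm_eq_zero diff_eq_zero_iff nrm_diff_triangle)

end

sublocale normed_space \<subseteq> metric: Metric_space "carrier V" "ndist V"
  by (rule Metric_space_ndist)

context normed_space
begin

lemma ndist_eq [simp]: "\<lbrakk>x \<in> carrier V; y \<in> carrier V\<rbrakk> \<Longrightarrow> ndist V x y = nrm V (x \<ominus> y)"
  by (simp add: ndist_def)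

lemma ntop_eq: "ntop V = metric.mtopology"
  by (simp add: ntop_def)

end

text \<open>Completeness turns compactness of a closure into a covering condition on the set itself,
  which can be pushed through bounded maps and differences with finite nets.\<close>

lemma (in banach_space) compact_closure_iff_totally_bounded:
  "S \<subseteq> carrier V \<Longrightarrow> compactin (ntop V) (ntop V closure_of S) \<longleftrightarrow> metric.mtotally_bounded S"
  using metric.mtotally_bounded_eq_compact_closure_of[OF complete] by (simp add: ntop_eq)

lemma (in normed_space) MCauchy_iff:
  "metric.MCauchy s \<longleftrightarrow> (\<forall>n. s n \<in> carrier V) \<and>
    (\<forall>\<epsilon>>0. \<exists>N. \<forall>m\<ge>N. \<forall>n\<ge>N. nrm V (s m \<ominus> s n) < \<epsilon>)"
proof (cases "\<forall>n. s n \<in> carrier V")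
  case True
  then have "ndist V (s m) (s n) = nrm V (s m \<ominus> s n)" for m n by simp
  then show ?thesis
    unfolding metric.MCauchy_def using True by auto
qed (auto simp: metric.MCauchy_def)

lemma (in normed_space) limitin_iff:
  fixes s :: "nat \<Rightarrow> 'v"
  assumes "\<And>n. s n \<in> carrier V"
  shows "limitin metric.mtopology s l sequentially \<longleftrightarrow>
    l \<in> carrier V \<and> (\<lambda>n. nrm V (s n \<ominus> l)) \<longlonglongrightarrow> 0"
  using assms nrm_nonneg by (auto simp: metric.limitin_metric_dist_null)

lemma (in banach_space) complete_sequence:
  assumes "\<And>n. s n \<in> carrier V"
    and "\<And>\<epsilon>. \<epsilon> > 0 \<Longrightarrow> \<exists>N. \<forall>m\<ge>N. \<forall>n\<ge>N. nrm V (s m \<ominus> s n) < \<epsilon>"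
  obtains l where "l \<in> carrier V" "(\<lambda>n. nrm V (s n \<ominus> l)) \<longlonglongrightarrow> 0"
proof -
  have "metric.MCauchy s" using assms by (simp add: MCauchy_iff)
  then show thesis
    using complete that limitin_iff[of s] assms(1) unfolding metric.mcomplete_def by blast
qed

lemma banach_spaceI:
  fixes V (structure)
  assumes "normed_space V"
    and "\<And>s :: nat \<Rightarrow> _. \<lbrakk>\<And>n. s n \<in> carrier V;
            \<And>\<epsilon>. \<epsilon> > 0 \<Longrightarrow> \<exists>N. \<forall>m\<ge>N. \<forall>n\<ge>N. nrm V (s m \<ominus> s n) < \<epsilon>\<rbrakk>
          \<Longrightarrow> \<exists>l\<in>carrier V. (\<lambda>n. nrm V (s n \<ominus> l)) \<longlonglongrightarrow> 0"
  shows "banach_space V"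
proof -
  interpret normed_space V by fact
  have "metric.mcomplete"
    unfolding metric.mcomplete_def MCauchy_iff
  proof (intro allI impI, elim conjE)
    fix s :: "nat \<Rightarrow> _" assume s: "\<forall>n. s n \<in> carrier V"
      "\<forall>\<epsilon>>0. \<exists>N. \<forall>m\<ge>N. \<forall>n\<ge>N. nrm V (s m \<ominus> s n) < \<epsilon>"
    then obtain l where "l \<in> carrier V" "(\<lambda>n. nrm V (s n \<ominus> l)) \<longlonglongrightarrow> 0"
      using assms(2)[of s] by blast
    then show "\<exists>x. limitin metric.mtopology s x sequentially"
      using s(1) limitin_iff[of s l] by blast
  qed
  then show ?thesis
    by unfold_locales
qed

section \<open>Linear maps\<close>

lemma linear_onD:
  assumes "linear_on V W f"
  shows "x \<in> carrier V \<Longrightarrow> f x \<in> carrier W"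
    and "\<lbrakk>x \<in> carrier V; y \<in> carrier V\<rbrakk> \<Longrightarrow> f (x \<oplus>\<^bsub>V\<^esub> y) = f x \<oplus>\<^bsub>W\<^esub> f y"
    and "x \<in> carrier V \<Longrightarrow> f (c \<odot>\<^bsub>V\<^esub> x) = c \<odot>\<^bsub>W\<^esub> f x"
  using assms by (auto simp: linear_on_def)

lemma linear_on_compose:
  "\<lbrakk>linear_on U V f; linear_on V W g\<rbrakk> \<Longrightarrow> linear_on U W (\<lambda>x. g (f x))"
  by (auto simp: linear_on_def Pi_iff)

lemma bounded_linear_onD: "bounded_linear_on V W f \<Longrightarrow> linear_on V W f"
  by (simp add: bounded_linear_on_def)

locale normed_pair = V: normed_space V + W: normed_space W
  for V :: "('k::real_normed_field, 'v, 'y) normed_alg_scheme"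
    and W :: "('k, 'w, 'z) normed_alg_scheme"
begin

context
  fixes f
  assumes lin: "linear_on V W f"
begin

lemmas linear_simps = linear_onD[OF lin]

lemma linear_zero: "f \<zero>\<^bsub>V\<^esub> = \<zero>\<^bsub>W\<^esub>"
  using linear_simps(3)[of "\<zero>\<^bsub>V\<^esub>" 0] linear_simps(1) by simp

lemma linear_minus: "x \<in> carrier V \<Longrightarrow> f (\<ominus>\<^bsub>V\<^esub> x) = \<ominus>\<^bsub>W\<^esub> f x"
  by (simp add: V.minus_eq_smul W.minus_eq_smul linear_simps)

lemma linear_diff:
  "\<lbrakk>x \<in> carrier V; y \<in> carrier V\<rbrakk> \<Longrightarrow> f (x \<ominus>\<^bsub>V\<^esub> y) = f x \<ominus>\<^bsub>W\<^esub> f y"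
  by (simp add: a_minus_def linear_minus linear_simps)

end

lemma linear_inv_into:
  assumes lin: "linear_on V W f" and bij: "bij_betw f (carrier V) (carrier W)"
  shows "linear_on W V (inv_into (carrier V) f)"
proof -
  let ?g = "inv_into (carrier V) f"
  have g: "?g y \<in> carrier V" "f (?g y) = y" if "y \<in> carrier W" for y
    using that bij by (auto simp: bij_betw_def f_inv_into_f inv_into_into)
  have gf: "?g (f x) = x" if "x \<in> carrier V" for x
    using that bij by (auto simp: bij_betw_def)
  note l = linear_onD[OF lin]
  show ?thesis
    unfolding linear_on_def
  proof (intro conjI ballI allI)
    fix x y assume "x \<in> carrier W" "y \<in> carrier W"
    then have "f (?g x \<oplus>\<^bsub>V\<^esub> ?g y) = x \<oplus>\<^bsub>W\<^esub> y" "?g x \<oplus>\<^bsub>V\<^esub> ?g y \<in> carrier V"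
      using g l(2) by auto
    then show "?g (x \<oplus>\<^bsub>W\<^esub> y) = ?g x \<oplus>\<^bsub>V\<^esub> ?g y"
      by (metis gf)
  next
    fix c x assume "x \<in> carrier W"
    then have "f (c \<odot>\<^bsub>V\<^esub> ?g x) = c \<odot>\<^bsub>W\<^esub> x" "c \<odot>\<^bsub>V\<^esub> ?g x \<in> carrier V"
      using g l(3) by auto
    then show "?g (c \<odot>\<^bsub>W\<^esub> x) = c \<odot>\<^bsub>V\<^esub> ?g x"
      by (metis gf)
  qed (use g in auto)
qed

text \<open>A strictly positive bound can be divided by, as the radii \<open>\<epsilon> / K\<close>
  of the later estimates require.\<close>

lemma bounded_linear_pos_bound:
  assumes "bounded_linear_on V W f"
  obtains K where "K > 0" "\<And>x. x \<in> carrier V \<Longrightarrow> nrm W (f x) \<le> K * nrm V x"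
proof -
  obtain K where K: "\<And>x. x \<in> carrier V \<Longrightarrow> nrm W (f x) \<le> K * nrm V x"
    using assms by (auto simp: bounded_linear_on_def)
  have "nrm W (f x) \<le> max K 1 * nrm V x" if "x \<in> carrier V" for x
    using K[OF that] mult_right_mono[OF max.cobounded1[of K 1] V.nrm_nonneg[OF that]] by linarith
  then show thesis
    by (intro that[of "max K 1"]) auto
qed

lemma bounded_linear_imp_continuous:
  assumes "bounded_linear_on V W f"
  shows "continuous_map (ntop V) (ntop W) f"
proof -
  note lin = bounded_linear_onD[OF assms]
  obtain K where K: "K > 0" "\<And>x. x \<in> carrier V \<Longrightarrow> nrm W (f x) \<le> K * nrm V x"
    using assms by (rule bounded_linear_pos_bound) blast
  have "\<exists>\<delta>>0. \<forall>x. x \<in> carrier V \<and> ndist V a x < \<delta> \<longrightarrow> ndist W (f a) (f x) < \<epsilon>"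
    if "a \<in> carrier V" "\<epsilon> > 0" for a \<epsilon>
  proof (intro exI[of _ "\<epsilon> / K"] conjI allI impI)
    fix x assume "x \<in> carrier V \<and> ndist V a x < \<epsilon> / K"
    then have x: "x \<in> carrier V" "ndist V a x < \<epsilon> / K" by auto
    have "nrm W (f a \<ominus>\<^bsub>W\<^esub> f x) \<le> K * nrm V (a \<ominus>\<^bsub>V\<^esub> x)"
      using K(2)[of "a \<ominus>\<^bsub>V\<^esub> x"] x that by (simp add: linear_diff[OF lin])
    also have "\<dots> < \<epsilon>"
      using x that K(1) by (simp add: pos_less_divide_eq mult.commute)
    finally show "ndist W (f a) (f x) < \<epsilon>"
      using x that linear_onD[OF lin] by simp
  qed (use that K in simp)
  then show ?thesis
    unfolding V.ntop_eq W.ntop_eq V.metric.metric_continuous_map[OF W.Metric_space_ndist]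
    using linear_onD(1)[OF lin] by blast
qed

text \<open>Strong equivalence asks for continuity, whereas the bounded inverse theorem speaks of
  bounds. The bound comes from scaling a vector into a ball around 0 on which the image stays below
  norm 1.\<close>

lemma continuous_linear_imp_bounded:
  assumes lin: "linear_on V W f" and "continuous_map (ntop V) (ntop W) f"
  shows "bounded_linear_on V W f"
proof -
  note l = linear_onD[OF lin]
  obtain \<delta> where \<delta>: "\<delta> > 0" "\<And>x. \<lbrakk>x \<in> carrier V; ndist V \<zero>\<^bsub>V\<^esub> x < \<delta>\<rbrakk> \<Longrightarrow> ndist W (f \<zero>\<^bsub>V\<^esub>) (f x) < 1"
    using assms(2) unfolding V.ntop_eq W.ntop_eq V.metric.metric_continuous_map[OF W.Metric_space_ndist]
    by (metis V.zero_closed zero_less_one)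
  have small: "nrm W (f x) < 1" if "x \<in> carrier V" "nrm V x < \<delta>" for x
    using \<delta>(2)[of x] that l(1) W.nrm_diff_commute[of "\<zero>\<^bsub>W\<^esub>" "f x"] V.nrm_diff_commute[of "\<zero>\<^bsub>V\<^esub>" "x"]
    by (simp add: linear_zero[OF lin])
  have "nrm W (f x) \<le> 2 / \<delta> * nrm V x" if x: "x \<in> carrier V" for x
  proof (cases "nrm V x = 0")
    case True
    then show ?thesis using x by (simp add: V.nrm_eq_zero linear_zero[OF lin])
  next
    case False
    then have pos: "nrm V x > 0" using V.nrm_nonneg[OF x] by simp
    \<comment> \<open>The factor brings \<open>x\<close> to norm \<delta> / 2, strictly inside the
      ball of \<open>small\<close>. It is an embedded real number, so the argument covers every
      scalar field.\<close>
    let ?c = "of_real (\<delta> / (2 * nrm V x)) :: 'k"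
    have c: "norm ?c = \<delta> / (2 * nrm V x)"
      using pos \<delta>(1) by (simp only: norm_of_real) simp
    have "nrm W (f (?c \<odot>\<^bsub>V\<^esub> x)) < 1"
      using x pos \<delta>(1) by (intro small) (simp_all only: V.nrm_smult c V.smul_closed, simp)
    then have "\<delta> / (2 * nrm V x) * nrm W (f x) < 1"
      using x l(1)[OF x] by (simp only: l(3)[OF x] W.nrm_smult c)
    then show ?thesis
      using pos \<delta>(1) by (simp add: field_simps)
  qed
  then show ?thesis
    using lin unfolding bounded_linear_on_def by blast
qed

end

lemma bounded_linear_on_compose:
  assumes "normed_space U" "normed_space V" "normed_space W"
    and f: "bounded_linear_on U V f" and g: "bounded_linear_on V W g"
  shows "bounded_linear_on U W (\<lambda>x. g (f x))"
proof -
  interpret UV: normed_pair U V using assms by (simp add: normed_pair_def)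
  interpret VW: normed_pair V W using assms by (simp add: normed_pair_def)
  obtain K where K: "K > 0" "\<And>x. x \<in> carrier U \<Longrightarrow> nrm V (f x) \<le> K * nrm U x"
    using f by (rule UV.bounded_linear_pos_bound) blast
  obtain L where L: "L > 0" "\<And>x. x \<in> carrier V \<Longrightarrow> nrm W (g x) \<le> L * nrm V x"
    using g by (rule VW.bounded_linear_pos_bound) blast
  have "nrm W (g (f x)) \<le> L * K * nrm U x" if "x \<in> carrier U" for x
  proof -
    have "nrm W (g (f x)) \<le> L * nrm V (f x)"
      using L(2) linear_onD(1)[OF bounded_linear_onD[OF f] that] by blast
    also have "\<dots> \<le> L * (K * nrm U x)"
      using K(2)[OF that] L(1) by simp
    finally show ?thesis by (simp add: mult.assoc)
  qed
  moreover have "linear_on U W (\<lambda>x. g (f x))"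
    by (rule linear_on_compose[OF bounded_linear_onD[OF f] bounded_linear_onD[OF g]])
  ultimately show ?thesis
    by (auto simp: bounded_linear_on_def)
qed

section \<open>The open mapping theorem\<close>

locale banach_surjection = V: banach_space V + W: banach_space W
  for V :: "('k::real_normed_field, 'v, 'y) normed_alg_scheme"
    and W :: "('k, 'w, 'z) normed_alg_scheme" +
  fixes f
  assumes bounded: "bounded_linear_on V W f"
    and surj: "f ` carrier V = carrier W"
begin

sublocale normed_pair V W ..

lemmas lin = bounded_linear_onD[OF bounded]
lemmas f_simps = linear_onD[OF lin]

lemma f_closed [simp]: "x \<in> carrier V \<Longrightarrow> f x \<in> carrier W"
  by (rule f_simps(1))

text \<open>Baire's theorem in the complete space \<open>W\<close>: by surjectivity the closed sets
  \<open>?C n\<close> exhaust \<open>W\<close>, so one of them has an interior point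
  \<open>y\<close>. This point need not be 0, which \<open>approximate_preimage\<close> repairs by
  taking differences.\<close>

lemma image_ball_dense_in_ball:
  obtains n r y where "r > 0" "y \<in> carrier W"
    "W.metric.mball y r \<subseteq>
      W.metric.mtopology closure_of (f ` {x \<in> carrier V. nrm V x \<le> real n})"
proof -
  let ?C = "\<lambda>n. W.metric.mtopology closure_of (f ` {x \<in> carrier V. nrm V x \<le> real n})"
  have "\<exists>n. y \<in> ?C n" if y: "y \<in> carrier W" for y
  proof -
    obtain x where x: "x \<in> carrier V" "y = f x" using y surj by blast
    obtain n where "nrm V x \<le> real n" using real_arch_simple by blast
    then have "y \<in> f ` {x \<in> carrier V. nrm V x \<le> real n}" using x by blast
    moreover have "f ` {x \<in> carrier V. nrm V x \<le> real n} \<subseteq> ?C n"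
      by (rule closure_of_subset) (use f_simps(1) in auto)
    ultimately show ?thesis by blast
  qed
  moreover have C_sub: "?C n \<subseteq> carrier W" for n
    using closure_of_subset_topspace[of W.metric.mtopology] by simp
  ultimately have union: "\<Union>(range ?C) = carrier W" by blast
  then have "W.metric.mtopology interior_of \<Union>(range ?C) \<noteq> {}"
    using interior_of_topspace[of W.metric.mtopology] W.zero_closed unfolding union by auto
  moreover have "countable (range ?C)" "closedin W.metric.mtopology (?C n)" for n
    by (simp_all only: closedin_closure_of) simp
  ultimately obtain n where "W.metric.mtopology interior_of ?C n \<noteq> {}"
    using W.metric.metric_Baire_category_alt[OF W.complete, of "range ?C"] by blast
  then obtain y where y: "y \<in> W.metric.mtopology interior_of ?C n" by blast
  have "openin W.metric.mtopology (W.metric.mtopology interior_of ?C n)" by simp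
  then obtain r where "r > 0" "W.metric.mball y r \<subseteq> W.metric.mtopology interior_of ?C n"
    using y unfolding W.metric.openin_mtopology by blast
  moreover have "y \<in> carrier W"
    using y interior_of_subset[of W.metric.mtopology "?C n"] C_sub by blast
  ultimately show thesis
    using that[of r y n] interior_of_subset[of W.metric.mtopology "?C n"] by blast
qed

text \<open>Differences of approximations near \<open>y\<close> approximate every small
  \<open>z\<close>, and scaling extends this to all \<open>z\<close>. An error of half the norm is
  left; \<open>bounded_preimage\<close> removes it by iteration.\<close>

lemma approximate_preimage:
  obtains M where "M \<ge> 0"
    "\<And>z. z \<in> carrier W \<Longrightarrow>
      \<exists>x\<in>carrier V. nrm V x \<le> M * nrm W z \<and> nrm W (z \<ominus>\<^bsub>W\<^esub> f x) \<le> nrm W z / 2"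
proof -
  obtain n r y where r: "r > 0" and y: "y \<in> carrier W" and
    ball: "W.metric.mball y r \<subseteq>
      W.metric.mtopology closure_of (f ` {x \<in> carrier V. nrm V x \<le> real n})"
    by (rule image_ball_dense_in_ball)
  have approx: "\<exists>u\<in>carrier V. nrm V u \<le> real n \<and> nrm W (w \<ominus>\<^bsub>W\<^esub> f u) < \<epsilon>"
    if "w \<in> carrier W" "nrm W (y \<ominus>\<^bsub>W\<^esub> w) < r" and \<epsilon>: "\<epsilon> > 0" for w \<epsilon>
  proof -
    have "w \<in> W.metric.mball y r" using that y by simp
    then have "w \<in> W.metric.mtopology closure_of (f ` {x \<in> carrier V. nrm V x \<le> real n})"
      using ball by blast
    then obtain u where "u \<in> carrier V" "nrm V u \<le> real n" "f u \<in> W.metric.mball w \<epsilon>"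
      unfolding W.metric.metric_closure_of using \<epsilon> by blast
    then show ?thesis using that(1) by auto
  qed
  \<comment> \<open>\<open>z\<close> is the difference of \<open>y \<oplus> z\<close> and
    \<open>y\<close>, both within \<open>r\<close> of \<open>y\<close>. Approximating each by the
    image of a vector of norm at most \<open>n\<close> gives the bound \<open>2 * n\<close>.\<close>
  have near: "\<exists>x\<in>carrier V. nrm V x \<le> 2 * real n \<and> nrm W (z \<ominus>\<^bsub>W\<^esub> f x) < \<epsilon>"
    if z: "z \<in> carrier W" "nrm W z < r" and \<epsilon>: "\<epsilon> > 0" for z \<epsilon>
  proof -
    have "y \<ominus>\<^bsub>W\<^esub> (y \<oplus>\<^bsub>W\<^esub> z) = \<ominus>\<^bsub>W\<^esub> z"
      using y z by (simp add: a_minus_def W.minus_add W.r_neg2)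
    then obtain u where u: "u \<in> carrier V" "nrm V u \<le> real n"
      "nrm W ((y \<oplus>\<^bsub>W\<^esub> z) \<ominus>\<^bsub>W\<^esub> f u) < \<epsilon> / 2"
      using approx[of "y \<oplus>\<^bsub>W\<^esub> z" "\<epsilon> / 2"] y z \<epsilon> by auto
    obtain v where v: "v \<in> carrier V" "nrm V v \<le> real n" "nrm W (y \<ominus>\<^bsub>W\<^esub> f v) < \<epsilon> / 2"
      using approx[of y "\<epsilon> / 2"] y r \<epsilon> by auto
    have "z \<ominus>\<^bsub>W\<^esub> f (u \<ominus>\<^bsub>V\<^esub> v) = ((y \<oplus>\<^bsub>W\<^esub> z) \<ominus>\<^bsub>W\<^esub> f u) \<ominus>\<^bsub>W\<^esub> (y \<ominus>\<^bsub>W\<^esub> f v)"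
      using u v z y W.add_diff_cancel[of z y]
      by (simp add: W.diff_diff_diff linear_diff[OF lin] W.a_comm)
    then have "nrm W (z \<ominus>\<^bsub>W\<^esub> f (u \<ominus>\<^bsub>V\<^esub> v)) < \<epsilon>"
      using u v y z W.nrm_diff_le[of "(y \<oplus>\<^bsub>W\<^esub> z) \<ominus>\<^bsub>W\<^esub> f u" "y \<ominus>\<^bsub>W\<^esub> f v"] by simp
    moreover have "nrm V (u \<ominus>\<^bsub>V\<^esub> v) \<le> 2 * real n"
      using V.nrm_diff_le[of u v] u v by simp
    ultimately show ?thesis
      using u(1) v(1) by blast
  qed
  show thesis
  proof (rule that[of "4 * real n / r"])
    fix z assume z: "z \<in> carrier W"
    show "\<exists>x\<in>carrier V. nrm V x \<le> 4 * real n / r * nrm W z \<and> nrm W (z \<ominus>\<^bsub>W\<^esub> f x) \<le> nrm W z / 2"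
    proof (cases "nrm W z = 0")
      case True
      then show ?thesis
        using z W.nrm_eq_zero by (intro bexI[of _ "\<zero>\<^bsub>V\<^esub>"]) (auto simp: linear_zero[OF lin])
    next
      case False
      then have pos: "nrm W z > 0" using W.nrm_nonneg[OF z] by simp
      \<comment> \<open>\<open>t\<close> scales \<open>z\<close> to norm \<open>r / 2\<close>,
        within reach of \<open>near\<close>. Scaling back by \<open>1 / t = 2 * nrm W z / r\<close>
        turns the tolerance \<open>r / 4\<close> into \<open>nrm W z / 2\<close> and the bound
        \<open>2 * n\<close> into \<open>4 * n / r * nrm W z\<close>.\<close>
      define t where "t = r / (2 * nrm W z)"
      have t: "t > 0" using pos r by (simp add: t_def)
      let ?c = "of_real t :: 'k" and ?d = "of_real (1 / t) :: 'k"
      have "nrm W (?c \<odot>\<^bsub>W\<^esub> z) < r"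
        using z pos r t by (simp add: W.nrm_smult) (simp add: t_def)
      then obtain v where v: "v \<in> carrier V" "nrm V v \<le> 2 * real n"
        "nrm W (?c \<odot>\<^bsub>W\<^esub> z \<ominus>\<^bsub>W\<^esub> f v) < r / 4"
        using near[of "?c \<odot>\<^bsub>W\<^esub> z" "r / 4"] z r by auto
      have "?d * ?c = 1" using t by (simp flip: of_real_mult)
      then have "z \<ominus>\<^bsub>W\<^esub> f (?d \<odot>\<^bsub>V\<^esub> v) = ?d \<odot>\<^bsub>W\<^esub> (?c \<odot>\<^bsub>W\<^esub> z \<ominus>\<^bsub>W\<^esub> f v)"
        using z v by (simp add: W.smul_diff W.smul_smul f_simps del: of_real_divide)
      moreover have nd: "norm ?d = 1 / t" using t by (simp only: norm_of_real) simp
      ultimately have "nrm W (z \<ominus>\<^bsub>W\<^esub> f (?d \<odot>\<^bsub>V\<^esub> v)) = 1 / t * nrm W (?c \<odot>\<^bsub>W\<^esub> z \<ominus>\<^bsub>W\<^esub> f v)"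
        using z v by (simp add: W.nrm_smult del: of_real_divide)
      also have "\<dots> \<le> 1 / t * (r / 4)"
        using t v(3) by (intro mult_left_mono) auto
      also have "\<dots> = nrm W z / 2"
        using r pos by (simp add: t_def)
      finally have "nrm W (z \<ominus>\<^bsub>W\<^esub> f (?d \<odot>\<^bsub>V\<^esub> v)) \<le> nrm W z / 2" .
      moreover have "nrm V (?d \<odot>\<^bsub>V\<^esub> v) \<le> 1 / t * (2 * real n)"
        unfolding V.nrm_smult[OF v(1)] nd using t v(2) by (intro mult_left_mono) auto
      then have "nrm V (?d \<odot>\<^bsub>V\<^esub> v) \<le> 4 * real n / r * nrm W z"
        using r by (simp add: t_def mult_ac)
      ultimately show ?thesis
        using v(1) by (intro bexI[of _ "?d \<odot>\<^bsub>V\<^esub> v"]) auto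
    qed
  qed (use r in auto)
qed

text \<open>The remainder is approximated again and again. Its bound halves each time, so the
  corrections are dominated by a geometric series; they sum up in the complete space
  \<open>V\<close>, with total norm at most twice the first bound.\<close>

lemma bounded_preimage:
  obtains M where "\<And>y. y \<in> carrier W \<Longrightarrow> \<exists>x\<in>carrier V. f x = y \<and> nrm V x \<le> M * nrm W y"
proof -
  obtain M g where M: "M \<ge> 0" and g: "\<And>z. z \<in> carrier W \<Longrightarrow> g z \<in> carrier V"
    "\<And>z. z \<in> carrier W \<Longrightarrow> nrm V (g z) \<le> M * nrm W z"
    "\<And>z. z \<in> carrier W \<Longrightarrow> nrm W (z \<ominus>\<^bsub>W\<^esub> f (g z)) \<le> nrm W z / 2"
    using approximate_preimage by metis
  obtain K where K: "K > 0" "\<And>x. x \<in> carrier V \<Longrightarrow> nrm W (f x) \<le> K * nrm V x"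
    using bounded by (rule bounded_linear_pos_bound) blast
  have "\<exists>x\<in>carrier V. f x = y \<and> nrm V x \<le> 2 * M * nrm W y" if y: "y \<in> carrier W" for y
  proof -
    \<comment> \<open>Partial sums of the corrections: \<open>g\<close> picks an approximate
      preimage of what is still missing from \<open>y\<close>.\<close>
    define s where "s = rec_nat \<zero>\<^bsub>V\<^esub> (\<lambda>_ x. x \<oplus>\<^bsub>V\<^esub> g (y \<ominus>\<^bsub>W\<^esub> f x))"
    have s_simps: "s 0 = \<zero>\<^bsub>V\<^esub>" "s (Suc n) = s n \<oplus>\<^bsub>V\<^esub> g (y \<ominus>\<^bsub>W\<^esub> f (s n))" for n
      by (simp_all add: s_def)
    have s [simp]: "s n \<in> carrier V" for n
      by (induction n) (use y g(1) in \<open>auto simp: s_simps\<close>)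
    have rest: "nrm W (y \<ominus>\<^bsub>W\<^esub> f (s n)) \<le> nrm W y / 2 ^ n" for n
    proof (induction n)
      case 0
      then show ?case using y by (simp add: s_simps linear_zero[OF lin])
    next
      case (Suc n)
      let ?w = "y \<ominus>\<^bsub>W\<^esub> f (s n)"
      have w: "?w \<in> carrier W" using y by simp
      have "y \<ominus>\<^bsub>W\<^esub> f (s (Suc n)) = ?w \<ominus>\<^bsub>W\<^esub> f (g ?w)"
        using y g(1)[OF w] by (simp add: s_simps f_simps a_minus_def W.minus_add W.a_assoc)
      then show ?case using g(3)[OF w] Suc by simp
    qed
    have step: "nrm V (s (Suc n) \<ominus>\<^bsub>V\<^esub> s n) \<le> M * nrm W y / 2 ^ n" for n
    proof -
      have w: "y \<ominus>\<^bsub>W\<^esub> f (s n) \<in> carrier W" using y by simp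
      have "s (Suc n) \<ominus>\<^bsub>V\<^esub> s n = g (y \<ominus>\<^bsub>W\<^esub> f (s n))"
        using g(1)[OF w] by (simp add: s_simps V.a_comm[of "s n"])
      then show ?thesis
        using g(2)[OF w] mult_left_mono[OF rest[of n] M] by simp
    qed
    \<comment> \<open>The exact partial sum of the geometric series is carried along; with the
      coarser bound of \<open>tail\<close> the induction on \<open>k\<close> would not
      close.\<close>
    have dist: "nrm V (s (n + k) \<ominus>\<^bsub>V\<^esub> s n) \<le> 2 * M * nrm W y / 2 ^ n * (1 - 1 / 2 ^ k)" for n k
    proof (induction k)
      case (Suc k)
      have "nrm V (s (n + Suc k) \<ominus>\<^bsub>V\<^esub> s n) \<le>
          nrm V (s (Suc (n + k)) \<ominus>\<^bsub>V\<^esub> s (n + k)) + nrm V (s (n + k) \<ominus>\<^bsub>V\<^esub> s n)"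
        using V.nrm_diff_triangle by simp
      also have "\<dots> \<le> M * nrm W y / 2 ^ (n + k) + 2 * M * nrm W y / 2 ^ n * (1 - 1 / 2 ^ k)"
        using step[of "n + k"] Suc by linarith
      also have "\<dots> = 2 * M * nrm W y / 2 ^ n * (1 - 1 / 2 ^ Suc k)"
        by (simp add: power_add field_simps)
      finally show ?case .
    qed simp
    have tail: "nrm V (s (n + k) \<ominus>\<^bsub>V\<^esub> s n) \<le> 2 * M * nrm W y / 2 ^ n" for n k
    proof -
      have "2 * M * nrm W y / 2 ^ n * (1 - 1 / 2 ^ k) \<le> 2 * M * nrm W y / 2 ^ n * 1"
        using M W.nrm_nonneg[OF y] by (intro mult_left_mono) auto
      then show ?thesis using dist[of n k] by simp
    qed
    have "\<exists>N. \<forall>m\<ge>N. \<forall>n\<ge>N. nrm V (s m \<ominus>\<^bsub>V\<^esub> s n) < \<epsilon>" if \<epsilon>: "\<epsilon> > 0" for \<epsilon>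
    proof -
      have "(\<lambda>n. 2 * M * nrm W y * (1 / 2) ^ n) \<longlonglongrightarrow> 2 * M * nrm W y * 0"
        by (intro tendsto_intros) simp_all
      from order_tendstoD(2)[OF this, of "\<epsilon> / 2"] \<epsilon>
      obtain N where N: "2 * M * nrm W y / 2 ^ N < \<epsilon> / 2"
        by (auto simp: eventually_sequentially power_one_over)
      have near: "nrm V (s m \<ominus>\<^bsub>V\<^esub> s N) < \<epsilon> / 2" if "m \<ge> N" for m
        using tail[of N "m - N"] N that by simp
      have "nrm V (s m \<ominus>\<^bsub>V\<^esub> s n) < \<epsilon>" if "m \<ge> N" "n \<ge> N" for m n
        using V.nrm_diff_triangle[of "s m" "s N" "s n"] near[OF that(1)] near[OF that(2)]
          V.nrm_diff_commute[of "s N" "s n"] by simp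
      then show ?thesis by blast
    qed
    then obtain l where l: "l \<in> carrier V" "(\<lambda>n. nrm V (s n \<ominus>\<^bsub>V\<^esub> l)) \<longlonglongrightarrow> 0"
      using V.complete_sequence[of s] s by blast
    \<comment> \<open>Both terms on the right tend to 0 as \<open>n\<close> grows while the left
      side is constant, which forces \<open>f l = y\<close>.\<close>
    have "nrm W (y \<ominus>\<^bsub>W\<^esub> f l) \<le> nrm W y * (1 / 2) ^ n + K * nrm V (s n \<ominus>\<^bsub>V\<^esub> l)" for n
    proof -
      have "nrm W (y \<ominus>\<^bsub>W\<^esub> f l) \<le> nrm W (y \<ominus>\<^bsub>W\<^esub> f (s n)) + nrm W (f (s n) \<ominus>\<^bsub>W\<^esub> f l)"
        using y l by (intro W.nrm_diff_triangle) auto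
      also have "f (s n) \<ominus>\<^bsub>W\<^esub> f l = f (s n \<ominus>\<^bsub>V\<^esub> l)"
        using l by (simp add: linear_diff[OF lin])
      finally show ?thesis
        using rest[of n] K(2)[of "s n \<ominus>\<^bsub>V\<^esub> l"] l by (simp add: power_one_over)
    qed
    moreover have "(\<lambda>n. nrm W y * (1 / 2) ^ n + K * nrm V (s n \<ominus>\<^bsub>V\<^esub> l)) \<longlonglongrightarrow> nrm W y * 0 + K * 0"
      by (intro tendsto_intros l(2)) simp_all
    ultimately have "nrm W (y \<ominus>\<^bsub>W\<^esub> f l) \<le> 0"
      by (intro LIMSEQ_le_const) auto
    then have "f l = y"
      using W.nrm_nonneg[of "y \<ominus>\<^bsub>W\<^esub> f l"] W.nrm_eq_zero[of "y \<ominus>\<^bsub>W\<^esub> f l"] y l(1)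
      by (simp add: W.diff_eq_zero_iff)
    \<comment> \<open>\<open>tail\<close> started at \<open>s 0\<close>, which is zero, bounds every
      partial sum by \<open>2 * M * nrm W y\<close>, and the bound survives the limit.\<close>
    moreover have "nrm V l \<le> nrm V (s n \<ominus>\<^bsub>V\<^esub> l) + 2 * M * nrm W y" for n
    proof -
      have "nrm V l \<le> nrm V (l \<ominus>\<^bsub>V\<^esub> s n) + nrm V (s n)"
        using V.nrm_triangle[of "l \<ominus>\<^bsub>V\<^esub> s n" "s n"] l(1) by simp
      then show ?thesis
        using tail[of 0 n] V.nrm_diff_commute[of l "s n"] l(1) by (simp add: s_simps)
    qed
    moreover have "(\<lambda>n. nrm V (s n \<ominus>\<^bsub>V\<^esub> l) + 2 * M * nrm W y) \<longlonglongrightarrow> 0 + 2 * M * nrm W y"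
      by (intro tendsto_intros l(2))
    ultimately have "nrm V l \<le> 2 * M * nrm W y" "f l = y"
      by (auto intro: LIMSEQ_le_const)
    then show ?thesis using l(1) by blast
  qed
  then show thesis by (rule that)
qed

end

text \<open>Injectivity identifies the preimage found by \<open>bounded_preimage\<close> with the
  value of the inverse.\<close>

lemma bounded_linear_inv_into:
  assumes "banach_space V" "banach_space W"
    and f: "bounded_linear_on V W f" and bij: "bij_betw f (carrier V) (carrier W)"
  shows "bounded_linear_on W V (inv_into (carrier V) f)"
proof -
  interpret banach_surjection V W f
    using assms by (simp add: banach_surjection_def banach_surjection_axioms_def bij_betw_def)
  obtain M where M: "\<And>y. y \<in> carrier W \<Longrightarrow> \<exists>x\<in>carrier V. f x = y \<and> nrm V x \<le> M * nrm W y"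
    using bounded_preimage by blast
  have "nrm V (inv_into (carrier V) f y) \<le> M * nrm W y" if "y \<in> carrier W" for y
    using M[OF that] bij by (auto simp: bij_betw_def)
  then show ?thesis
    using linear_inv_into[OF lin bij] by (auto simp: bounded_linear_on_def)
qed

section \<open>Bilinear maps\<close>

lemma bilinear_onD:
  assumes "bilinear_on U V W f" and "x \<in> carrier U" and "y \<in> carrier V"
  shows "f x y \<in> carrier W"
    and "x' \<in> carrier U \<Longrightarrow> f (x \<oplus>\<^bsub>U\<^esub> x') y = f x y \<oplus>\<^bsub>W\<^esub> f x' y"
    and "y' \<in> carrier V \<Longrightarrow> f x (y \<oplus>\<^bsub>V\<^esub> y') = f x y \<oplus>\<^bsub>W\<^esub> f x y'"
    and "f (c \<odot>\<^bsub>U\<^esub> x) y = c \<odot>\<^bsub>W\<^esub> f x y"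
    and "f x (c \<odot>\<^bsub>V\<^esub> y) = c \<odot>\<^bsub>W\<^esub> f x y"
  using assms unfolding bilinear_on_def linear_on_def by blast+

lemma bilinear_on_compose:
  "\<lbrakk>bilinear_on U U V f; linear_on V W g\<rbrakk> \<Longrightarrow> bilinear_on U U W (\<lambda>x y. g (f x y))"
  unfolding bilinear_on_def by (auto intro: linear_on_compose)

text \<open>Homogeneity in each argument reduces everything to vectors of norm exactly
  \<open>r\<close>. The radius is kept free: it is \<open>1 / 2\<close> for compact maps, whose
  images are controlled on open unit balls only, and \<open>cocycle_const\<close> for the product of
  the cocycle algebra.\<close>

lemma bilinear_bound:
  assumes UVW: "normed_space U" "normed_space V" "normed_space W"
    and bil: "bilinear_on U V W f" and r: "r > 0"
    and B: "\<And>x y. \<lbrakk>x \<in> carrier U; y \<in> carrier V; nrm U x = r; nrm V y = r\<rbrakk> \<Longrightarrow> nrm W (f x y) \<le> B"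
    and x: "x \<in> carrier U" and y: "y \<in> carrier V"
  shows "nrm W (f x y) \<le> B / r\<^sup>2 * nrm U x * nrm V y"
proof -
  interpret U: normed_space U by fact
  interpret V: normed_space V by fact
  interpret W: normed_space W by fact
  interpret normed_pair V W by unfold_locales
  interpret UW: normed_pair U W by unfold_locales
  have fx: "linear_on V W (f x)" and fy: "linear_on U W (\<lambda>x. f x y)"
    using bil x y by (auto simp: bilinear_on_def)
  show ?thesis
  proof (cases "nrm U x = 0 \<or> nrm V y = 0")
    case True
    then have "f x y = \<zero>\<^bsub>W\<^esub>"
      using x y linear_zero[OF fx] UW.linear_zero[OF fy] by (auto simp: U.nrm_eq_zero V.nrm_eq_zero)
    then show ?thesis using True by auto
  next
    case False
    then have pos: "nrm U x > 0" "nrm V y > 0"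
      using U.nrm_nonneg[OF x] V.nrm_nonneg[OF y] by auto
    define s where "s = r / nrm U x"
    define t where "t = r / nrm V y"
    have st: "s > 0" "t > 0" "s * nrm U x = r" "t * nrm V y = r"
      using pos r by (auto simp: s_def t_def)
    have "nrm W (f (of_real s \<odot>\<^bsub>U\<^esub> x) (of_real t \<odot>\<^bsub>V\<^esub> y)) \<le> B"
      using x y st by (intro B) (auto simp: U.nrm_smult V.nrm_smult)
    then have "s * (t * nrm W (f x y)) \<le> B"
      using st x y by (simp add: bilinear_onD[OF bil] W.nrm_smult mult.left_commute)
    then have "s * t * nrm W (f x y) * (nrm U x * nrm V y) \<le> B * (nrm U x * nrm V y)"
      using pos by (intro mult_right_mono) (auto simp: mult.assoc)
    moreover have "s * t * nrm W (f x y) * (nrm U x * nrm V y) =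
        (s * nrm U x) * (t * nrm V y) * nrm W (f x y)"
      by (simp only: mult_ac)
    ultimately have "r\<^sup>2 * nrm W (f x y) \<le> B * (nrm U x * nrm V y)"
      by (simp add: st power2_eq_square)
    then show ?thesis
      using r by (simp add: field_simps)
  qed
qed

section \<open>Compact bilinear maps\<close>

text \<open>A net of radius \<open>\<epsilon> / K\<close> is mapped to a net of radius
  \<open>\<epsilon>\<close>.\<close>

lemma (in normed_pair) totally_bounded_image:
  assumes f: "bounded_linear_on V W f" and S: "V.metric.mtotally_bounded S"
  shows "W.metric.mtotally_bounded (f ` S)"
  unfolding W.metric.mtotally_bounded_def
proof (intro allI impI)
  fix \<epsilon> :: real assume \<epsilon>: "\<epsilon> > 0"
  note lin = bounded_linear_onD[OF f]
  obtain K where K: "K > 0" "\<And>x. x \<in> carrier V \<Longrightarrow> nrm W (f x) \<le> K * nrm V x"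
    using f by (rule bounded_linear_pos_bound) blast
  obtain F where F: "finite F" "F \<subseteq> S" "S \<subseteq> (\<Union>x\<in>F. V.metric.mball x (\<epsilon> / K))"
    using S \<epsilon> K(1) unfolding V.metric.mtotally_bounded_def by (meson divide_pos_pos)
  have "f y \<in> W.metric.mball (f x) \<epsilon>" if y: "y \<in> V.metric.mball x (\<epsilon> / K)" for x y
  proof -
    have xy: "x \<in> carrier V" "y \<in> carrier V" "nrm V (x \<ominus>\<^bsub>V\<^esub> y) < \<epsilon> / K"
      using y by (auto simp: ndist_def split: if_splits)
    have "nrm W (f x \<ominus>\<^bsub>W\<^esub> f y) \<le> K * nrm V (x \<ominus>\<^bsub>V\<^esub> y)"
      using K(2)[of "x \<ominus>\<^bsub>V\<^esub> y"] xy by (simp add: linear_diff[OF lin])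
    also have "\<dots> < \<epsilon>"
      using xy K(1) by (simp add: pos_less_divide_eq mult.commute)
    finally show ?thesis
      using xy linear_onD(1)[OF lin] by simp
  qed
  then have "f ` (\<Union>x\<in>F. V.metric.mball x (\<epsilon> / K)) \<subseteq> (\<Union>x\<in>f ` F. W.metric.mball x \<epsilon>)"
    by fast
  then have "f ` S \<subseteq> (\<Union>x\<in>f ` F. W.metric.mball x \<epsilon>)"
    using image_mono[OF F(3), of f] by (rule order_trans[rotated])
  moreover have "finite (f ` F)" "f ` F \<subseteq> f ` S"
    using F(1,2) by auto
  ultimately show "\<exists>K. finite K \<and> K \<subseteq> f ` S \<and> f ` S \<subseteq> (\<Union>x\<in>K. W.metric.mball x \<epsilon>)"
    by meson
qed

text \<open>The differences of two finite nets of radius \<open>\<epsilon> / 2\<close> form a net of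
  radius \<open>\<epsilon>\<close>.\<close>

lemma (in normed_space) totally_bounded_diff:
  assumes S: "metric.mtotally_bounded S" and S': "metric.mtotally_bounded S'"
  shows "metric.mtotally_bounded {x \<ominus> y |x y. x \<in> S \<and> y \<in> S'}"
  unfolding metric.mtotally_bounded_def
proof (intro allI impI)
  fix \<epsilon> :: real assume \<epsilon>: "\<epsilon> > 0"
  obtain F where F: "finite F" "F \<subseteq> S" "S \<subseteq> (\<Union>x\<in>F. metric.mball x (\<epsilon> / 2))"
    using S \<epsilon> unfolding metric.mtotally_bounded_def by (meson half_gt_zero)
  obtain G where G: "finite G" "G \<subseteq> S'" "S' \<subseteq> (\<Union>x\<in>G. metric.mball x (\<epsilon> / 2))"
    using S' \<epsilon> unfolding metric.mtotally_bounded_def by (meson half_gt_zero)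
  let ?H = "{x \<ominus> y |x y. x \<in> F \<and> y \<in> G}"
  have fin: "finite ?H"
    by (rule finite_image_set2) (use F(1) G(1) in simp_all)
  have in_ball: "x \<ominus> y \<in> (\<Union>z\<in>?H. metric.mball z \<epsilon>)" if "x \<in> S" "y \<in> S'" for x y
  proof -
    obtain u v where u: "u \<in> F" "x \<in> metric.mball u (\<epsilon> / 2)" and v: "v \<in> G" "y \<in> metric.mball v (\<epsilon> / 2)"
      using \<open>x \<in> S\<close> \<open>y \<in> S'\<close> F(3) G(3) by blast
    have c: "x \<in> carrier V" "u \<in> carrier V" "nrm V (u \<ominus> x) < \<epsilon> / 2"
      "y \<in> carrier V" "v \<in> carrier V" "nrm V (v \<ominus> y) < \<epsilon> / 2"
      using u(2) v(2) by (auto simp: ndist_def split: if_splits)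
    then have "nrm V ((u \<ominus> v) \<ominus> (x \<ominus> y)) < \<epsilon>"
      using nrm_diff_le[of "u \<ominus> x" "v \<ominus> y"] by (simp add: diff_diff_diff)
    then have "x \<ominus> y \<in> metric.mball (u \<ominus> v) \<epsilon>"
      using c by simp
    then show ?thesis using u(1) v(1) by blast
  qed
  then have sub: "{x \<ominus> y |x y. x \<in> S \<and> y \<in> S'} \<subseteq> (\<Union>z\<in>?H. metric.mball z \<epsilon>)"
    by blast
  moreover have "?H \<subseteq> {x \<ominus> y |x y. x \<in> S \<and> y \<in> S'}"
    using F(2) G(2) by blast
  ultimately show "\<exists>K. finite K \<and> K \<subseteq> {x \<ominus> y |x y. x \<in> S \<and> y \<in> S'} \<and>
      {x \<ominus> y |x y. x \<in> S \<and> y \<in> S'} \<subseteq> (\<Union>x\<in>K. metric.mball x \<epsilon>)"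
    using fin by meson
qed

abbreviation ball_image ::
  "('k, 'a, 'y) normed_alg_scheme \<Rightarrow> ('a \<times> 'a \<Rightarrow> 'e) \<Rightarrow> 'e set" where
  "ball_image A T \<equiv>
    {T (a, b) |a b. a \<in> carrier A \<and> b \<in> carrier A \<and> nrm A a < 1 \<and> nrm A b < 1}"

lemma (in banach_space) compact_bilinear_iff:
  "compact_bilinear A V T \<longleftrightarrow>
    bilinear_on A A V (curry T) \<and> metric.mtotally_bounded (ball_image A T)"
proof (cases "bilinear_on A A V (curry T)")
  case True
  have "ball_image A T \<subseteq> carrier V"
    using bilinear_onD(1)[OF True] by auto
  then show ?thesis
    by (simp add: compact_bilinear_def compact_closure_iff_totally_bounded)
qed (simp add: compact_bilinear_def)

lemma compact_bilinear_compose: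
  assumes "banach_space V" "banach_space W"
    and T: "compact_bilinear A V T" and g: "bounded_linear_on V W g"
  shows "compact_bilinear A W (\<lambda>p. g (T p))"
proof -
  interpret V: banach_space V by fact
  interpret W: banach_space W by fact
  interpret normed_pair V W by unfold_locales
  have "ball_image A (\<lambda>p. g (T p)) = g ` ball_image A T" by blast
  then have "W.metric.mtotally_bounded (ball_image A (\<lambda>p. g (T p)))"
    using totally_bounded_image[OF g] T by (simp add: V.compact_bilinear_iff)
  then show ?thesis
    using T bilinear_on_compose[OF _ bounded_linear_onD[OF g], of A "curry T"]
    by (simp add: V.compact_bilinear_iff W.compact_bilinear_iff curry_def)
qed

lemma bilinear_on_cong:
  assumes "normed_space U" "normed_space V"
    and "\<And>x y. \<lbrakk>x \<in> carrier U; y \<in> carrier V\<rbrakk> \<Longrightarrow> f x y = g x y"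
  shows "bilinear_on U V W f \<longleftrightarrow> bilinear_on U V W g"
proof -
  interpret U: normed_space U by fact
  interpret V: normed_space V by fact
  show ?thesis
    using assms(3) unfolding bilinear_on_def linear_on_def by (simp add: Pi_iff)
qed

text \<open>Cochains are extensional while the natural formulas for them are not; this passes
  between the two.\<close>

lemma compact_bilinear_cong:
  assumes "normed_space A"
    and "\<And>a b. \<lbrakk>a \<in> carrier A; b \<in> carrier A\<rbrakk> \<Longrightarrow> T (a, b) = T' (a, b)"
  shows "compact_bilinear A V T \<longleftrightarrow> compact_bilinear A V T'"
proof -
  have "bilinear_on A A V (curry T) \<longleftrightarrow> bilinear_on A A V (curry T')"
    using assms by (intro bilinear_on_cong) auto
  moreover have "ball_image A T = ball_image A T'"
    using assms(2) by (metis (no_types, lifting))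
  ultimately show ?thesis
    by (simp add: compact_bilinear_def)
qed

lemma linear_on_diff:
  assumes "normed_space V" "normed_space W" "linear_on V W f" "linear_on V W g"
  shows "linear_on V W (\<lambda>x. f x \<ominus>\<^bsub>W\<^esub> g x)"
proof -
  interpret V: normed_space V by fact
  interpret W: normed_space W by fact
  show ?thesis
    using linear_onD[OF assms(3)] linear_onD[OF assms(4)]
    by (auto simp: linear_on_def W.add_diff_add W.smul_diff)
qed

lemma bounded_linear_on_diff:
  assumes VW: "normed_space V" "normed_space W"
    and f: "bounded_linear_on V W f" and g: "bounded_linear_on V W g"
  shows "bounded_linear_on V W (\<lambda>x. f x \<ominus>\<^bsub>W\<^esub> g x)"
proof -
  interpret W: normed_space W by fact
  obtain K L where "\<And>x. x \<in> carrier V \<Longrightarrow> nrm W (f x) \<le> K * nrm V x"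
    "\<And>x. x \<in> carrier V \<Longrightarrow> nrm W (g x) \<le> L * nrm V x"
    using f g unfolding bounded_linear_on_def by blast
  then have "nrm W (f x \<ominus>\<^bsub>W\<^esub> g x) \<le> (K + L) * nrm V x" if "x \<in> carrier V" for x
    using that W.nrm_diff_le[of "f x" "g x"] linear_onD(1)[OF bounded_linear_onD[OF f] that]
      linear_onD(1)[OF bounded_linear_onD[OF g] that]
    by (fastforce simp: distrib_right)
  then show ?thesis
    using linear_on_diff[OF VW bounded_linear_onD[OF f] bounded_linear_onD[OF g]]
    unfolding bounded_linear_on_def by blast
qed

lemma compact_bilinear_diff:
  assumes A: "normed_space A" and V: "banach_space V"
    and T: "compact_bilinear A V T" and T': "compact_bilinear A V T'"
  shows "compact_bilinear A V (\<lambda>p. T p \<ominus>\<^bsub>V\<^esub> T' p)"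
proof -
  interpret V: banach_space V by fact
  have VN: "normed_space V" by unfold_locales
  have "ball_image A (\<lambda>p. T p \<ominus>\<^bsub>V\<^esub> T' p) \<subseteq>
      {x \<ominus>\<^bsub>V\<^esub> y |x y. x \<in> ball_image A T \<and> y \<in> ball_image A T'}" by blast
  moreover have "bilinear_on A A V (curry (\<lambda>p. T p \<ominus>\<^bsub>V\<^esub> T' p))"
    using T T' linear_on_diff[OF A VN]
    unfolding bilinear_on_def V.compact_bilinear_iff curry_def by blast
  ultimately show ?thesis
    using T T' V.totally_bounded_diff V.metric.mtotally_bounded_subset
    unfolding V.compact_bilinear_iff by blast
qed

lemma compact_bilinear_zero:
  assumes A: "normed_space A" and V: "banach_space V"
  shows "compact_bilinear A V (\<lambda>_. \<zero>\<^bsub>V\<^esub>)"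
proof -
  interpret V: banach_space V by fact
  have "ball_image A (\<lambda>_. \<zero>\<^bsub>V\<^esub>) \<subseteq> {\<zero>\<^bsub>V\<^esub>}" by blast
  then have "V.metric.mtotally_bounded (ball_image A (\<lambda>_. \<zero>\<^bsub>V\<^esub>))"
    using V.metric.mtotally_bounded_subset[of "{\<zero>\<^bsub>V\<^esub>}"] by simp
  then show ?thesis
    by (simp add: V.compact_bilinear_iff bilinear_on_def linear_on_def)
qed

text \<open>Totally bounded sets are bounded. This is what gives a compact cocycle a continuous
  product on \<open>A \<oplus> E\<close>.\<close>

lemma compact_bilinear_bounded:
  assumes A: "normed_space A" and V: "banach_space V" and T: "compact_bilinear A V T"
  obtains K where "K \<ge> 0"
    "\<And>a b. \<lbrakk>a \<in> carrier A; b \<in> carrier A\<rbrakk> \<Longrightarrow> nrm V (T (a, b)) \<le> K * nrm A a * nrm A b"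
proof -
  interpret A: normed_space A by fact
  interpret V: banach_space V by fact
  have bil: "bilinear_on A A V (curry T)" and "V.metric.mtotally_bounded (ball_image A T)"
    using T by (auto simp: V.compact_bilinear_iff)
  then have "V.metric.mbounded (ball_image A T)"
    using V.metric.mtotally_bounded_imp_mbounded by blast
  then obtain z B where z: "ball_image A T \<subseteq> V.metric.mcball z B"
    unfolding V.metric.mbounded_def by blast
  \<comment> \<open>The norm is \<open>1 / 2\<close> because \<open>ball_image\<close> only sees
    vectors of norm strictly below 1.\<close>
  have sphere: "nrm V (T (a, b)) \<le> \<bar>B\<bar> + nrm V z"
    if "a \<in> carrier A" "b \<in> carrier A" "nrm A a = 1 / 2" "nrm A b = 1 / 2" for a b
  proof -
    have "T (a, b) \<in> ball_image A T"
      using that by fastforce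
    then have "T (a, b) \<in> V.metric.mcball z B"
      using z by blast
    then have *: "z \<in> carrier V" "T (a, b) \<in> carrier V" "nrm V (z \<ominus>\<^bsub>V\<^esub> T (a, b)) \<le> B"
      by (auto simp: ndist_def split: if_splits)
    have "nrm V (T (a, b)) \<le> nrm V (T (a, b) \<ominus>\<^bsub>V\<^esub> z) + nrm V z"
      using V.nrm_triangle[of "T (a, b) \<ominus>\<^bsub>V\<^esub> z" z] * by simp
    then show ?thesis
      using * V.nrm_diff_commute[of z "T (a, b)"] by simp
  qed
  \<comment> \<open>\<open>max 0\<close> fixes the sign of the constant: \<open>z\<close> is known
    to lie in the carrier only inside the proof of \<open>sphere\<close>, so nothing is at hand
    about the sign of \<open>nrm V z\<close>.\<close>
  have "nrm V (T (a, b)) \<le> max 0 ((\<bar>B\<bar> + nrm V z) / (1 / 2)\<^sup>2) * nrm A a * nrm A b"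
    if "a \<in> carrier A" "b \<in> carrier A" for a b
  proof -
    have "nrm V (T (a, b)) \<le> (\<bar>B\<bar> + nrm V z) / (1 / 2)\<^sup>2 * nrm A a * nrm A b"
      using bilinear_bound[OF A A V.normed_space_axioms bil, of "1/2" "\<bar>B\<bar> + nrm V z" a b] sphere that
      by simp
    also have "\<dots> \<le> max 0 ((\<bar>B\<bar> + nrm V z) / (1 / 2)\<^sup>2) * nrm A a * nrm A b"
      using A.nrm_nonneg that by (intro mult_right_mono) auto
    finally show ?thesis .
  qed
  then show thesis
    using that[of "max 0 ((\<bar>B\<bar> + nrm V z) / (1 / 2)\<^sup>2)"] by simp
qed

section \<open>Groups of compact cochains\<close>

context banach_bimodule
begin

lemma normed_A: "normed_space A" and normed_E: "normed_space E" and banach_E: "banach_space E"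
  and banach_A: "banach_algebra A"
  by unfold_locales

lemma normed_pair_E_E: "normed_pair E E" by unfold_locales

lemma mult_closed [simp]: "\<lbrakk>a \<in> carrier A; b \<in> carrier A\<rbrakk> \<Longrightarrow> a \<otimes>\<^bsub>A\<^esub> b \<in> carrier A"
  by (rule bilinear_onD(1)[OF mult_bilinear])

lemma lact_closed [simp]: "\<lbrakk>a \<in> carrier A; x \<in> carrier E\<rbrakk> \<Longrightarrow> lact E a x \<in> carrier E"
  by (rule bilinear_onD(1)[OF lact_bilinear])

lemma ract_closed [simp]: "\<lbrakk>a \<in> carrier A; x \<in> carrier E\<rbrakk> \<Longrightarrow> ract E x a \<in> carrier E"
  by (rule bilinear_onD(1)[OF ract_bilinear])

lemmas lact_simps = bilinear_onD(2-)[OF lact_bilinear]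
lemmas ract_simps = bilinear_onD(2-)[OF ract_bilinear]

lemma lact_linear: "a \<in> carrier A \<Longrightarrow> linear_on E E (lact E a)"
  and ract_linear: "a \<in> carrier A \<Longrightarrow> linear_on E E (\<lambda>x. ract E x a)"
  using lact_bilinear ract_bilinear by (auto simp: bilinear_on_def)

lemma K2_closed: "\<lbrakk>T \<in> K2 A E; a \<in> carrier A; b \<in> carrier A\<rbrakk> \<Longrightarrow> T (a, b) \<in> carrier E"
  using bilinear_onD(1)[of A A E "curry T" a b] by (auto simp: K2_def compact_bilinear_def)

lemma K2_eqI:
  assumes "T \<in> K2 A E" "T' \<in> K2 A E"
    and "\<And>a b. \<lbrakk>a \<in> carrier A; b \<in> carrier A\<rbrakk> \<Longrightarrow> T (a, b) = T' (a, b)"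
  shows "T = T'"
  using assms by (intro extensionalityI[of _ "carrier A \<times> carrier A"]) (auto simp: K2_def)

lemma K2_diff: "\<lbrakk>T \<in> K2 A E; T' \<in> K2 A E\<rbrakk> \<Longrightarrow> cochain_diff A E T T' \<in> K2 A E"
  using compact_bilinear_diff[OF normed_A banach_E, of T T']
    compact_bilinear_cong[OF normed_A, of "cochain_diff A E T T'" "\<lambda>p. T p \<ominus>\<^bsub>E\<^esub> T' p" E]
  by (auto simp: K2_def cochain_diff_def)

definition zero_cochain where
  "zero_cochain = (\<lambda>p\<in>carrier A \<times> carrier A. \<zero>\<^bsub>E\<^esub>)"

lemma K2_zero: "zero_cochain \<in> K2 A E"
  using compact_bilinear_zero[OF normed_A banach_E]
    compact_bilinear_cong[OF normed_A, of zero_cochain "\<lambda>_. \<zero>\<^bsub>E\<^esub>" E]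
  by (auto simp: K2_def zero_cochain_def)

text \<open>Zero and differences generate the other group operations: the negative of
  \<open>T\<close> is \<open>0 - T\<close>, and \<open>T + T'\<close> is
  \<open>T - (0 - T')\<close>.\<close>

definition cochain_subgroup where
  "cochain_subgroup N \<longleftrightarrow> N \<subseteq> K2 A E \<and> zero_cochain \<in> N \<and>
    (\<forall>T\<in>N. \<forall>T'\<in>N. cochain_diff A E T T' \<in> N)"

lemma cochain_coset_eq_iff:
  assumes N: "cochain_subgroup N" and T: "T \<in> K2 A E" and T': "T' \<in> K2 A E"
  shows "cochain_coset A E T N = cochain_coset A E T' N \<longleftrightarrow> cochain_diff A E T T' \<in> N"
proof
  have zero: "zero_cochain \<in> N" and diff: "\<And>n n'. \<lbrakk>n \<in> N; n' \<in> N\<rbrakk> \<Longrightarrow> cochain_diff A E n n' \<in> N"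
    and sub: "\<And>n. n \<in> N \<Longrightarrow> n \<in> K2 A E"
    using N by (auto simp: cochain_subgroup_def)
  have ext: "T \<in> extensional (carrier A \<times> carrier A)" if "T \<in> K2 A E" for T
    using that by (simp add: K2_def)
  note simps = cochain_add_def cochain_diff_def zero_cochain_def
  note cl [simp] = K2_closed[OF T] K2_closed[OF T'] K2_closed[OF sub]
  show "cochain_diff A E T T' \<in> N" if eq: "cochain_coset A E T N = cochain_coset A E T' N"
  proof -
    \<comment> \<open>This element is \<open>T\<close> itself, written as \<open>T + 0\<close>;
      membership in the other coset then exhibits \<open>T - T'\<close> as an element of
      \<open>N\<close>.\<close>
    have "cochain_add A E T zero_cochain \<in> cochain_coset A E T N"
      unfolding cochain_coset_def using zero by blast
    then have "cochain_add A E T zero_cochain \<in> cochain_coset A E T' N"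
      using eq by simp
    then obtain n where n: "n \<in> N" and *: "cochain_add A E T zero_cochain = cochain_add A E T' n"
      unfolding cochain_coset_def by blast
    have "T (a, b) \<ominus>\<^bsub>E\<^esub> T' (a, b) = n (a, b)" if "a \<in> carrier A" "b \<in> carrier A" for a b
      using fun_cong[OF *, of "(a, b)"] that n by (simp add: simps E.a_comm[of "T' (a, b)"])
    then have "cochain_diff A E T T' = n"
      using K2_diff[OF T T'] sub[OF n] by (intro K2_eqI) (auto simp: simps)
    then show ?thesis using n by simp
  qed
  have half: "cochain_coset A E T N \<subseteq> cochain_coset A E T' N"
    if T: "T \<in> K2 A E" and T': "T' \<in> K2 A E" and d: "cochain_diff A E T T' \<in> N" for T T'
  proof
    fix S assume "S \<in> cochain_coset A E T N"
    then obtain n where n: "n \<in> N" "S = cochain_add A E T n"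
      by (auto simp: cochain_coset_def)
    \<comment> \<open>\<open>m\<close> is \<open>(T - T') + n\<close>, the sum being expressed by
      two differences so that closure of \<open>N\<close> applies; then
      \<open>T' + m = T + n\<close>.\<close>
    define m where "m = cochain_diff A E (cochain_diff A E T T') (cochain_diff A E zero_cochain n)"
    have m: "m \<in> N" unfolding m_def by (intro diff d zero n(1))
    have "S = cochain_add A E T' m"
    proof
      fix p
      show "S p = cochain_add A E T' m p"
      proof (cases "p \<in> carrier A \<times> carrier A")
        case True
        then obtain a b where p: "p = (a, b)" "a \<in> carrier A" "b \<in> carrier A" by auto
        define d where "d = T (a, b) \<ominus>\<^bsub>E\<^esub> T' (a, b)"
        have c: "d \<in> carrier E" "n (a, b) \<in> carrier E" "T' (a, b) \<in> carrier E"
          using p K2_closed[OF T p(2,3)] K2_closed[OF T' p(2,3)] K2_closed[OF sub[OF n(1)] p(2,3)]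
          by (auto simp: d_def)
        have "T (a, b) = d \<oplus>\<^bsub>E\<^esub> T' (a, b)"
          using p K2_closed[OF T p(2,3)] K2_closed[OF T' p(2,3)] by (simp add: d_def)
        moreover have "m (a, b) = d \<oplus>\<^bsub>E\<^esub> n (a, b)"
          using p c by (simp add: m_def simps a_minus_def E.minus_minus d_def)
        ultimately show ?thesis
          using p c by (simp add: n(2) cochain_add_def E.a_ac)
      qed (simp add: n(2) cochain_add_def)
    qed
    then show "S \<in> cochain_coset A E T' N"
      using m by (auto simp: cochain_coset_def)
  qed
  show "cochain_coset A E T N = cochain_coset A E T' N" if d: "cochain_diff A E T T' \<in> N"
  proof -
    have "cochain_diff A E T' T = cochain_diff A E zero_cochain (cochain_diff A E T T')"
      by (auto simp: simps fun_eq_iff E.minus_diff a_minus_def[of E "\<zero>\<^bsub>E\<^esub>"])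
    then have "cochain_diff A E T' T \<in> N"
      using diff[OF zero d] by simp
    then show ?thesis
      using half[OF T T' d] half[OF T' T] by blast
  qed
qed

lemma delta1_diff:
  assumes S: "linear_on A E S" "linear_on A E S'" and ab: "a \<in> carrier A" "b \<in> carrier A"
  shows "delta1 A E (\<lambda>x. S x \<ominus>\<^bsub>E\<^esub> S' x) a b = delta1 A E S a b \<ominus>\<^bsub>E\<^esub> delta1 A E S' a b"
  using ab linear_onD(1)[OF S(1)] linear_onD(1)[OF S(2)]
  by (simp add: delta1_def E.diff_diff_diff E.add_diff_add
      normed_pair.linear_diff[OF normed_pair_E_E lact_linear[OF ab(1)]]
      normed_pair.linear_diff[OF normed_pair_E_E ract_linear[OF ab(2)]])

lemma delta1_zero:
  assumes ab: "a \<in> carrier A" "b \<in> carrier A"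
  shows "delta1 A E (\<lambda>_. \<zero>\<^bsub>E\<^esub>) a b = \<zero>\<^bsub>E\<^esub>"
  using ab by (simp add: delta1_def normed_pair.linear_zero[OF normed_pair_E_E lact_linear[OF ab(1)]]
      normed_pair.linear_zero[OF normed_pair_E_E ract_linear[OF ab(2)]])

text \<open>\<open>P\<close> stands for linear or for bounded linear, which yields
  \<open>N2K_tilde\<close> and \<open>N2K\<close> from one proof.\<close>

lemma coboundary_subgroup:
  assumes N: "N = {T \<in> K2 A E. \<exists>S. P S \<and> (\<forall>a\<in>carrier A. \<forall>b\<in>carrier A. T (a, b) = delta1 A E S a b)}"
    and lin: "\<And>S. P S \<Longrightarrow> linear_on A E S" and zero: "P (\<lambda>_. \<zero>\<^bsub>E\<^esub>)"
    and diff: "\<And>S S'. \<lbrakk>P S; P S'\<rbrakk> \<Longrightarrow> P (\<lambda>x. S x \<ominus>\<^bsub>E\<^esub> S' x)"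
  shows "cochain_subgroup N"
  unfolding cochain_subgroup_def
proof (intro conjI ballI)
  show "zero_cochain \<in> N"
    unfolding N using K2_zero zero by (auto intro!: exI[of _ "\<lambda>_. \<zero>\<^bsub>E\<^esub>"] simp: delta1_zero zero_cochain_def)
next
  fix T T' assume "T \<in> N" "T' \<in> N"
  then obtain S S' where "T \<in> K2 A E" "T' \<in> K2 A E" "P S" "P S'"
    "\<And>a b. \<lbrakk>a \<in> carrier A; b \<in> carrier A\<rbrakk> \<Longrightarrow> T (a, b) = delta1 A E S a b"
    "\<And>a b. \<lbrakk>a \<in> carrier A; b \<in> carrier A\<rbrakk> \<Longrightarrow> T' (a, b) = delta1 A E S' a b"
    unfolding N by blast
  then show "cochain_diff A E T T' \<in> N"
    unfolding N using K2_diff diff lin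
    by (auto intro!: exI[of _ "\<lambda>x. S x \<ominus>\<^bsub>E\<^esub> S' x"] simp: delta1_diff cochain_diff_def)
qed (auto simp: N)

lemma N2K_tilde_subgroup: "cochain_subgroup (N2K_tilde A E)"
proof (rule coboundary_subgroup[OF N2K_tilde_def])
  show "linear_on A E (\<lambda>_. \<zero>\<^bsub>E\<^esub>)"
    by (simp add: linear_on_def)
qed (auto intro: linear_on_diff[OF normed_A normed_E])

lemma N2K_subgroup: "cochain_subgroup (N2K A E)"
proof (rule coboundary_subgroup[OF N2K_def])
  show "bounded_linear_on A E (\<lambda>_. \<zero>\<^bsub>E\<^esub>)"
    by (auto simp: bounded_linear_on_def linear_on_def intro!: exI[of _ 0])
qed (auto intro: bounded_linear_on_diff[OF normed_A normed_E] bounded_linear_onD)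

text \<open>The right side is free of subtraction. It is the second coordinate of multiplicativity,
  on the elements \<open>(a, 0)\<close> and \<open>(b, 0)\<close>, of the map
  \<open>(a, x) \<mapsto> (a, S a \<oplus> x)\<close> from the algebra of \<open>T\<close> to that
  of \<open>T'\<close>.\<close>

lemma cochain_diff_eq_delta1_iff:
  assumes "linear_on A E S" "T \<in> K2 A E" "T' \<in> K2 A E" "a \<in> carrier A" "b \<in> carrier A"
  shows "cochain_diff A E T T' (a, b) = delta1 A E S a b \<longleftrightarrow>
    T (a, b) \<oplus>\<^bsub>E\<^esub> S (a \<otimes>\<^bsub>A\<^esub> b) = lact E a (S b) \<oplus>\<^bsub>E\<^esub> ract E (S a) b \<oplus>\<^bsub>E\<^esub> T' (a, b)"
proof -
  note [simp] = assms(4,5) linear_onD(1)[OF assms(1)] K2_closed[OF assms(2)] K2_closed[OF assms(3)]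
  let ?l = "lact E a (S b)" and ?r = "ract E (S a) b" and ?s = "S (a \<otimes>\<^bsub>A\<^esub> b)"
  have "delta1 A E S a b = ?l \<oplus>\<^bsub>E\<^esub> ?r \<ominus>\<^bsub>E\<^esub> ?s"
    by (simp add: delta1_def a_minus_def E.a_ac)
  then have "cochain_diff A E T T' (a, b) = delta1 A E S a b \<longleftrightarrow>
      T (a, b) = ?l \<oplus>\<^bsub>E\<^esub> ?r \<ominus>\<^bsub>E\<^esub> ?s \<oplus>\<^bsub>E\<^esub> T' (a, b)"
    by (simp add: cochain_diff_def E.diff_eq_iff)
  also have "?l \<oplus>\<^bsub>E\<^esub> ?r \<ominus>\<^bsub>E\<^esub> ?s \<oplus>\<^bsub>E\<^esub> T' (a, b) = ?l \<oplus>\<^bsub>E\<^esub> ?r \<oplus>\<^bsub>E\<^esub> T' (a, b) \<ominus>\<^bsub>E\<^esub> ?s"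
    by (simp add: a_minus_def E.a_ac)
  also have "T (a, b) = \<dots> \<longleftrightarrow> \<dots> = T (a, b)"
    by (rule eq_commute)
  also have "\<dots> \<longleftrightarrow> ?l \<oplus>\<^bsub>E\<^esub> ?r \<oplus>\<^bsub>E\<^esub> T' (a, b) = T (a, b) \<oplus>\<^bsub>E\<^esub> ?s"
    by (intro E.diff_eq_iff) auto
  finally show ?thesis by auto
qed

text \<open>Without subtraction the cocycle identity has the form in which it enters the
  associativity of a product.\<close>

lemma delta2_eq_zero_iff:
  assumes T: "bilinear_on A A E (curry T)"
    and abc [simp]: "a \<in> carrier A" "b \<in> carrier A" "c \<in> carrier A"
  shows "delta2 A E T a b c = \<zero>\<^bsub>E\<^esub> \<longleftrightarrow>
    lact E a (T (b, c)) \<oplus>\<^bsub>E\<^esub> T (a, b \<otimes>\<^bsub>A\<^esub> c) = T (a \<otimes>\<^bsub>A\<^esub> b, c) \<oplus>\<^bsub>E\<^esub> ract E (T (a, b)) c"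
proof -
  have [simp]: "T (a, b) \<in> carrier E" if "a \<in> carrier A" "b \<in> carrier A" for a b
    using bilinear_onD(1)[OF T that] by simp
  let ?p = "lact E a (T (b, c))" and ?q = "T (a, b \<otimes>\<^bsub>A\<^esub> c)"
    and ?r = "T (a \<otimes>\<^bsub>A\<^esub> b, c)" and ?s = "ract E (T (a, b)) c"
  have "delta2 A E T a b c = (?p \<oplus>\<^bsub>E\<^esub> ?q) \<ominus>\<^bsub>E\<^esub> (?r \<oplus>\<^bsub>E\<^esub> ?s)"
    by (simp add: delta2_def a_minus_def E.minus_add E.a_ac)
  then show ?thesis
    by (simp add: E.diff_eq_zero_iff)
qed

end

section \<open>The Banach algebra of a bounded cocycle\<close>

text \<open>Boundedness of \<open>T\<close> is what makes the product on \<open>A \<oplus> E\<close>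
  continuous; \<open>Z2K_bounded_cocycle\<close> brings every element of \<open>Z2K\<close> under
  these assumptions.\<close>

locale bounded_cocycle = banach_bimodule A E
  for A :: "('k::real_normed_field, 'a) normed_alg" and E :: "('k, 'a, 'e) bimodule" +
  fixes T :: "'a \<times> 'a \<Rightarrow> 'e"
  assumes bilinear: "bilinear_on A A E (curry T)"
    and bounded: "\<exists>K. \<forall>a\<in>carrier A. \<forall>b\<in>carrier A. nrm E (T (a, b)) \<le> K * nrm A a * nrm A b"
    and cocycle: "\<lbrakk>a \<in> carrier A; b \<in> carrier A; c \<in> carrier A\<rbrakk> \<Longrightarrow>
      lact E a (T (b, c)) \<oplus>\<^bsub>E\<^esub> T (a, b \<otimes>\<^bsub>A\<^esub> c) = T (a \<otimes>\<^bsub>A\<^esub> b, c) \<oplus>\<^bsub>E\<^esub> ract E (T (a, b)) c"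
begin

abbreviation "AT \<equiv> cocycle_algebra A E T"
abbreviation "C \<equiv> cocycle_const A E T"

lemma cocycle_algebra_simps:
  "carrier AT = carrier A \<times> carrier E"
  "mult AT (a, x) (b, y) = (a \<otimes>\<^bsub>A\<^esub> b, lact E a y \<oplus>\<^bsub>E\<^esub> ract E x b \<oplus>\<^bsub>E\<^esub> T (a, b))"
  "add AT (a, x) (b, y) = (a \<oplus>\<^bsub>A\<^esub> b, x \<oplus>\<^bsub>E\<^esub> y)"
  "smult AT c (a, x) = (c \<odot>\<^bsub>A\<^esub> a, c \<odot>\<^bsub>E\<^esub> x)"
  "zero AT = (\<zero>\<^bsub>A\<^esub>, \<zero>\<^bsub>E\<^esub>)"
  "nrm AT (a, x) = C * (nrm A a + nrm E x)"
  by (simp_all add: cocycle_algebra_def cocycle_mult_def sum_nrm_def)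

lemma C_ge_1: "1 \<le> C"
  by (simp add: cocycle_const_def)

lemma C_pos: "0 < C"
  using C_ge_1 by linarith

lemma T_closed [simp]: "\<lbrakk>a \<in> carrier A; b \<in> carrier A\<rbrakk> \<Longrightarrow> T (a, b) \<in> carrier E"
  using bilinear_onD(1)[OF bilinear] by simp

lemma T_simps:
  assumes "a \<in> carrier A" "b \<in> carrier A"
  shows "a' \<in> carrier A \<Longrightarrow> T (a \<oplus>\<^bsub>A\<^esub> a', b) = T (a, b) \<oplus>\<^bsub>E\<^esub> T (a', b)"
    and "b' \<in> carrier A \<Longrightarrow> T (a, b \<oplus>\<^bsub>A\<^esub> b') = T (a, b) \<oplus>\<^bsub>E\<^esub> T (a, b')"
    and "T (c \<odot>\<^bsub>A\<^esub> a, b) = c \<odot>\<^bsub>E\<^esub> T (a, b)"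
    and "T (a, c \<odot>\<^bsub>A\<^esub> b) = c \<odot>\<^bsub>E\<^esub> T (a, b)"
  using bilinear_onD[OF bilinear assms] by simp_all

lemma abelian_group_AT: "abelian_group AT"
proof (rule abelian_groupI)
  fix u assume "u \<in> carrier AT"
  then obtain a x where u: "u = (a, x)" "a \<in> carrier A" "x \<in> carrier E"
    by (auto simp: cocycle_algebra_simps)
  then show "\<exists>v\<in>carrier AT. v \<oplus>\<^bsub>AT\<^esub> u = \<zero>\<^bsub>AT\<^esub>"
    by (intro bexI[of _ "(\<ominus>\<^bsub>A\<^esub> a, \<ominus>\<^bsub>E\<^esub> x)"]) (auto simp: cocycle_algebra_simps l_neg E.l_neg)
qed (auto simp: cocycle_algebra_simps a_ac E.a_ac)

lemma normed_space_AT: "normed_space AT"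
proof (rule normed_spaceI[OF abelian_group_AT])
  fix x assume "x \<in> carrier AT"
  then show "nrm AT x = 0 \<longleftrightarrow> x = \<zero>\<^bsub>AT\<^esub>"
    using C_pos nrm_nonneg E.nrm_nonneg
    by (auto simp: cocycle_algebra_simps add_nonneg_eq_0_iff nrm_eq_zero E.nrm_eq_zero)
next
  fix x y assume "x \<in> carrier AT" "y \<in> carrier AT"
  then obtain a b u v where xy: "x = (a, u)" "y = (b, v)" "a \<in> carrier A" "b \<in> carrier A"
      "u \<in> carrier E" "v \<in> carrier E"
    by (auto simp: cocycle_algebra_simps)
  then have "nrm A (a \<oplus>\<^bsub>A\<^esub> b) + nrm E (u \<oplus>\<^bsub>E\<^esub> v) \<le> (nrm A a + nrm E u) + (nrm A b + nrm E v)"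
    using nrm_triangle[of a b] E.nrm_triangle[of u v] by simp
  from mult_left_mono[OF this, of C] show "nrm AT (x \<oplus>\<^bsub>AT\<^esub> y) \<le> nrm AT x + nrm AT y"
    using C_pos by (simp add: xy cocycle_algebra_simps algebra_simps)
qed (use C_pos nrm_nonneg E.nrm_nonneg in \<open>auto simp: cocycle_algebra_simps smul_add_left E.smul_add_left
      smul_add_right E.smul_add_right smul_smul E.smul_smul nrm_smult E.nrm_smult algebra_simps\<close>)

lemma diff_AT:
  assumes "a \<in> carrier A" "x \<in> carrier E" "b \<in> carrier A" "y \<in> carrier E"
  shows "(a, x) \<ominus>\<^bsub>AT\<^esub> (b, y) = (a \<ominus>\<^bsub>A\<^esub> b, x \<ominus>\<^bsub>E\<^esub> y)"
proof -
  interpret AT: normed_space AT by (rule normed_space_AT)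
  show ?thesis
    using assms by (subst AT.diff_eq_iff) (auto simp: cocycle_algebra_simps)
qed

lemma banach_space_AT: "banach_space AT"
proof (rule banach_spaceI[OF normed_space_AT])
  fix s :: "nat \<Rightarrow> 'a \<times> 'e"
  assume s: "\<And>n. s n \<in> carrier AT"
    and cauchy: "\<And>\<epsilon>. \<epsilon> > 0 \<Longrightarrow> \<exists>N. \<forall>m\<ge>N. \<forall>n\<ge>N. nrm AT (s m \<ominus>\<^bsub>AT\<^esub> s n) < \<epsilon>"
  define a where "a n = fst (s n)" for n
  define x where "x n = snd (s n)" for n
  have s_eq: "s n = (a n, x n)" and ax [simp]: "a n \<in> carrier A" "x n \<in> carrier E" for n
    using s[of n] by (auto simp: a_def x_def cocycle_algebra_simps mem_Times_iff)
  have nrm_s: "nrm AT (s m \<ominus>\<^bsub>AT\<^esub> s n) = C * (nrm A (a m \<ominus>\<^bsub>A\<^esub> a n) + nrm E (x m \<ominus>\<^bsub>E\<^esub> x n))" for m n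
    by (simp add: s_eq diff_AT cocycle_algebra_simps)
  \<comment> \<open>Because \<open>C \<ge> 1\<close>, each coordinate norm is at most the norm in
    \<open>AT\<close>, so both coordinates of a Cauchy sequence are Cauchy.\<close>
  have le: "nrm A (a m \<ominus>\<^bsub>A\<^esub> a n) \<le> nrm AT (s m \<ominus>\<^bsub>AT\<^esub> s n)"
    "nrm E (x m \<ominus>\<^bsub>E\<^esub> x n) \<le> nrm AT (s m \<ominus>\<^bsub>AT\<^esub> s n)" for m n
  proof -
    have "1 * (nrm A (a m \<ominus>\<^bsub>A\<^esub> a n) + nrm E (x m \<ominus>\<^bsub>E\<^esub> x n)) \<le> nrm AT (s m \<ominus>\<^bsub>AT\<^esub> s n)"
      unfolding nrm_s using C_ge_1 nrm_nonneg E.nrm_nonneg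
      by (intro mult_right_mono) (auto intro: add_nonneg_nonneg)
    then show "nrm A (a m \<ominus>\<^bsub>A\<^esub> a n) \<le> nrm AT (s m \<ominus>\<^bsub>AT\<^esub> s n)"
      "nrm E (x m \<ominus>\<^bsub>E\<^esub> x n) \<le> nrm AT (s m \<ominus>\<^bsub>AT\<^esub> s n)"
      using nrm_nonneg[of "a m \<ominus>\<^bsub>A\<^esub> a n"] E.nrm_nonneg[of "x m \<ominus>\<^bsub>E\<^esub> x n"] by auto
  qed
  have "\<exists>N. \<forall>m\<ge>N. \<forall>n\<ge>N. nrm A (a m \<ominus>\<^bsub>A\<^esub> a n) < \<epsilon>"
    and "\<exists>N. \<forall>m\<ge>N. \<forall>n\<ge>N. nrm E (x m \<ominus>\<^bsub>E\<^esub> x n) < \<epsilon>" if "\<epsilon> > 0" for \<epsilon>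
    using cauchy[OF that] le by (meson le_less_trans)+
  then obtain l k where l: "l \<in> carrier A" "(\<lambda>n. nrm A (a n \<ominus>\<^bsub>A\<^esub> l)) \<longlonglongrightarrow> 0"
    and k: "k \<in> carrier E" "(\<lambda>n. nrm E (x n \<ominus>\<^bsub>E\<^esub> k)) \<longlonglongrightarrow> 0"
    using complete_sequence[of a] E.complete_sequence[of x] ax by metis
  have "(\<lambda>n. C * (nrm A (a n \<ominus>\<^bsub>A\<^esub> l) + nrm E (x n \<ominus>\<^bsub>E\<^esub> k))) \<longlonglongrightarrow> C * (0 + 0)"
    by (intro tendsto_intros l k)
  then have "(\<lambda>n. nrm AT (s n \<ominus>\<^bsub>AT\<^esub> (l, k))) \<longlonglongrightarrow> 0"
    using l(1) k(1) by (simp add: s_eq diff_AT cocycle_algebra_simps)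
  then show "\<exists>l\<in>carrier AT. (\<lambda>n. nrm AT (s n \<ominus>\<^bsub>AT\<^esub> l)) \<longlonglongrightarrow> 0"
    using l(1) k(1) by (auto simp: cocycle_algebra_simps)
qed

lemma mult_AT_bilinear: "bilinear_on AT AT AT (mult AT)"
  unfolding bilinear_on_def linear_on_def
  by (auto simp: cocycle_algebra_simps bilinear_onD(2-)[OF mult_bilinear] lact_simps ract_simps T_simps
      E.smul_add_right E.a_ac)

text \<open>Once the bimodule axioms have matched the other terms, the two bracketings differ only
  by the two sides of the cocycle identity.\<close>

lemma mult_AT_assoc:
  assumes "u \<in> carrier AT" "v \<in> carrier AT" "w \<in> carrier AT"
  shows "(u \<otimes>\<^bsub>AT\<^esub> v) \<otimes>\<^bsub>AT\<^esub> w = u \<otimes>\<^bsub>AT\<^esub> (v \<otimes>\<^bsub>AT\<^esub> w)"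
proof -
  obtain a b c x y z where uvw: "u = (a, x)" "v = (b, y)" "w = (c, z)"
    and [simp]: "a \<in> carrier A" "b \<in> carrier A" "c \<in> carrier A"
      "x \<in> carrier E" "y \<in> carrier E" "z \<in> carrier E"
    using assms by (auto simp: cocycle_algebra_simps)
  have "lact E (a \<otimes>\<^bsub>A\<^esub> b) z \<oplus>\<^bsub>E\<^esub> ract E (lact E a y \<oplus>\<^bsub>E\<^esub> ract E x b \<oplus>\<^bsub>E\<^esub> T (a, b)) c \<oplus>\<^bsub>E\<^esub> T (a \<otimes>\<^bsub>A\<^esub> b, c) =
      lact E (a \<otimes>\<^bsub>A\<^esub> b) z \<oplus>\<^bsub>E\<^esub> ract E (lact E a y) c \<oplus>\<^bsub>E\<^esub> ract E x (b \<otimes>\<^bsub>A\<^esub> c) \<oplus>\<^bsub>E\<^esub>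
        (T (a \<otimes>\<^bsub>A\<^esub> b, c) \<oplus>\<^bsub>E\<^esub> ract E (T (a, b)) c)"
    by (simp add: ract_simps ract_ract E.a_ac)
  also have "\<dots> = lact E (a \<otimes>\<^bsub>A\<^esub> b) z \<oplus>\<^bsub>E\<^esub> ract E (lact E a y) c \<oplus>\<^bsub>E\<^esub> ract E x (b \<otimes>\<^bsub>A\<^esub> c) \<oplus>\<^bsub>E\<^esub>
        (lact E a (T (b, c)) \<oplus>\<^bsub>E\<^esub> T (a, b \<otimes>\<^bsub>A\<^esub> c))"
    by (simp add: cocycle)
  also have "\<dots> = lact E a (lact E b z \<oplus>\<^bsub>E\<^esub> ract E y c \<oplus>\<^bsub>E\<^esub> T (b, c)) \<oplus>\<^bsub>E\<^esub> ract E x (b \<otimes>\<^bsub>A\<^esub> c) \<oplus>\<^bsub>E\<^esub> T (a, b \<otimes>\<^bsub>A\<^esub> c)"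
    by (simp add: lact_simps lact_lact lact_ract E.a_ac)
  finally show ?thesis
    by (simp add: uvw cocycle_algebra_simps mult_assoc)
qed

text \<open>Provides the upper bound without which the supremum in \<open>cocycle_const\<close>
  would say nothing about the product.\<close>

lemma sum_nrm_mult_bounded:
  "\<exists>K\<ge>0. \<forall>u\<in>carrier AT. \<forall>v\<in>carrier AT.
    sum_nrm A E (cocycle_mult A E T u v) \<le> K * sum_nrm A E u * sum_nrm A E v"
proof -
  obtain L where L: "\<And>a x. \<lbrakk>a \<in> carrier A; x \<in> carrier E\<rbrakk> \<Longrightarrow>
      nrm E (lact E a x) \<le> L * nrm A a * nrm E x \<and> nrm E (ract E x a) \<le> L * nrm A a * nrm E x"
    using act_bounded by blast
  obtain M where M: "\<And>a b. \<lbrakk>a \<in> carrier A; b \<in> carrier A\<rbrakk> \<Longrightarrow>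
      nrm E (T (a, b)) \<le> M * nrm A a * nrm A b"
    using bounded by blast
  \<comment> \<open>The three summands account for the product of \<open>A\<close>, the two module
    actions and \<open>T\<close>.\<close>
  define K where "K = 1 + \<bar>L\<bar> + \<bar>M\<bar>"
  have "sum_nrm A E (cocycle_mult A E T u v) \<le> K * sum_nrm A E u * sum_nrm A E v"
    if uv: "u \<in> carrier AT" "v \<in> carrier AT" for u v
  proof -
    obtain a b x y where u: "u = (a, x)" "a \<in> carrier A" "x \<in> carrier E"
      and v: "v = (b, y)" "b \<in> carrier A" "y \<in> carrier E"
      using uv by (auto simp: cocycle_algebra_simps)
    define p q r s where "p = nrm A a" and "q = nrm A b" and "r = nrm E x" and "s = nrm E y"
    have pos: "p \<ge> 0" "q \<ge> 0" "r \<ge> 0" "s \<ge> 0"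
      using u v nrm_nonneg E.nrm_nonneg by (auto simp: p_def q_def r_def s_def)
    have "nrm E (lact E a y \<oplus>\<^bsub>E\<^esub> ract E x b \<oplus>\<^bsub>E\<^esub> T (a, b)) \<le>
        nrm E (lact E a y) + nrm E (ract E x b) + nrm E (T (a, b))"
      using E.nrm_triangle[of "lact E a y \<oplus>\<^bsub>E\<^esub> ract E x b" "T (a, b)"]
        E.nrm_triangle[of "lact E a y" "ract E x b"] u v by simp
    also have "\<dots> \<le> L * p * s + L * q * r + M * p * q"
      using L[OF u(2) v(3)] L[OF v(2) u(3)] M[OF u(2) v(2)] by (simp add: p_def q_def r_def s_def)
    also have "\<dots> \<le> \<bar>L\<bar> * p * s + \<bar>L\<bar> * q * r + \<bar>M\<bar> * p * q"
      using pos by (intro add_mono mult_right_mono) auto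
    finally have "sum_nrm A E (cocycle_mult A E T u v) \<le>
        p * q + (\<bar>L\<bar> * p * s + \<bar>L\<bar> * q * r + \<bar>M\<bar> * p * q)"
      using nrm_mult[OF u(2) v(2)] by (simp add: sum_nrm_def cocycle_mult_def u v p_def q_def)
    also have "\<dots> \<le> K * (p + r) * (q + s)"
    proof -
      \<comment> \<open>The difference of the two sides is expanded into a sum of visibly
        nonnegative terms.\<close>
      have "K * (p + r) * (q + s) - (p * q + (\<bar>L\<bar> * p * s + \<bar>L\<bar> * q * r + \<bar>M\<bar> * p * q)) =
          p * s + r * q + r * s + \<bar>L\<bar> * (p * q + r * s) + \<bar>M\<bar> * (p * s + r * q + r * s)"
        by (simp add: K_def algebra_simps)
      moreover have "\<dots> \<ge> 0"
        using pos by (intro add_nonneg_nonneg mult_nonneg_nonneg) auto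
      ultimately show ?thesis by linarith
    qed
    finally show ?thesis
      by (simp add: sum_nrm_def u v p_def q_def r_def s_def)
  qed
  then show ?thesis
    by (intro exI[of _ K]) (simp add: K_def)
qed

lemma sum_nrm_mult_le:
  assumes u: "u \<in> carrier AT" and v: "v \<in> carrier AT"
  shows "sum_nrm A E (u \<otimes>\<^bsub>AT\<^esub> v) \<le> C * sum_nrm A E u * sum_nrm A E v"
proof -
  interpret AT: normed_space AT by (rule normed_space_AT)
  let ?S = "{sum_nrm A E (cocycle_mult A E T u v) |u v.
     u \<in> carrier A \<times> carrier E \<and> v \<in> carrier A \<times> carrier E \<and>
     sum_nrm A E u \<le> 1 \<and> sum_nrm A E v \<le> 1}"
  have mult_eq: "cocycle_mult A E T = mult AT" by (simp add: cocycle_algebra_def)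
  have nrm_eq: "nrm AT u = C * sum_nrm A E u" for u by (simp add: cocycle_algebra_def)
  have nonneg: "sum_nrm A E u \<ge> 0" if "u \<in> carrier AT" for u
    using that nrm_nonneg E.nrm_nonneg by (auto simp: sum_nrm_def cocycle_algebra_simps)
  obtain K where K: "\<And>u v. \<lbrakk>u \<in> carrier AT; v \<in> carrier AT\<rbrakk> \<Longrightarrow>
      sum_nrm A E (cocycle_mult A E T u v) \<le> K * sum_nrm A E u * sum_nrm A E v" "K \<ge> 0"
    using sum_nrm_mult_bounded by blast
  have "bdd_above ?S"
  proof (rule bdd_aboveI[of _ K], clarify)
    fix a x b y
    assume *: "a \<in> carrier A" "x \<in> carrier E" "b \<in> carrier A" "y \<in> carrier E"
      "sum_nrm A E (a, x) \<le> 1" "sum_nrm A E (b, y) \<le> 1"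
    then have c: "(a, x) \<in> carrier AT" "(b, y) \<in> carrier AT" by (simp_all add: cocycle_algebra_simps)
    have "sum_nrm A E (a, x) * sum_nrm A E (b, y) \<le> 1"
      using mult_mono[OF *(5,6)] nonneg[OF c(1)] nonneg[OF c(2)] by simp
    from mult_left_mono[OF this K(2)]
    show "sum_nrm A E (cocycle_mult A E T (a, x) (b, y)) \<le> K"
      using K(1)[OF c] by (simp add: mult.assoc)
  qed
  then have unit: "sum_nrm A E (u \<otimes>\<^bsub>AT\<^esub> v) \<le> C"
    if "u \<in> carrier AT" "v \<in> carrier AT" "sum_nrm A E u \<le> 1" "sum_nrm A E v \<le> 1" for u v
  proof -
    have "sum_nrm A E (u \<otimes>\<^bsub>AT\<^esub> v) \<in> ?S"
      using that unfolding mult_eq cocycle_algebra_simps by blast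
    then have "sum_nrm A E (u \<otimes>\<^bsub>AT\<^esub> v) \<le> Sup ?S"
      using \<open>bdd_above ?S\<close> by (rule cSup_upper)
    then show ?thesis
      unfolding cocycle_const_def by linarith
  qed
  \<comment> \<open>A vector with \<open>sum_nrm\<close> equal to 1 has norm \<open>C\<close> in
    \<open>AT\<close>, hence the radius \<open>C\<close>. The bound on that sphere is
    \<open>C * C\<close>, and dividing by the square of the radius leaves 1.\<close>
  have "nrm AT (u \<otimes>\<^bsub>AT\<^esub> v) \<le> C * C / C\<^sup>2 * nrm AT u * nrm AT v"
  proof (rule bilinear_bound[OF AT.normed_space_axioms AT.normed_space_axioms AT.normed_space_axioms
        mult_AT_bilinear C_pos _ u v])
    fix u v assume "u \<in> carrier AT" "v \<in> carrier AT" "nrm AT u = C" "nrm AT v = C"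
    then have "sum_nrm A E (u \<otimes>\<^bsub>AT\<^esub> v) \<le> C"
      using C_pos by (intro unit) (auto simp: nrm_eq)
    then show "nrm AT (u \<otimes>\<^bsub>AT\<^esub> v) \<le> C * C"
      using C_pos by (simp add: nrm_eq)
  qed
  then have "C * sum_nrm A E (u \<otimes>\<^bsub>AT\<^esub> v) \<le> C * (C * sum_nrm A E u * sum_nrm A E v)"
    using C_pos by (simp add: nrm_eq power2_eq_square mult_ac)
  then show ?thesis
    using C_pos mult_le_cancel_left_pos by blast
qed

lemma banach_algebra_AT: "banach_algebra AT"
proof -
  interpret AT: banach_space AT by (rule banach_space_AT)
  show ?thesis
  proof unfold_locales
    fix u v assume "u \<in> carrier AT" "v \<in> carrier AT"
    from mult_left_mono[OF sum_nrm_mult_le[OF this], of C]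
    show "nrm AT (u \<otimes>\<^bsub>AT\<^esub> v) \<le> nrm AT u * nrm AT v"
      using C_pos by (simp add: cocycle_algebra_def mult_ac)
  qed (use mult_AT_bilinear mult_AT_assoc in auto)
qed

end

section \<open>Singular admissible extensions\<close>

lemma (in banach_bimodule) zero_mult_simps:
  "carrier (zero_mult E) = carrier E" "add (zero_mult E) = add E" "zero (zero_mult E) = zero E"
  "smult (zero_mult E) = smult E" "nrm (zero_mult E) = nrm E"
  "mult (zero_mult E) = (\<lambda>_ _. \<zero>\<^bsub>E\<^esub>)"
  by (simp_all add: zero_mult_def)

lemma (in banach_bimodule) banach_algebra_zero_mult: "banach_algebra (zero_mult E)"
proof -
  have "abelian_group (zero_mult E)"
    by (rule abelian_groupI)
      (auto simp: zero_mult_simps E.a_ac intro: bexI[of _ "\<ominus>\<^bsub>E\<^esub> x" for x] E.l_neg)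
  then interpret Z: normed_space "zero_mult E"
    by (rule normed_spaceI)
      (auto simp: zero_mult_simps E.smul_add_left E.smul_add_right E.smul_smul E.nrm_nonneg
        E.nrm_eq_zero E.nrm_triangle E.nrm_smult)
  \<comment> \<open>\<open>zero_mult E\<close> is another record, so its subtraction is first
    identified with that of \<open>E\<close>; the norm being the same, completeness then carries
    over.\<close>
  have diff: "x \<ominus>\<^bsub>zero_mult E\<^esub> y = x \<ominus>\<^bsub>E\<^esub> y" if "x \<in> carrier E" "y \<in> carrier E" for x y
    using that Z.diff_eq_iff[of x y "x \<ominus>\<^bsub>E\<^esub> y"] by (simp add: zero_mult_simps)
  interpret Z: banach_space "zero_mult E"
  proof (rule banach_spaceI[OF Z.normed_space_axioms])
    fix s :: "nat \<Rightarrow> 'e"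
    assume "\<And>n. s n \<in> carrier (zero_mult E)"
      "\<And>\<epsilon>. 0 < \<epsilon> \<Longrightarrow> \<exists>N. \<forall>m\<ge>N. \<forall>n\<ge>N. nrm (zero_mult E) (s m \<ominus>\<^bsub>zero_mult E\<^esub> s n) < \<epsilon>"
    then show "\<exists>l\<in>carrier (zero_mult E). (\<lambda>n. nrm (zero_mult E) (s n \<ominus>\<^bsub>zero_mult E\<^esub> l)) \<longlonglongrightarrow> 0"
      using E.complete_sequence[of s] by (simp add: zero_mult_simps diff cong: bex_cong) blast
  qed
  show ?thesis
    by unfold_locales
      (auto simp: zero_mult_simps bilinear_on_def linear_on_def E.nrm_nonneg)
qed

lemma (in banach_bimodule) on_zero_mult:
  "linear_on (zero_mult E) W f \<longleftrightarrow> linear_on E W f"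
  "bounded_linear_on (zero_mult E) W f \<longleftrightarrow> bounded_linear_on E W f"
  by (simp_all add: linear_on_def bounded_linear_on_def zero_mult_simps)

locale sa_extension = banach_bimodule A E
  for A :: "('k::real_normed_field, 'a) normed_alg" and E :: "('k, 'a, 'e) bimodule" +
  fixes X :: "('k, 'a, 'e, 'm) extension"
  assumes X: "X \<in> SA_extensions A E"
begin

abbreviation "M \<equiv> ext_alg X"
abbreviation "i \<equiv> ext_incl X"
abbreviation "q \<equiv> ext_quot X"

lemma extension: "banach_extension A (zero_mult E) X"
  using X by (simp add: SA_extensions_def singular_extension_by_def)

sublocale M: banach_algebra M
  using extension by (simp add: banach_extension_def)

lemma banach_M: "banach_space M" and normed_M: "normed_space M"
  by unfold_locales

lemma i_bounded: "bounded_linear_on E M i"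
  using extension by (simp add: banach_extension_def on_zero_mult)

lemmas i_linear = bounded_linear_onD[OF i_bounded]

lemma q_bounded: "bounded_linear_on M A q"
  using extension by (simp add: banach_extension_def)

lemmas q_linear = bounded_linear_onD[OF q_bounded]

lemmas i_simps = linear_onD(2,3)[OF i_linear] and q_simps = linear_onD(2,3)[OF q_linear]

lemma i_closed [simp]: "x \<in> carrier E \<Longrightarrow> i x \<in> carrier M"
  by (rule linear_onD(1)[OF i_linear])

lemma q_closed [simp]: "u \<in> carrier M \<Longrightarrow> q u \<in> carrier A"
  by (rule linear_onD(1)[OF q_linear])

lemma q_mult [simp]: "\<lbrakk>u \<in> carrier M; v \<in> carrier M\<rbrakk> \<Longrightarrow> q (u \<otimes>\<^bsub>M\<^esub> v) = q u \<otimes>\<^bsub>A\<^esub> q v"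
  using extension by (simp add: banach_extension_def algebra_hom_def)

lemma M_mult_closed [simp]: "\<lbrakk>u \<in> carrier M; v \<in> carrier M\<rbrakk> \<Longrightarrow> u \<otimes>\<^bsub>M\<^esub> v \<in> carrier M"
  by (rule bilinear_onD(1)[OF M.mult_bilinear])

lemma i_inj: "inj_on i (carrier E)"
  and i_image: "i ` carrier E = {u \<in> carrier M. q u = \<zero>\<^bsub>A\<^esub>}"
  using extension by (simp_all add: banach_extension_def zero_mult_simps)

lemma i_eq_iff [simp]: "\<lbrakk>x \<in> carrier E; y \<in> carrier E\<rbrakk> \<Longrightarrow> i x = i y \<longleftrightarrow> x = y"
  using i_inj by (auto simp: inj_on_def)

lemma q_i [simp]: "x \<in> carrier E \<Longrightarrow> q (i x) = \<zero>\<^bsub>A\<^esub>"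
  using i_image by blast

lemma kernelE:
  assumes "u \<in> carrier M" "q u = \<zero>\<^bsub>A\<^esub>"
  obtains x where "x \<in> carrier E" "u = i x"
  using assms i_image by blast

lemma i_mult: "\<lbrakk>x \<in> carrier E; u \<in> carrier M\<rbrakk> \<Longrightarrow> i x \<otimes>\<^bsub>M\<^esub> u = i (ract E x (q u))"
  and mult_i: "\<lbrakk>x \<in> carrier E; u \<in> carrier M\<rbrakk> \<Longrightarrow> u \<otimes>\<^bsub>M\<^esub> i x = i (lact E (q u) x)"
  using X by (simp_all add: SA_extensions_def singular_extension_by_def)

lemma q_diff: "\<lbrakk>u \<in> carrier M; v \<in> carrier M\<rbrakk> \<Longrightarrow> q (u \<ominus>\<^bsub>M\<^esub> v) = q u \<ominus>\<^bsub>A\<^esub> q v"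
proof -
  interpret normed_pair M A by unfold_locales
  show "\<lbrakk>u \<in> carrier M; v \<in> carrier M\<rbrakk> \<Longrightarrow> q (u \<ominus>\<^bsub>M\<^esub> v) = q u \<ominus>\<^bsub>A\<^esub> q v"
    by (rule linear_diff[OF q_linear])
qed

lemma i_zero [simp]: "i \<zero>\<^bsub>E\<^esub> = \<zero>\<^bsub>M\<^esub>"
proof -
  interpret normed_pair E M by unfold_locales
  show ?thesis by (rule linear_zero[OF i_linear])
qed

lemma bounded_section: "\<exists>Q. bounded_linear_on A M Q \<and> (\<forall>a\<in>carrier A. q (Q a) = a)"
  using X by (auto simp: SA_extensions_def admissible_def)

section \<open>The splitting map of a linear section\<close>

context
  fixes Q
  assumes Q: "linear_on A M Q" and q_Q: "\<And>a. a \<in> carrier A \<Longrightarrow> q (Q a) = a"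
begin

abbreviation "splitting_map \<equiv> (\<lambda>(a, x). Q a \<oplus>\<^bsub>M\<^esub> i x)"

lemma Q_closed [simp]: "a \<in> carrier A \<Longrightarrow> Q a \<in> carrier M"
  by (rule linear_onD(1)[OF Q])

text \<open>Applying \<open>q\<close> recovers \<open>a\<close>, and
  \<open>u \<ominus> Q (q u)\<close> lies in the kernel, hence in the image of \<open>i\<close>. In
  particular the carrier of \<open>M\<close> has the size of \<open>A \<times> E\<close>.\<close>

lemma splitting_map_bij: "bij_betw splitting_map (carrier A \<times> carrier E) (carrier M)"
proof (rule bij_betwI')
  fix p p' assume "p \<in> carrier A \<times> carrier E" "p' \<in> carrier A \<times> carrier E"
  then obtain a x b y where p: "p = (a, x)" "p' = (b, y)"
    and [simp]: "a \<in> carrier A" "b \<in> carrier A" "x \<in> carrier E" "y \<in> carrier E" by auto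
  have "a = b" if "Q a \<oplus>\<^bsub>M\<^esub> i x = Q b \<oplus>\<^bsub>M\<^esub> i y"
    using arg_cong[OF that, of q] by (simp add: q_simps q_Q)
  then show "splitting_map p = splitting_map p' \<longleftrightarrow> p = p'"
    using p by (auto simp: M.a_comm[of "Q b"])
next
  fix u assume u: "u \<in> carrier M"
  then have "q (u \<ominus>\<^bsub>M\<^esub> Q (q u)) = \<zero>\<^bsub>A\<^esub>"
    by (simp add: q_diff q_Q)
  then obtain x where x: "x \<in> carrier E" "u \<ominus>\<^bsub>M\<^esub> Q (q u) = i x"
    using kernelE[of "u \<ominus>\<^bsub>M\<^esub> Q (q u)"] u by auto
  then have "u = Q (q u) \<oplus>\<^bsub>M\<^esub> i x"
    using u M.diff_add_cancel[of u "Q (q u)"] by (simp add: M.a_comm)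
  then show "\<exists>p\<in>carrier A \<times> carrier E. u = splitting_map p"
    using x(1) u by (intro bexI[of _ "(q u, x)"]) auto
qed auto

text \<open>The linear structure of \<open>cocycle_algebra A E T\<close> does not depend on
  \<open>T\<close>, so \<open>T\<close> is arbitrary here and in
  \<open>splitting_map_bounded\<close>: it is the cocycle of \<open>Q\<close> in one use and zero in
  another.\<close>

lemma splitting_map_linear: "linear_on (cocycle_algebra A E T) M splitting_map"
  unfolding linear_on_def
  by (auto simp: cocycle_algebra_def linear_onD[OF Q] i_simps M.smul_add_right M.a_ac)

lemma splitting_map_bounded:
  assumes "bounded_linear_on A M Q"
  shows "bounded_linear_on (cocycle_algebra A E T) M splitting_map"
proof -
  interpret AM: normed_pair A M by unfold_locales
  interpret EM: normed_pair E M by unfold_locales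
  obtain K where K: "K > 0" "\<And>a. a \<in> carrier A \<Longrightarrow> nrm M (Q a) \<le> K * nrm A a"
    using assms by (rule AM.bounded_linear_pos_bound) blast
  obtain L where L: "L > 0" "\<And>x. x \<in> carrier E \<Longrightarrow> nrm M (i x) \<le> L * nrm E x"
    using i_bounded by (rule EM.bounded_linear_pos_bound) blast
  have "nrm M (Q a \<oplus>\<^bsub>M\<^esub> i x) \<le> (K + L) * (cocycle_const A E T * (nrm A a + nrm E x))"
    if ax: "a \<in> carrier A" "x \<in> carrier E" for a x
  proof -
    have nn: "nrm A a \<ge> 0" "nrm E x \<ge> 0" using ax nrm_nonneg E.nrm_nonneg by auto
    have "nrm M (Q a \<oplus>\<^bsub>M\<^esub> i x) \<le> K * nrm A a + L * nrm E x"
      using M.nrm_triangle[of "Q a" "i x"] K(2)[OF ax(1)] L(2)[OF ax(2)] ax by simp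
    also have "\<dots> \<le> (K + L) * (1 * (nrm A a + nrm E x))"
      using nn K(1) L(1) by (simp add: distrib_left distrib_right)
    also have "\<dots> \<le> (K + L) * (cocycle_const A E T * (nrm A a + nrm E x))"
      using nn K(1) L(1) by (intro mult_left_mono mult_right_mono) (auto simp: cocycle_const_def)
    finally show ?thesis .
  qed
  then have "\<forall>p\<in>carrier (cocycle_algebra A E T).
      nrm M (splitting_map p) \<le> (K + L) * nrm (cocycle_algebra A E T) p"
    by (auto simp: cocycle_algebra_def sum_nrm_def)
  then show ?thesis
    using splitting_map_linear unfolding bounded_linear_on_def by blast
qed

text \<open>The hypothesis on \<open>T\<close> says that \<open>i (T (a, b))\<close> is the defect
  \<open>Q a Q b - Q (a b)\<close>, and this is precisely the term that \<open>cocycle_mult\<close>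
  adds to the module actions.\<close>

lemma splitting_map_equivalence:
  assumes T: "bounded_cocycle A E T"
    and T_Q: "\<And>a b. \<lbrakk>a \<in> carrier A; b \<in> carrier A\<rbrakk> \<Longrightarrow>
      i (T (a, b)) \<oplus>\<^bsub>M\<^esub> Q (a \<otimes>\<^bsub>A\<^esub> b) = Q a \<otimes>\<^bsub>M\<^esub> Q b"
  shows "equivalence_map E (cocycle_extension A E T) X splitting_map"
proof -
  interpret T: bounded_cocycle A E T by fact
  have "splitting_map (mult (cocycle_algebra A E T) (a, x) (b, y)) =
      (Q a \<oplus>\<^bsub>M\<^esub> i x) \<otimes>\<^bsub>M\<^esub> (Q b \<oplus>\<^bsub>M\<^esub> i y)"
    if [simp]: "a \<in> carrier A" "x \<in> carrier E" "b \<in> carrier A" "y \<in> carrier E" for a x b y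
  proof -
    have "(Q a \<oplus>\<^bsub>M\<^esub> i x) \<otimes>\<^bsub>M\<^esub> (Q b \<oplus>\<^bsub>M\<^esub> i y) =
        (Q a \<otimes>\<^bsub>M\<^esub> Q b \<oplus>\<^bsub>M\<^esub> i x \<otimes>\<^bsub>M\<^esub> Q b) \<oplus>\<^bsub>M\<^esub> (Q a \<otimes>\<^bsub>M\<^esub> i y \<oplus>\<^bsub>M\<^esub> i x \<otimes>\<^bsub>M\<^esub> i y)"
      by (simp add: bilinear_onD(2,3)[OF M.mult_bilinear])
    \<comment> \<open>\<open>i y\<close> acts on \<open>E\<close> through
      \<open>q (i y) = 0\<close>, so the kernel has square zero.\<close>
    also have "i x \<otimes>\<^bsub>M\<^esub> i y = \<zero>\<^bsub>M\<^esub>"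
    proof -
      have "ract E x \<zero>\<^bsub>A\<^esub> = \<zero>\<^bsub>E\<^esub>"
        using ract_simps(4)[of x "\<zero>\<^bsub>A\<^esub>" 0] by simp
      then show ?thesis by (simp add: i_mult)
    qed
    also have "Q a \<otimes>\<^bsub>M\<^esub> Q b \<oplus>\<^bsub>M\<^esub> i x \<otimes>\<^bsub>M\<^esub> Q b \<oplus>\<^bsub>M\<^esub> (Q a \<otimes>\<^bsub>M\<^esub> i y \<oplus>\<^bsub>M\<^esub> \<zero>\<^bsub>M\<^esub>) =
        Q (a \<otimes>\<^bsub>A\<^esub> b) \<oplus>\<^bsub>M\<^esub> i (lact E a y \<oplus>\<^bsub>E\<^esub> ract E x b \<oplus>\<^bsub>E\<^esub> T (a, b))"
      by (simp add: T_Q[symmetric] i_mult mult_i q_Q i_simps M.a_ac)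
    finally show ?thesis by (simp add: T.cocycle_algebra_simps)
  qed
  then have "algebra_hom (cocycle_algebra A E T) M splitting_map"
    unfolding algebra_hom_def using splitting_map_linear
    by (auto simp: T.cocycle_algebra_simps(1))
  moreover have "Q \<zero>\<^bsub>A\<^esub> = \<zero>\<^bsub>M\<^esub>"
    using linear_onD(3)[OF Q, of "\<zero>\<^bsub>A\<^esub>" 0] by simp
  ultimately show ?thesis
    using splitting_map_bij
    by (auto simp: equivalence_map_def cocycle_extension_def T.cocycle_algebra_simps(1) q_simps q_Q)
qed

end

text \<open>The retraction is the second coordinate of the inverse of the splitting map \<open>A \<oplus> E \<rightarrow> M\<close> of a bounded
  section; as only the Banach space \<open>A \<oplus> E\<close> matters, it is taken with the zero cocycle.\<close>

lemma bounded_retraction: "\<exists>P. bounded_linear_on M E P \<and> (\<forall>x\<in>carrier E. P (i x) = x)"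
proof -
  obtain Q where Q: "bounded_linear_on A M Q" and q_Q: "\<And>a. a \<in> carrier A \<Longrightarrow> q (Q a) = a"
    using bounded_section by blast
  note lin = bounded_linear_onD[OF Q]
  let ?\<phi> = "\<lambda>(a, x). Q a \<oplus>\<^bsub>M\<^esub> i x"
  interpret Z: bounded_cocycle A E "\<lambda>_. \<zero>\<^bsub>E\<^esub>"
  proof unfold_locales
    show "bilinear_on A A E (curry (\<lambda>_. \<zero>\<^bsub>E\<^esub>))"
      by (simp add: bilinear_on_def linear_on_def)
    show "\<exists>K. \<forall>a\<in>carrier A. \<forall>b\<in>carrier A. nrm E \<zero>\<^bsub>E\<^esub> \<le> K * nrm A a * nrm A b"
      by (intro exI[of _ 0]) simp
  qed (simp add: normed_pair.linear_zero[OF normed_pair_E_E lact_linear] normed_pair.linear_zero[OF normed_pair_E_E ract_linear])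
  let ?\<psi> = "inv_into (carrier Z.AT) ?\<phi>"
  have bij: "bij_betw ?\<phi> (carrier Z.AT) (carrier M)"
    using splitting_map_bij[OF lin q_Q] by (simp add: Z.cocycle_algebra_simps)
  have inv: "bounded_linear_on M Z.AT ?\<psi>"
    by (rule bounded_linear_inv_into[OF Z.banach_space_AT banach_M splitting_map_bounded[OF lin q_Q Q] bij])
  have "nrm E x \<le> 1 * nrm Z.AT (a, x)" if "a \<in> carrier A" "x \<in> carrier E" for a x
  proof -
    have "1 * nrm E x \<le> Z.C * (nrm A a + nrm E x)"
      using Z.C_ge_1 nrm_nonneg[OF that(1)] E.nrm_nonneg[OF that(2)] by (intro mult_mono) auto
    then show ?thesis by (simp add: Z.cocycle_algebra_simps)
  qed
  then have snd: "bounded_linear_on Z.AT E snd"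
    unfolding bounded_linear_on_def linear_on_def
    by (auto simp: Z.cocycle_algebra_simps simp del: mult_1 intro!: exI[of _ 1])
  have "?\<psi> (i x) = (\<zero>\<^bsub>A\<^esub>, x)" if "x \<in> carrier E" for x
  proof (rule inv_into_f_eq)
    show "inj_on ?\<phi> (carrier Z.AT)"
      using bij by (rule bij_betw_imp_inj_on)
    show "?\<phi> (\<zero>\<^bsub>A\<^esub>, x) = i x"
      using that linear_onD(3)[OF lin, of "\<zero>\<^bsub>A\<^esub>" 0] linear_onD(1)[OF lin] by simp
  qed (use that in \<open>simp add: Z.cocycle_algebra_simps\<close>)
  then show ?thesis
    using bounded_linear_on_compose[OF normed_M Z.normed_space_AT normed_E inv snd]
    by (intro exI[of _ "\<lambda>u. snd (?\<psi> u)"]) simp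
qed

text \<open>\<open>Q\<close> is not assumed bounded; the retraction \<open>P\<close> rests on the
  bounded section from admissibility, which may be a different one.\<close>

lemma cocycle_of_cf_section:
  assumes Q: "cf_homomorphism A M Q" and q_Q: "\<And>a. a \<in> carrier A \<Longrightarrow> q (Q a) = a"
  shows "\<exists>T\<in>Z2K A E. \<forall>a\<in>carrier A. \<forall>b\<in>carrier A.
    i (T (a, b)) \<oplus>\<^bsub>M\<^esub> Q (a \<otimes>\<^bsub>A\<^esub> b) = Q a \<otimes>\<^bsub>M\<^esub> Q b"
proof -
  obtain P where P: "bounded_linear_on M E P" "\<And>x. x \<in> carrier E \<Longrightarrow> P (i x) = x"
    using bounded_retraction by blast
  have lin: "linear_on A M Q"
    and cpt: "compact_bilinear A M (\<lambda>(a, b). Q a \<otimes>\<^bsub>M\<^esub> Q b \<ominus>\<^bsub>M\<^esub> Q (a \<otimes>\<^bsub>A\<^esub> b))"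
    using Q by (auto simp: cf_homomorphism_def)
  note Q_closed [simp] = linear_onD(1)[OF lin]
  \<comment> \<open>\<open>P\<close> takes the place of the inverse of \<open>i\<close>: the two
    agree on the kernel, but \<open>P\<close> is bounded on all of \<open>M\<close> and therefore
    preserves compactness.\<close>
  define S where "S = (\<lambda>(a, b). P (Q a \<otimes>\<^bsub>M\<^esub> Q b \<ominus>\<^bsub>M\<^esub> Q (a \<otimes>\<^bsub>A\<^esub> b)))"
  have S_cpt: "compact_bilinear A E S"
    using compact_bilinear_compose[OF banach_M banach_E cpt P(1)]
    by (simp add: S_def case_prod_unfold)
  define T where "T = restrict S (carrier A \<times> carrier A)"
  have T_cpt: "compact_bilinear A E T"
    using S_cpt compact_bilinear_cong[OF normed_A, of T S E] by (simp add: T_def)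
  have T_closed [simp]: "T (a, b) \<in> carrier E" if "a \<in> carrier A" "b \<in> carrier A" for a b
    using T_cpt that bilinear_onD(1)[of A A E "curry T" a b] by (simp add: compact_bilinear_def)
  have iT: "i (T (a, b)) \<oplus>\<^bsub>M\<^esub> Q (a \<otimes>\<^bsub>A\<^esub> b) = Q a \<otimes>\<^bsub>M\<^esub> Q b"
    if [simp]: "a \<in> carrier A" "b \<in> carrier A" for a b
  proof -
    have "q (Q a \<otimes>\<^bsub>M\<^esub> Q b \<ominus>\<^bsub>M\<^esub> Q (a \<otimes>\<^bsub>A\<^esub> b)) = \<zero>\<^bsub>A\<^esub>"
      by (simp add: q_diff q_Q)
    then obtain x where x: "x \<in> carrier E" "Q a \<otimes>\<^bsub>M\<^esub> Q b \<ominus>\<^bsub>M\<^esub> Q (a \<otimes>\<^bsub>A\<^esub> b) = i x"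
      using kernelE[of "Q a \<otimes>\<^bsub>M\<^esub> Q b \<ominus>\<^bsub>M\<^esub> Q (a \<otimes>\<^bsub>A\<^esub> b)"] by auto
    then have "i (T (a, b)) = Q a \<otimes>\<^bsub>M\<^esub> Q b \<ominus>\<^bsub>M\<^esub> Q (a \<otimes>\<^bsub>A\<^esub> b)"
      by (simp add: T_def S_def P(2))
    then show ?thesis by simp
  qed
  have "lact E a (T (b, c)) \<oplus>\<^bsub>E\<^esub> T (a, b \<otimes>\<^bsub>A\<^esub> c) = T (a \<otimes>\<^bsub>A\<^esub> b, c) \<oplus>\<^bsub>E\<^esub> ract E (T (a, b)) c"
    if [simp]: "a \<in> carrier A" "b \<in> carrier A" "c \<in> carrier A" for a b c
  proof -
    \<comment> \<open>Applying \<open>i\<close> and adding \<open>?Qabc\<close> turns both sides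
      into a bracketing of \<open>Q a Q b Q c\<close>; associativity in \<open>M\<close> and
      injectivity of \<open>i\<close> then give the identity.\<close>
    let ?Qabc = "Q (a \<otimes>\<^bsub>A\<^esub> b \<otimes>\<^bsub>A\<^esub> c)"
    have "i (lact E a (T (b, c)) \<oplus>\<^bsub>E\<^esub> T (a, b \<otimes>\<^bsub>A\<^esub> c)) \<oplus>\<^bsub>M\<^esub> ?Qabc =
        Q a \<otimes>\<^bsub>M\<^esub> i (T (b, c)) \<oplus>\<^bsub>M\<^esub> (i (T (a, b \<otimes>\<^bsub>A\<^esub> c)) \<oplus>\<^bsub>M\<^esub> ?Qabc)"
      by (simp add: i_simps mult_i q_Q M.a_assoc)
    also have "\<dots> = Q a \<otimes>\<^bsub>M\<^esub> i (T (b, c)) \<oplus>\<^bsub>M\<^esub> Q a \<otimes>\<^bsub>M\<^esub> Q (b \<otimes>\<^bsub>A\<^esub> c)"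
      using iT[of a "b \<otimes>\<^bsub>A\<^esub> c"] by (simp add: mult_assoc)
    also have "\<dots> = Q a \<otimes>\<^bsub>M\<^esub> (Q b \<otimes>\<^bsub>M\<^esub> Q c)"
      using bilinear_onD(3)[OF M.mult_bilinear, of "Q a" "i (T (b, c))" "Q (b \<otimes>\<^bsub>A\<^esub> c)"]
      by (simp add: iT)
    also have "\<dots> = (Q a \<otimes>\<^bsub>M\<^esub> Q b) \<otimes>\<^bsub>M\<^esub> Q c"
      by (simp add: M.mult_assoc)
    also have "\<dots> = i (T (a, b)) \<otimes>\<^bsub>M\<^esub> Q c \<oplus>\<^bsub>M\<^esub> Q (a \<otimes>\<^bsub>A\<^esub> b) \<otimes>\<^bsub>M\<^esub> Q c"
      using bilinear_onD(2)[OF M.mult_bilinear, of "i (T (a, b))" "Q c" "Q (a \<otimes>\<^bsub>A\<^esub> b)"]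
      by (simp add: iT)
    also have "\<dots> = i (T (a \<otimes>\<^bsub>A\<^esub> b, c) \<oplus>\<^bsub>E\<^esub> ract E (T (a, b)) c) \<oplus>\<^bsub>M\<^esub> ?Qabc"
      by (simp add: iT[symmetric, of "a \<otimes>\<^bsub>A\<^esub> b" c] i_simps i_mult q_Q M.a_ac)
    finally show ?thesis by simp
  qed
  then have "T \<in> Z2K A E"
    using T_cpt delta2_eq_zero_iff[of T]
    by (auto simp: Z2K_def K2_def compact_bilinear_def) (simp add: T_def)
  then show ?thesis
    using iT by blast
qed

end

text \<open>Serves both the extension of a cocycle and a transported extension. The remaining axioms
  follow: the kernel is closed as the preimage of 0 and an ideal by the module identities,
  \<open>ext_incl Y\<close> is multiplicative because \<open>ext_quot Y\<close> kills its image, and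
  the section makes \<open>ext_quot Y\<close> surjective.\<close>

lemma (in banach_bimodule) SA_extensionI:
  assumes M: "banach_algebra (ext_alg Y)"
    and i: "bounded_linear_on E (ext_alg Y) (ext_incl Y)"
    and q: "bounded_linear_on (ext_alg Y) A (ext_quot Y)"
    and q_mult: "\<And>u v. \<lbrakk>u \<in> carrier (ext_alg Y); v \<in> carrier (ext_alg Y)\<rbrakk> \<Longrightarrow>
      ext_quot Y (u \<otimes>\<^bsub>ext_alg Y\<^esub> v) = ext_quot Y u \<otimes>\<^bsub>A\<^esub> ext_quot Y v"
    and inj: "inj_on (ext_incl Y) (carrier E)"
    and image: "ext_incl Y ` carrier E = {u \<in> carrier (ext_alg Y). ext_quot Y u = \<zero>\<^bsub>A\<^esub>}"
    and i_mult: "\<And>x u. \<lbrakk>x \<in> carrier E; u \<in> carrier (ext_alg Y)\<rbrakk> \<Longrightarrow>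
      ext_incl Y x \<otimes>\<^bsub>ext_alg Y\<^esub> u = ext_incl Y (ract E x (ext_quot Y u))"
    and mult_i: "\<And>x u. \<lbrakk>x \<in> carrier E; u \<in> carrier (ext_alg Y)\<rbrakk> \<Longrightarrow>
      u \<otimes>\<^bsub>ext_alg Y\<^esub> ext_incl Y x = ext_incl Y (lact E (ext_quot Y u) x)"
    and Q: "bounded_linear_on A (ext_alg Y) Q" "\<And>a. a \<in> carrier A \<Longrightarrow> ext_quot Y (Q a) = a"
  shows "Y \<in> SA_extensions A E"
proof -
  interpret M: banach_algebra "ext_alg Y" by (rule M)
  interpret MA: normed_pair "ext_alg Y" A by unfold_locales
  let ?J = "{u \<in> carrier (ext_alg Y). ext_quot Y u = \<zero>\<^bsub>A\<^esub>}"
  note q_lin = bounded_linear_onD[OF q] and i_lin = bounded_linear_onD[OF i]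
  note [simp] = linear_onD(1)[OF q_lin] linear_onD(1)[OF i_lin]
  have q_i: "ext_quot Y (ext_incl Y x) = \<zero>\<^bsub>A\<^esub>" if "x \<in> carrier E" for x
    using image that by blast
  have "ext_incl Y x \<otimes>\<^bsub>ext_alg Y\<^esub> ext_incl Y y = ext_incl Y \<zero>\<^bsub>E\<^esub>"
    if "x \<in> carrier E" "y \<in> carrier E" for x y
    using that ract_simps(4)[of x "\<zero>\<^bsub>A\<^esub>" 0] by (simp add: i_mult q_i)
  then have hom_i: "algebra_hom (zero_mult E) (ext_alg Y) (ext_incl Y)"
    using i_lin by (simp add: algebra_hom_def on_zero_mult zero_mult_simps)
  have hom_q: "algebra_hom (ext_alg Y) A (ext_quot Y)"
    using q_lin q_mult by (simp add: algebra_hom_def)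
  have "closedin (ntop A) {\<zero>\<^bsub>A\<^esub>}"
    unfolding ntop_eq by (intro closedin_Hausdorff_singleton metric.Hausdorff_space_mtopology) simp
  from closedin_continuous_map_preimage[OF MA.bounded_linear_imp_continuous[OF q] this]
  have closed: "closedin (ntop (ext_alg Y)) ?J"
    by (simp add: M.ntop_eq)
  have "u \<otimes>\<^bsub>ext_alg Y\<^esub> x \<in> ext_incl Y ` carrier E \<and> x \<otimes>\<^bsub>ext_alg Y\<^esub> u \<in> ext_incl Y ` carrier E"
    if u: "u \<in> carrier (ext_alg Y)" and x: "x \<in> ext_incl Y ` carrier E" for u x
    using x u by (auto simp: i_mult mult_i)
  then have "closed_ideal (ext_alg Y) (ext_incl Y ` carrier E)"
    unfolding closed_ideal_def using closed
    by (auto simp: image MA.linear_zero[OF q_lin] linear_onD[OF q_lin])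
  moreover have "ext_quot Y ` carrier (ext_alg Y) = carrier A"
    using Q linear_onD(1)[OF bounded_linear_onD[OF Q(1)]] by (force simp: image_iff)
  ultimately have "banach_extension A (zero_mult E) Y"
    unfolding banach_extension_def
    using banach_A banach_algebra_zero_mult M hom_i i hom_q q inj image
    by (simp add: on_zero_mult zero_mult_simps)
  moreover have "admissible A Y"
    using Q by (auto simp: admissible_def)
  ultimately show ?thesis
    using i_mult mult_i
    by (simp add: SA_extensions_def singular_extension_by_def singular_def zero_mult_simps)
qed

section \<open>The extension of a bounded cocycle and its zero section\<close>

context bounded_cocycle
begin

abbreviation "\<Sigma>T \<equiv> cocycle_extension A E T"

lemma cocycle_extension_simps:
  "ext_alg \<Sigma>T = AT" "ext_incl \<Sigma>T x = (\<zero>\<^bsub>A\<^esub>, x)" "ext_quot \<Sigma>T = fst"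
  by (simp_all add: cocycle_extension_def)

lemma section_bounded:
  assumes S: "bounded_linear_on A E S"
  shows "bounded_linear_on A AT (\<lambda>a. (a, S a))"
proof -
  obtain K where K: "\<forall>a\<in>carrier A. nrm E (S a) \<le> K * nrm A a"
    using S by (auto simp: bounded_linear_on_def)
  have "nrm AT (a, S a) \<le> C * (1 + K) * nrm A a" if "a \<in> carrier A" for a
    using mult_left_mono[of "nrm A a + nrm E (S a)" "(1 + K) * nrm A a" C] C_pos K that
    by (simp add: cocycle_algebra_simps distrib_right mult.assoc)
  moreover have "linear_on A AT (\<lambda>a. (a, S a))"
    using bounded_linear_onD[OF S] by (auto simp: linear_on_def cocycle_algebra_simps)
  ultimately show ?thesis
    unfolding bounded_linear_on_def by blast
qed

lemma zero_section_bounded: "bounded_linear_on A AT (\<lambda>a. (a, \<zero>\<^bsub>E\<^esub>))"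
  by (rule section_bounded) (auto simp: bounded_linear_on_def linear_on_def intro!: exI[of _ 0])

lemma incl_bounded: "bounded_linear_on E AT (\<lambda>x. (\<zero>\<^bsub>A\<^esub>, x))"
  unfolding bounded_linear_on_def linear_on_def
  by (auto simp: cocycle_algebra_simps intro!: exI[of _ C])

text \<open>\<open>T\<close> vanishes as soon as one argument is 0, so multiplication by
  \<open>(0, x)\<close> reduces to the module action. Admissibility is witnessed by the zero
  section.\<close>

lemma cocycle_extension_SA: "\<Sigma>T \<in> SA_extensions A E"
proof (rule SA_extensionI)
  have "nrm A a \<le> 1 * nrm AT (a, x)" if "a \<in> carrier A" "x \<in> carrier E" for a x
  proof -
    have "1 * nrm A a \<le> C * (nrm A a + nrm E x)"
      using C_ge_1 nrm_nonneg[OF that(1)] E.nrm_nonneg[OF that(2)] by (intro mult_mono) auto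
    then show ?thesis by (simp add: cocycle_algebra_simps)
  qed
  then show "bounded_linear_on (ext_alg \<Sigma>T) A (ext_quot \<Sigma>T)"
    unfolding bounded_linear_on_def linear_on_def
    by (auto simp: cocycle_extension_simps cocycle_algebra_simps simp del: mult_1 intro!: exI[of _ 1])
  have zero: "lact E \<zero>\<^bsub>A\<^esub> x = \<zero>\<^bsub>E\<^esub>" "ract E x \<zero>\<^bsub>A\<^esub> = \<zero>\<^bsub>E\<^esub>" if "x \<in> carrier E" for x
    using that ract_simps(4)[of x "\<zero>\<^bsub>A\<^esub>" 0] lact_simps(3)[of "\<zero>\<^bsub>A\<^esub>" x 0] by auto
  have T_zero: "T (\<zero>\<^bsub>A\<^esub>, a) = \<zero>\<^bsub>E\<^esub>" "T (a, \<zero>\<^bsub>A\<^esub>) = \<zero>\<^bsub>E\<^esub>" if "a \<in> carrier A" for a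
    using that T_simps(3)[of "\<zero>\<^bsub>A\<^esub>" a 0] T_simps(4)[of a "\<zero>\<^bsub>A\<^esub>" 0] by auto
  have A_zero: "\<zero>\<^bsub>A\<^esub> \<otimes>\<^bsub>A\<^esub> a = \<zero>\<^bsub>A\<^esub>" "a \<otimes>\<^bsub>A\<^esub> \<zero>\<^bsub>A\<^esub> = \<zero>\<^bsub>A\<^esub>" if "a \<in> carrier A" for a
    using that bilinear_onD(4)[OF mult_bilinear, of "\<zero>\<^bsub>A\<^esub>" a 0]
      bilinear_onD(5)[OF mult_bilinear, of a "\<zero>\<^bsub>A\<^esub>" 0] by auto
  fix x u assume x: "x \<in> carrier E" and u: "u \<in> carrier (ext_alg \<Sigma>T)"
  obtain a y where ay: "u = (a, y)" "a \<in> carrier A" "y \<in> carrier E"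
    using u by (auto simp: cocycle_extension_simps cocycle_algebra_simps)
  show "ext_incl \<Sigma>T x \<otimes>\<^bsub>ext_alg \<Sigma>T\<^esub> u = ext_incl \<Sigma>T (ract E x (ext_quot \<Sigma>T u))"
    "u \<otimes>\<^bsub>ext_alg \<Sigma>T\<^esub> ext_incl \<Sigma>T x = ext_incl \<Sigma>T (lact E (ext_quot \<Sigma>T u) x)"
    using x ay by (simp_all add: cocycle_extension_simps cocycle_algebra_simps zero T_zero A_zero)
next
  show "bounded_linear_on A (ext_alg \<Sigma>T) (\<lambda>a. (a, \<zero>\<^bsub>E\<^esub>))"
    by (simp add: cocycle_extension_simps zero_section_bounded)
  have "bounded_linear_on E AT (ext_incl \<Sigma>T)"
    using incl_bounded by (simp add: cocycle_extension_def)
  then show "bounded_linear_on E (ext_alg \<Sigma>T) (ext_incl \<Sigma>T)"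
    by (simp add: cocycle_extension_simps)
qed (use banach_algebra_AT in \<open>auto simp: cocycle_extension_simps cocycle_algebra_simps inj_on_def\<close>)

lemma mult_zero_section:
  assumes "a \<in> carrier A" "b \<in> carrier A"
  shows "(a, \<zero>\<^bsub>E\<^esub>) \<otimes>\<^bsub>AT\<^esub> (b, \<zero>\<^bsub>E\<^esub>) = (a \<otimes>\<^bsub>A\<^esub> b, T (a, b))"
  using assms normed_pair.linear_zero[OF normed_pair_E_E lact_linear[OF assms(1)]]
    normed_pair.linear_zero[OF normed_pair_E_E ract_linear[OF assms(2)]]
  by (simp add: cocycle_algebra_simps)

text \<open>The zero section works: its multiplicative defect is \<open>T\<close> followed by the
  bounded inclusion of \<open>E\<close>, and bounded maps preserve compactness.\<close>

lemma cocycle_extension_cf_splits_strongly: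
  assumes "compact_bilinear A E T"
  shows "cf_splits_strongly A \<Sigma>T"
proof -
  have eq: "(a, \<zero>\<^bsub>E\<^esub>) \<otimes>\<^bsub>AT\<^esub> (b, \<zero>\<^bsub>E\<^esub>) \<ominus>\<^bsub>AT\<^esub> (a \<otimes>\<^bsub>A\<^esub> b, \<zero>\<^bsub>E\<^esub>) = (\<zero>\<^bsub>A\<^esub>, T (a, b))"
    if "a \<in> carrier A" "b \<in> carrier A" for a b
    using that by (simp add: mult_zero_section diff_AT)
  have "compact_bilinear A AT (\<lambda>p. (\<zero>\<^bsub>A\<^esub>, T p))"
    by (rule compact_bilinear_compose[OF banach_E banach_space_AT assms incl_bounded])
  moreover have "compact_bilinear A AT
        (\<lambda>(a, b). (a, \<zero>\<^bsub>E\<^esub>) \<otimes>\<^bsub>AT\<^esub> (b, \<zero>\<^bsub>E\<^esub>) \<ominus>\<^bsub>AT\<^esub> (a \<otimes>\<^bsub>A\<^esub> b, \<zero>\<^bsub>E\<^esub>)) \<longleftrightarrow>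
      compact_bilinear A AT (\<lambda>p. (\<zero>\<^bsub>A\<^esub>, T p))"
    by (rule compact_bilinear_cong[OF normed_A]) (simp add: eq)
  ultimately have "compact_bilinear A AT
      (\<lambda>(a, b). (a, \<zero>\<^bsub>E\<^esub>) \<otimes>\<^bsub>AT\<^esub> (b, \<zero>\<^bsub>E\<^esub>) \<ominus>\<^bsub>AT\<^esub> (a \<otimes>\<^bsub>A\<^esub> b, \<zero>\<^bsub>E\<^esub>))"
    by blast
  then show ?thesis
    unfolding cf_splits_strongly_def cf_homomorphism_def cocycle_extension_simps
    using zero_section_bounded bounded_linear_onD[OF zero_section_bounded]
    by (intro exI[of _ "\<lambda>a. (a, \<zero>\<^bsub>E\<^esub>)"]) simp
qed

end

section \<open>Transport of an extension along an injection\<close>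

text \<open>Transport of structure along \<open>f\<close>, with \<open>g\<close> its inverse on the
  image. It provides copies of algebras on pairs inside the type over which classes are
  formed.\<close>

definition push_alg :: "('m \<Rightarrow> 'n) \<Rightarrow> ('k, 'm) normed_alg \<Rightarrow> ('k, 'n) normed_alg" where
  "push_alg f B = (let g = inv_into (carrier B) f in
    \<lparr>carrier = f ` carrier B, mult = (\<lambda>u v. f (g u \<otimes>\<^bsub>B\<^esub> g v)), one = f \<one>\<^bsub>B\<^esub>,
     zero = f \<zero>\<^bsub>B\<^esub>, add = (\<lambda>u v. f (g u \<oplus>\<^bsub>B\<^esub> g v)), smult = (\<lambda>c u. f (c \<odot>\<^bsub>B\<^esub> g u)),
     nrm = (\<lambda>u. nrm B (g u))\<rparr>)"

definition push_ext :: "('m \<Rightarrow> 'n) \<Rightarrow> ('k, 'a, 'i, 'm) extension \<Rightarrow> ('k, 'a, 'i, 'n) extension" where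
  "push_ext f X = \<lparr>ext_alg = push_alg f (ext_alg X), ext_incl = (\<lambda>x. f (ext_incl X x)),
     ext_quot = (\<lambda>u. ext_quot X (inv_into (carrier (ext_alg X)) f u))\<rparr>"

locale push = banach_algebra B for B :: "('k::real_normed_field, 'm) normed_alg" +
  fixes f :: "'m \<Rightarrow> 'n"
  assumes inj: "inj_on f (carrier B)"
begin

abbreviation "P \<equiv> push_alg f B"

lemma mult_B_closed [simp]: "\<lbrakk>u \<in> carrier B; v \<in> carrier B\<rbrakk> \<Longrightarrow> u \<otimes>\<^bsub>B\<^esub> v \<in> carrier B"
  by (rule bilinear_onD(1)[OF mult_bilinear])

lemma f_eq_iff [simp]: "\<lbrakk>u \<in> carrier B; v \<in> carrier B\<rbrakk> \<Longrightarrow> f u = f v \<longleftrightarrow> u = v"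
  using inj by (auto simp: inj_on_def)

lemma push_simps:
  "carrier P = f ` carrier B"
  "\<zero>\<^bsub>P\<^esub> = f \<zero>\<^bsub>B\<^esub>"
  "\<lbrakk>u \<in> carrier B; v \<in> carrier B\<rbrakk> \<Longrightarrow> f u \<otimes>\<^bsub>P\<^esub> f v = f (u \<otimes>\<^bsub>B\<^esub> v)"
  "\<lbrakk>u \<in> carrier B; v \<in> carrier B\<rbrakk> \<Longrightarrow> f u \<oplus>\<^bsub>P\<^esub> f v = f (u \<oplus>\<^bsub>B\<^esub> v)"
  "u \<in> carrier B \<Longrightarrow> c \<odot>\<^bsub>P\<^esub> f u = f (c \<odot>\<^bsub>B\<^esub> u)"
  "u \<in> carrier B \<Longrightarrow> nrm P (f u) = nrm B u"
  using inj by (auto simp: push_alg_def Let_def)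

lemma normed_space_push: "normed_space P"
proof (rule normed_spaceI)
  show "abelian_group P"
  proof (rule abelian_groupI)
    fix u assume "u \<in> carrier P"
    then obtain v where "u = f v" "v \<in> carrier B" by (auto simp: push_simps)
    then show "\<exists>w\<in>carrier P. w \<oplus>\<^bsub>P\<^esub> u = \<zero>\<^bsub>P\<^esub>"
      by (intro bexI[of _ "f (\<ominus>\<^bsub>B\<^esub> v)"]) (auto simp: push_simps l_neg)
  qed (auto simp: push_simps a_ac)
qed (auto simp: push_simps smul_add_left smul_add_right smul_smul nrm_nonneg nrm_eq_zero
    nrm_triangle nrm_smult)

lemma diff_push:
  assumes "u \<in> carrier B" "v \<in> carrier B"
  shows "f u \<ominus>\<^bsub>P\<^esub> f v = f (u \<ominus>\<^bsub>B\<^esub> v)"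
proof -
  interpret P: normed_space P by (rule normed_space_push)
  show ?thesis
    using assms by (subst P.diff_eq_iff) (auto simp: push_simps)
qed

lemma banach_space_push: "banach_space P"
proof (rule banach_spaceI[OF normed_space_push])
  fix s :: "nat \<Rightarrow> 'n"
  assume s: "\<And>n. s n \<in> carrier P"
    and cauchy: "\<And>\<epsilon>. \<epsilon> > 0 \<Longrightarrow> \<exists>N. \<forall>m\<ge>N. \<forall>n\<ge>N. nrm P (s m \<ominus>\<^bsub>P\<^esub> s n) < \<epsilon>"
  obtain t where t: "t n \<in> carrier B" "s n = f (t n)" for n
    using s unfolding push_simps image_iff by metis
  have "\<exists>N. \<forall>m\<ge>N. \<forall>n\<ge>N. nrm B (t m \<ominus>\<^bsub>B\<^esub> t n) < \<epsilon>" if "\<epsilon> > 0" for \<epsilon>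
    using cauchy[OF that] t(1) by (simp add: t diff_push push_simps)
  then obtain l where "l \<in> carrier B" "(\<lambda>n. nrm B (t n \<ominus>\<^bsub>B\<^esub> l)) \<longlonglongrightarrow> 0"
    using complete_sequence[of t] t(1) by blast
  then show "\<exists>l\<in>carrier P. (\<lambda>n. nrm P (s n \<ominus>\<^bsub>P\<^esub> l)) \<longlonglongrightarrow> 0"
    using t(1) by (intro bexI[of _ "f l"]) (simp_all add: t diff_push push_simps)
qed

lemma banach_algebra_push: "banach_algebra P"
proof -
  interpret P: banach_space P by (rule banach_space_push)
  show ?thesis
  proof unfold_locales
    show "bilinear_on P P P (mult P)"
      unfolding bilinear_on_def linear_on_def
      by (auto simp: push_simps bilinear_onD(2-)[OF mult_bilinear])
  qed (auto simp: push_simps mult_assoc nrm_mult)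
qed

lemma push_bounded: "bounded_linear_on B P f"
  unfolding bounded_linear_on_def linear_on_def by (auto simp: push_simps intro!: exI[of _ 1])

end

context sa_extension
begin

text \<open>By construction \<open>f\<close> is an isometric isomorphism onto the transported
  algebra, so one map witnesses plain and strong equivalence alike.\<close>

lemma push_extension:
  assumes inj: "inj_on f (carrier M)"
  shows "push_ext f X \<in> SA_extensions A E"
    and "equivalence_map E X (push_ext f X) f"
    and "continuous_map (ntop M) (ntop (ext_alg (push_ext f X))) f"
proof -
  interpret P: push M f
    using inj by unfold_locales
  have simps: "ext_alg (push_ext f X) = P.P" "ext_incl (push_ext f X) x = f (i x)"
    "u \<in> carrier M \<Longrightarrow> ext_quot (push_ext f X) (f u) = q u" for x u
    using inj by (simp_all add: push_ext_def)
  interpret MP: normed_pair M P.P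
    using normed_M P.normed_space_push by (simp add: normed_pair_def)
  show "continuous_map (ntop M) (ntop (ext_alg (push_ext f X))) f"
    unfolding simps by (rule MP.bounded_linear_imp_continuous[OF P.push_bounded])
  show "equivalence_map E X (push_ext f X) f"
    using inj bounded_linear_onD[OF P.push_bounded]
    by (auto simp: equivalence_map_def algebra_hom_def simps P.push_simps bij_betw_def)
  obtain Q where Q: "bounded_linear_on A M Q" "\<And>a. a \<in> carrier A \<Longrightarrow> q (Q a) = a"
    using bounded_section by blast
  show "push_ext f X \<in> SA_extensions A E"
  proof (rule SA_extensionI)
    show "banach_algebra (ext_alg (push_ext f X))"
      by (simp add: simps P.banach_algebra_push)
    have "bounded_linear_on E P.P (\<lambda>x. f (i x))"
      by (rule bounded_linear_on_compose[OF normed_E normed_M P.normed_space_push i_bounded P.push_bounded])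
    then show "bounded_linear_on E (ext_alg (push_ext f X)) (ext_incl (push_ext f X))"
      by (simp add: push_ext_def)
    obtain K where "\<forall>u\<in>carrier M. nrm A (q u) \<le> K * nrm M u"
      using q_bounded by (auto simp: bounded_linear_on_def)
    then show "bounded_linear_on (ext_alg (push_ext f X)) A (ext_quot (push_ext f X))"
      unfolding bounded_linear_on_def linear_on_def
      by (auto simp: simps P.push_simps q_simps intro!: exI[of _ K])
    show "ext_incl (push_ext f X) ` carrier E =
        {u \<in> carrier (ext_alg (push_ext f X)). ext_quot (push_ext f X) u = \<zero>\<^bsub>A\<^esub>}"
    proof -
      have "ext_incl (push_ext f X) ` carrier E = f ` (i ` carrier E)"
        by (simp add: push_ext_def image_image)
      then show ?thesis
        unfolding i_image by (auto simp: simps P.push_simps)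
    qed
    show "bounded_linear_on A (ext_alg (push_ext f X)) (\<lambda>a. f (Q a))"
      unfolding simps
      by (rule bounded_linear_on_compose[OF normed_A normed_M P.normed_space_push Q(1) P.push_bounded])
  qed (use Q linear_onD(1)[OF bounded_linear_onD[OF Q(1)]] in
      \<open>auto simp: simps P.push_simps i_mult mult_i inj_on_def\<close>)
qed

end

section \<open>Equivalence of extensions\<close>

text \<open>Here and below the flag \<open>s\<close> selects between the strong (continuous, bounded) version of a notion and
  the purely algebraic one, so that parts (b) and (c) have a common proof.\<close>

definition ext_equiv :: "bool \<Rightarrow> ('k, 'a, 'i, 'z) bimodule_scheme \<Rightarrow>
    ('k, 'a, 'i, 'm) extension \<Rightarrow> ('k, 'a, 'i, 'n) extension \<Rightarrow> bool" where
  "ext_equiv s I X Y \<longleftrightarrow> (\<exists>\<psi>. equivalence_map I X Y \<psi> \<and>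
     (s \<longrightarrow> continuous_map (ntop (ext_alg X)) (ntop (ext_alg Y)) \<psi>))"

lemma equivalence_map_compose:
  assumes "equivalence_map I X Y \<psi>" "equivalence_map I Y Z \<theta>"
  shows "equivalence_map I X Z (\<lambda>u. \<theta> (\<psi> u))"
proof -
  have "linear_on (ext_alg X) (ext_alg Z) (\<lambda>u. \<theta> (\<psi> u))"
    by (rule linear_on_compose[of _ "ext_alg Y"]) (use assms in \<open>auto simp: equivalence_map_def algebra_hom_def\<close>)
  moreover have "bij_betw (\<lambda>u. \<theta> (\<psi> u)) (carrier (ext_alg X)) (carrier (ext_alg Z))"
    using assms bij_betw_trans[of \<psi> _ _ \<theta>] by (auto simp: equivalence_map_def comp_def)
  moreover have "\<psi> u \<in> carrier (ext_alg Y)" if "u \<in> carrier (ext_alg X)" for u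
    using assms(1) that by (auto simp: equivalence_map_def bij_betw_def)
  ultimately show ?thesis
    using assms by (simp add: equivalence_map_def algebra_hom_def)
qed

lemma ext_equiv_trans: "\<lbrakk>ext_equiv s I X Y; ext_equiv s I Y Z\<rbrakk> \<Longrightarrow> ext_equiv s I X Z"
  unfolding ext_equiv_def
  using equivalence_map_compose[of I X Y _ Z]
    continuous_map_compose[of "ntop (ext_alg X)" "ntop (ext_alg Y)" _ "ntop (ext_alg Z)"]
  unfolding comp_def by metis

context banach_bimodule
begin

lemma sa_extensionI: "X \<in> SA_extensions A E \<Longrightarrow> sa_extension A E X"
  by unfold_locales

text \<open>A strong equivalence demands continuity in one direction only, so its symmetry uses the
  completeness of both algebras: continuity is converted into a bound, inverted, and converted
  back.\<close>

lemma ext_equiv_sym: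
  assumes X: "X \<in> SA_extensions A E" and Y: "Y \<in> SA_extensions A E" and equiv: "ext_equiv s E X Y"
  shows "ext_equiv s E Y X"
proof -
  interpret X: sa_extension A E X using X by (rule sa_extensionI)
  interpret Y: sa_extension A E Y using Y by (rule sa_extensionI)
  interpret XY: normed_pair X.M Y.M by unfold_locales
  interpret YX: normed_pair Y.M X.M by unfold_locales
  obtain \<psi> where \<psi>: "equivalence_map E X Y \<psi>" and cont: "s \<Longrightarrow> continuous_map (ntop X.M) (ntop Y.M) \<psi>"
    using equiv unfolding ext_equiv_def by blast
  have lin: "linear_on X.M Y.M \<psi>" and bij: "bij_betw \<psi> (carrier X.M) (carrier Y.M)"
    and mult: "\<And>u v. \<lbrakk>u \<in> carrier X.M; v \<in> carrier X.M\<rbrakk> \<Longrightarrow> \<psi> (u \<otimes>\<^bsub>X.M\<^esub> v) = \<psi> u \<otimes>\<^bsub>Y.M\<^esub> \<psi> v"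
    and incl: "\<And>x. x \<in> carrier E \<Longrightarrow> \<psi> (X.i x) = Y.i x"
    and quot: "\<And>u. u \<in> carrier X.M \<Longrightarrow> Y.q (\<psi> u) = X.q u"
    using \<psi> by (auto simp: equivalence_map_def algebra_hom_def)
  let ?\<theta> = "inv_into (carrier X.M) \<psi>"
  have \<theta>: "?\<theta> v \<in> carrier X.M" "\<psi> (?\<theta> v) = v" if "v \<in> carrier Y.M" for v
    using that bij by (auto simp: bij_betw_def f_inv_into_f inv_into_into)
  have \<theta>\<psi>: "?\<theta> (\<psi> u) = u" if "u \<in> carrier X.M" for u
    using that bij by (auto simp: bij_betw_def)
  have "?\<theta> (u \<otimes>\<^bsub>Y.M\<^esub> v) = ?\<theta> u \<otimes>\<^bsub>X.M\<^esub> ?\<theta> v" if "u \<in> carrier Y.M" "v \<in> carrier Y.M" for u v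
    using that \<theta>\<psi>[of "?\<theta> u \<otimes>\<^bsub>X.M\<^esub> ?\<theta> v"] by (simp add: mult \<theta>)
  moreover have "?\<theta> (Y.i x) = X.i x" if "x \<in> carrier E" for x
    using that \<theta>\<psi>[of "X.i x"] by (simp add: incl)
  moreover have "X.q (?\<theta> v) = Y.q v" if "v \<in> carrier Y.M" for v
    using that quot[of "?\<theta> v"] by (simp add: \<theta>)
  ultimately have "equivalence_map E Y X ?\<theta>"
    using XY.linear_inv_into[OF lin bij] bij_betw_inv_into[OF bij]
    by (simp add: equivalence_map_def algebra_hom_def)
  moreover have "continuous_map (ntop Y.M) (ntop X.M) ?\<theta>" if s
    using bounded_linear_inv_into[OF X.banach_M Y.banach_M
        XY.continuous_linear_imp_bounded[OF lin cont[OF that]] bij]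
    by (rule YX.bounded_linear_imp_continuous)
  ultimately show ?thesis
    unfolding ext_equiv_def by blast
qed

lemma ext_equiv_refl: "ext_equiv s E X X"
  unfolding ext_equiv_def equivalence_map_def algebra_hom_def linear_on_def
  by (intro exI[of _ id]) (auto simp: id_def bij_betw_def)

section \<open>Classes, splittings and coboundaries under the common flag\<close>

definition equiv_class ::
  "bool \<Rightarrow> ('k, 'a, 'e, 'm) extension \<Rightarrow> ('k, 'a, 'e, 'n) extension set" where
  "equiv_class s X = {Y \<in> SA_extensions A E. ext_equiv s E X Y}"

lemma equiv_class_eq:
  assumes "X \<in> SA_extensions A E" "Y \<in> SA_extensions A E" "ext_equiv s E X Y"
  shows "equiv_class s X = equiv_class s Y"
  using assms ext_equiv_sym[OF assms] unfolding equiv_class_def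
  by (blast intro: ext_equiv_trans)

definition cf_split :: "bool \<Rightarrow> ('k, 'a, 'e, 'm) extension \<Rightarrow> bool" where
  "cf_split s X \<longleftrightarrow> (\<exists>Q. cf_homomorphism A (ext_alg X) Q \<and>
     (s \<longrightarrow> bounded_linear_on A (ext_alg X) Q) \<and> (\<forall>a\<in>carrier A. ext_quot X (Q a) = a))"

definition coboundaries :: "bool \<Rightarrow> ('a \<times> 'a \<Rightarrow> 'e) set" where
  "coboundaries s = {T \<in> K2 A E. \<exists>S. linear_on A E S \<and> (s \<longrightarrow> bounded_linear_on A E S) \<and>
     (\<forall>a\<in>carrier A. \<forall>b\<in>carrier A. T (a, b) = delta1 A E S a b)}"

lemma flag_simps:
  "equivalent_ext E = ext_equiv False E" "strongly_equivalent_ext E = ext_equiv True E"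
  "ext_class A E = equiv_class False" "strong_ext_class A E = equiv_class True"
  "cf_splits A = cf_split False" "cf_splits_strongly A = cf_split True"
  "N2K_tilde A E = coboundaries False" "N2K A E = coboundaries True"
  using bounded_linear_onD
  by (auto simp: fun_eq_iff equivalent_ext_def strongly_equivalent_ext_def ext_equiv_def
      ext_class_def strong_ext_class_def equiv_class_def cf_splits_def cf_splits_strongly_def
      cf_split_def N2K_tilde_def N2K_def coboundaries_def)

lemma Z2K_bounded_cocycle:
  assumes "T \<in> Z2K A E"
  shows "bounded_cocycle A E T" "compact_bilinear A E T" "T \<in> K2 A E"
proof -
  show K2: "T \<in> K2 A E" and cpt: "compact_bilinear A E T"
    using assms by (auto simp: Z2K_def K2_def)
  have bil: "bilinear_on A A E (curry T)"
    using cpt by (simp add: compact_bilinear_def)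
  obtain K where "\<And>a b. \<lbrakk>a \<in> carrier A; b \<in> carrier A\<rbrakk> \<Longrightarrow> nrm E (T (a, b)) \<le> K * nrm A a * nrm A b"
    by (rule compact_bilinear_bounded[OF normed_A banach_E cpt]) blast
  then show "bounded_cocycle A E T"
    using bil assms delta2_eq_zero_iff[OF bil] by unfold_locales (auto simp: Z2K_def)
qed

lemma cocycle_extension_equiv_iff:
  assumes T: "T \<in> Z2K A E" and T': "T' \<in> Z2K A E"
  shows "ext_equiv s E (cocycle_extension A E T) (cocycle_extension A E T') \<longleftrightarrow>
    cochain_diff A E T T' \<in> coboundaries s"
proof
  interpret T: bounded_cocycle A E T using Z2K_bounded_cocycle[OF T] by simp
  interpret T': bounded_cocycle A E T' using Z2K_bounded_cocycle[OF T'] by simp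
  interpret X': sa_extension A E T'.\<Sigma>T by unfold_locales (rule T'.cocycle_extension_SA)
  note K2 = Z2K_bounded_cocycle(3)[OF T] Z2K_bounded_cocycle(3)[OF T']
  interpret TT': normed_pair T.AT T'.AT
    using T.normed_space_AT T'.normed_space_AT by (simp add: normed_pair_def)
  {
    assume "cochain_diff A E T T' \<in> coboundaries s"
    then obtain S where S: "linear_on A E S" and bdd: "s \<Longrightarrow> bounded_linear_on A E S"
      and eq: "\<And>a b. \<lbrakk>a \<in> carrier A; b \<in> carrier A\<rbrakk> \<Longrightarrow> cochain_diff A E T T' (a, b) = delta1 A E S a b"
      unfolding coboundaries_def by blast
    note S_closed [simp] = linear_onD(1)[OF S]
    let ?Q = "\<lambda>a. (a, S a)"
    have Q: "linear_on A X'.M ?Q"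
      using S by (auto simp: linear_on_def T'.cocycle_extension_simps T'.cocycle_algebra_simps)
    have sec: "X'.q (?Q a) = a" for a
      by (simp add: T'.cocycle_extension_simps)
    have "X'.i (T (a, b)) \<oplus>\<^bsub>X'.M\<^esub> ?Q (a \<otimes>\<^bsub>A\<^esub> b) = ?Q a \<otimes>\<^bsub>X'.M\<^esub> ?Q b"
      if ab: "a \<in> carrier A" "b \<in> carrier A" for a b
      using cochain_diff_eq_delta1_iff[OF S K2 ab] eq[OF ab] ab
      by (simp add: T'.cocycle_extension_simps T'.cocycle_algebra_simps)
    then have "equivalence_map E T.\<Sigma>T T'.\<Sigma>T (\<lambda>(a, x). ?Q a \<oplus>\<^bsub>X'.M\<^esub> X'.i x)"
      by (intro X'.splitting_map_equivalence[OF Q sec T.bounded_cocycle_axioms]) auto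
    moreover have "continuous_map (ntop T.AT) (ntop T'.AT) (\<lambda>(a, x). ?Q a \<oplus>\<^bsub>X'.M\<^esub> X'.i x)" if s
      using X'.splitting_map_bounded[OF Q sec, of T] T'.section_bounded[OF bdd[OF that]]
      by (intro TT'.bounded_linear_imp_continuous) (simp add: T'.cocycle_extension_simps(1))
    ultimately show "ext_equiv s E T.\<Sigma>T T'.\<Sigma>T"
      unfolding ext_equiv_def T.cocycle_extension_simps T'.cocycle_extension_simps by blast
  }
  assume "ext_equiv s E T.\<Sigma>T T'.\<Sigma>T"
  then obtain \<psi> where \<psi>: "equivalence_map E T.\<Sigma>T T'.\<Sigma>T \<psi>"
    and cont: "s \<Longrightarrow> continuous_map (ntop T.AT) (ntop T'.AT) \<psi>"
    unfolding ext_equiv_def T.cocycle_extension_simps T'.cocycle_extension_simps by blast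
  have lin: "linear_on T.AT T'.AT \<psi>"
    and mult: "\<And>u v. \<lbrakk>u \<in> carrier T.AT; v \<in> carrier T.AT\<rbrakk> \<Longrightarrow> \<psi> (u \<otimes>\<^bsub>T.AT\<^esub> v) = \<psi> u \<otimes>\<^bsub>T'.AT\<^esub> \<psi> v"
    and incl: "\<And>x. x \<in> carrier E \<Longrightarrow> \<psi> (\<zero>\<^bsub>A\<^esub>, x) = (\<zero>\<^bsub>A\<^esub>, x)"
    and quot: "\<And>u. u \<in> carrier T.AT \<Longrightarrow> fst (\<psi> u) = fst u"
    using \<psi> by (auto simp: equivalence_map_def algebra_hom_def T.cocycle_extension_simps T'.cocycle_extension_simps)
  \<comment> \<open>Compatibility with the quotient maps fixes the first coordinate of
    \<open>\<psi>\<close>, and compatibility with the inclusions fixes \<open>\<psi>\<close> on the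
    kernel. What remains free is the second coordinate on the zero section.\<close>
  define S where "S a = snd (\<psi> (a, \<zero>\<^bsub>E\<^esub>))" for a
  have \<psi>_S: "\<psi> (a, \<zero>\<^bsub>E\<^esub>) = (a, S a)" if "a \<in> carrier A" for a
    using quot[of "(a, \<zero>\<^bsub>E\<^esub>)"] that by (simp add: S_def T.cocycle_algebra_simps prod_eq_iff)
  have S_closed [simp]: "S a \<in> carrier E" if "a \<in> carrier A" for a
    using linear_onD(1)[OF lin, of "(a, \<zero>\<^bsub>E\<^esub>)"] that
    by (simp add: T.cocycle_algebra_simps T'.cocycle_algebra_simps \<psi>_S)
  have \<psi>_eq: "\<psi> (a, x) = (a, S a \<oplus>\<^bsub>E\<^esub> x)" if "a \<in> carrier A" "x \<in> carrier E" for a x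
    using linear_onD(2)[OF lin, of "(a, \<zero>\<^bsub>E\<^esub>)" "(\<zero>\<^bsub>A\<^esub>, x)"] that
    by (simp add: T.cocycle_algebra_simps T'.cocycle_algebra_simps \<psi>_S incl)
  have S_lin: "linear_on A E S"
    using linear_onD(2)[OF lin, of "(_, \<zero>\<^bsub>E\<^esub>)" "(_, \<zero>\<^bsub>E\<^esub>)"] linear_onD(3)[OF lin, of "(_, \<zero>\<^bsub>E\<^esub>)"]
    by (auto simp: linear_on_def T.cocycle_algebra_simps T'.cocycle_algebra_simps \<psi>_S)
  have "bounded_linear_on A E S" if s
  proof -
    have "bounded_linear_on A T'.AT (\<lambda>a. \<psi> (a, \<zero>\<^bsub>E\<^esub>))"
      by (rule bounded_linear_on_compose[OF normed_A T.normed_space_AT T'.normed_space_AT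
            T.zero_section_bounded TT'.continuous_linear_imp_bounded[OF lin cont[OF that]]])
    then obtain K where K: "\<forall>a\<in>carrier A. nrm T'.AT (\<psi> (a, \<zero>\<^bsub>E\<^esub>)) \<le> K * nrm A a"
      by (auto simp: bounded_linear_on_def)
    have "nrm E (S a) \<le> K * nrm A a" if a: "a \<in> carrier A" for a
    proof -
      have "1 * nrm E (S a) \<le> T'.C * (nrm A a + nrm E (S a))"
        using T'.C_ge_1 nrm_nonneg[OF a] E.nrm_nonneg[OF S_closed[OF a]] by (intro mult_mono) auto
      also have "\<dots> \<le> K * nrm A a"
        using K a by (auto simp: \<psi>_S T'.cocycle_algebra_simps)
      finally show ?thesis by simp
    qed
    then show ?thesis
      using S_lin unfolding bounded_linear_on_def by blast
  qed
  moreover have "cochain_diff A E T T' (a, b) = delta1 A E S a b"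
    if ab: "a \<in> carrier A" "b \<in> carrier A" for a b
  proof -
    \<comment> \<open>In the algebra of \<open>T\<close> the product of \<open>(a, 0)\<close> and
      \<open>(b, 0)\<close> has second coordinate \<open>T (a, b)\<close>, so multiplicativity of
      \<open>\<psi>\<close> on the zero section compares \<open>T\<close> with
      \<open>T'\<close>.\<close>
    have "\<psi> (a \<otimes>\<^bsub>A\<^esub> b, T (a, b)) = (a, S a) \<otimes>\<^bsub>T'.AT\<^esub> (b, S b)"
      using mult[of "(a, \<zero>\<^bsub>E\<^esub>)" "(b, \<zero>\<^bsub>E\<^esub>)"] ab
      by (simp add: T.mult_zero_section \<psi>_S T.cocycle_algebra_simps(1))
    then have "T (a, b) \<oplus>\<^bsub>E\<^esub> S (a \<otimes>\<^bsub>A\<^esub> b) = lact E a (S b) \<oplus>\<^bsub>E\<^esub> ract E (S a) b \<oplus>\<^bsub>E\<^esub> T' (a, b)"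
      using ab by (simp add: \<psi>_eq T'.cocycle_algebra_simps E.a_comm)
    then show ?thesis
      by (simp add: cochain_diff_eq_delta1_iff[OF S_lin K2 ab])
  qed
  ultimately show "cochain_diff A E T T' \<in> coboundaries s"
    unfolding coboundaries_def using K2_diff[OF K2] S_lin by blast
qed

text \<open>Boundedness of \<open>Q\<close> gives continuity of its splitting map, so the same flag
  governs hypothesis and conclusion.\<close>

lemma cf_split_equiv_cocycle_extension:
  assumes X: "X \<in> SA_extensions A E" and split: "cf_split s X"
  obtains T where "T \<in> Z2K A E" "ext_equiv s E (cocycle_extension A E T) X"
proof -
  interpret X: sa_extension A E X using X by (rule sa_extensionI)
  obtain Q where Q: "cf_homomorphism A X.M Q" and bdd: "s \<Longrightarrow> bounded_linear_on A X.M Q"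
    and sec: "\<And>a. a \<in> carrier A \<Longrightarrow> X.q (Q a) = a"
    using split unfolding cf_split_def by blast
  have lin: "linear_on A X.M Q" using Q by (simp add: cf_homomorphism_def)
  obtain T where T: "T \<in> Z2K A E" and iT: "\<And>a b. \<lbrakk>a \<in> carrier A; b \<in> carrier A\<rbrakk> \<Longrightarrow>
      X.i (T (a, b)) \<oplus>\<^bsub>X.M\<^esub> Q (a \<otimes>\<^bsub>A\<^esub> b) = Q a \<otimes>\<^bsub>X.M\<^esub> Q b"
    using X.cocycle_of_cf_section[OF Q sec] by blast
  interpret T: bounded_cocycle A E T using Z2K_bounded_cocycle[OF T] by simp
  interpret TX: normed_pair T.AT X.M
    using T.normed_space_AT X.normed_M by (simp add: normed_pair_def)
  have "equivalence_map E T.\<Sigma>T X (\<lambda>(a, x). Q a \<oplus>\<^bsub>X.M\<^esub> X.i x)"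
    by (rule X.splitting_map_equivalence[OF lin sec T.bounded_cocycle_axioms iT])
  moreover have "continuous_map (ntop T.AT) (ntop X.M) (\<lambda>(a, x). Q a \<oplus>\<^bsub>X.M\<^esub> X.i x)" if s
    by (rule TX.bounded_linear_imp_continuous[OF X.splitting_map_bounded[OF lin sec bdd[OF that]]])
  ultimately have "ext_equiv s E T.\<Sigma>T X"
    unfolding ext_equiv_def T.cocycle_extension_simps by blast
  then show thesis
    using T that by blast
qed

text \<open>The defect of the composite of \<open>Q\<close> with \<open>f\<close> is
  \<open>f\<close> applied to the defect of \<open>Q\<close>, and \<open>f\<close> is a bounded
  homomorphism.\<close>

lemma cf_split_push:
  assumes X: "X \<in> SA_extensions A E" and split: "cf_split True X" and inj: "inj_on f (carrier (ext_alg X))"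
  shows "cf_split True (push_ext f X)"
proof -
  interpret X: sa_extension A E X using X by (rule sa_extensionI)
  interpret P: push X.M f using inj by unfold_locales
  have M: "ext_alg (push_ext f X) = P.P" by (simp add: push_ext_def)
  obtain Q where Q: "cf_homomorphism A X.M Q" "bounded_linear_on A X.M Q"
    and sec: "\<And>a. a \<in> carrier A \<Longrightarrow> X.q (Q a) = a"
    using split unfolding cf_split_def by blast
  have bdd: "bounded_linear_on A P.P (\<lambda>a. f (Q a))"
    by (rule bounded_linear_on_compose[OF normed_A X.normed_M P.normed_space_push Q(2) P.push_bounded])
  have cpt: "compact_bilinear A P.P
      (\<lambda>p. f ((\<lambda>(a, b). Q a \<otimes>\<^bsub>X.M\<^esub> Q b \<ominus>\<^bsub>X.M\<^esub> Q (a \<otimes>\<^bsub>A\<^esub> b)) p))"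
    using Q(1) by (intro compact_bilinear_compose[OF X.banach_M P.banach_space_push _ P.push_bounded])
      (simp add: cf_homomorphism_def)
  note Q_closed [simp] = linear_onD(1)[OF bounded_linear_onD[OF Q(2)]]
  have "compact_bilinear A P.P
        (\<lambda>(a, b). f (Q a) \<otimes>\<^bsub>P.P\<^esub> f (Q b) \<ominus>\<^bsub>P.P\<^esub> f (Q (a \<otimes>\<^bsub>A\<^esub> b))) \<longleftrightarrow>
      compact_bilinear A P.P
        (\<lambda>p. f ((\<lambda>(a, b). Q a \<otimes>\<^bsub>X.M\<^esub> Q b \<ominus>\<^bsub>X.M\<^esub> Q (a \<otimes>\<^bsub>A\<^esub> b)) p))"
    by (rule compact_bilinear_cong[OF normed_A]) (simp add: P.push_simps P.diff_push)
  then have "cf_homomorphism A P.P (\<lambda>a. f (Q a))"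
    using cpt bounded_linear_onD[OF bdd] by (simp add: cf_homomorphism_def)
  moreover have "ext_quot (push_ext f X) (f (Q a)) = a" if "a \<in> carrier A" for a
    using that inj sec by (simp add: push_ext_def)
  ultimately show ?thesis
    unfolding cf_split_def M using bdd by blast
qed

lemma cocycle_extension_cf_split:
  assumes "T \<in> Z2K A E" shows "cf_split s (cocycle_extension A E T)"
  using bounded_cocycle.cocycle_extension_cf_splits_strongly[OF Z2K_bounded_cocycle(1,2)[OF assms]]
  unfolding cf_splits_strongly_def cf_split_def by blast

lemma cf_split_mono: "cf_split True X \<Longrightarrow> cf_split s X"
  unfolding cf_split_def by blast

lemma cocycle_extension_SA: "T \<in> Z2K A E \<Longrightarrow> cocycle_extension A E T \<in> SA_extensions A E"
  by (rule bounded_cocycle.cocycle_extension_SA[OF Z2K_bounded_cocycle(1)])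

end

text \<open>Ensures that the type \<open>'m\<close> is large enough: by
  \<open>splitting_map_bij\<close> every singular admissible extension has the size of
  \<open>A \<times> E\<close>, so each of them has a copy over \<open>'m\<close>.\<close>

locale bimodule_universe = banach_bimodule A E
  for A :: "('k::real_normed_field, 'a) normed_alg" and E :: "('k, 'a, 'e) bimodule" +
  fixes univ :: "'a \<times> 'e \<Rightarrow> 'm"
  assumes univ: "inj_on univ (carrier A \<times> carrier E)"
begin

lemma cocycle_extension_representative:
  assumes T: "T \<in> Z2K A E"
  obtains Y :: "('k, 'a, 'e, 'm) extension"
  where "Y \<in> SA_extensions A E" "cf_split True Y" "\<And>s. ext_equiv s E (cocycle_extension A E T) Y"
proof -
  let ?X = "cocycle_extension A E T"
  interpret X: sa_extension A E ?X
    using cocycle_extension_SA[OF T] by (rule sa_extensionI)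
  have inj: "inj_on univ (carrier X.M)"
    using univ by (simp add: cocycle_extension_def cocycle_algebra_def)
  show thesis
  proof (rule that)
    show "push_ext univ ?X \<in> SA_extensions A E"
      by (rule X.push_extension[OF inj])
    show "cf_split True (push_ext univ ?X)"
      by (rule cf_split_push[OF X.X cocycle_extension_cf_split[OF T] inj])
    show "ext_equiv s E ?X (push_ext univ ?X)" for s
      unfolding ext_equiv_def using X.push_extension[OF inj] by blast
  qed
qed

lemma equiv_class_cocycle_extension_eq_iff:
  assumes T: "T \<in> Z2K A E" and T': "T' \<in> Z2K A E"
  shows "(equiv_class s (cocycle_extension A E T) :: ('k, 'a, 'e, 'm) extension set) =
      equiv_class s (cocycle_extension A E T') \<longleftrightarrow> cochain_diff A E T T' \<in> coboundaries s"
proof -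
  let ?X = "cocycle_extension A E T" and ?X' = "cocycle_extension A E T'"
  note SA = cocycle_extension_SA[OF T] cocycle_extension_SA[OF T']
  have "ext_equiv s E ?X ?X'"
    if eq: "(equiv_class s ?X :: ('k, 'a, 'e, 'm) extension set) = equiv_class s ?X'"
  proof -
    \<comment> \<open>A class over \<open>'m\<close> need not contain its defining extension, which
      lives on pairs. A common member \<open>Y\<close> serves as the link; without one, equal
      classes could both be empty.\<close>
    obtain Y :: "('k, 'a, 'e, 'm) extension" where Y: "Y \<in> SA_extensions A E" "ext_equiv s E ?X Y"
      using cocycle_extension_representative[OF T] by metis
    then have "Y \<in> equiv_class s ?X'"
      unfolding eq[symmetric] by (simp add: equiv_class_def)
    then have "ext_equiv s E Y ?X'"
      using ext_equiv_sym[OF SA(2) Y(1)] by (simp add: equiv_class_def)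
    with Y(2) show ?thesis by (rule ext_equiv_trans)
  qed
  then show ?thesis
    using equiv_class_eq[OF SA] cocycle_extension_equiv_iff[OF T T'] by blast
qed

lemma equiv_class_mem_iff:
  fixes C :: "('k, 'a, 'e, 'm) extension set"
  assumes "C \<in> equiv_class s ` (SA_extensions A E :: ('k, 'a, 'e, 'm) extension set)"
  shows "X \<in> C \<longleftrightarrow> X \<in> SA_extensions A E \<and> C = equiv_class s X"
proof -
  obtain X0 :: "('k, 'a, 'e, 'm) extension" where X0: "X0 \<in> SA_extensions A E" "C = equiv_class s X0"
    using assms by blast
  have "X \<in> equiv_class s X" if "X \<in> SA_extensions A E"
    using that ext_equiv_refl by (simp add: equiv_class_def)
  then show ?thesis
    using X0 equiv_class_eq[of X0 X s] by (auto simp: equiv_class_def)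
qed

text \<open>A strong class calls for a bounded section, a plain class accepts either kind; this is
  the meaning of the hypothesis. The right side does not depend on \<open>t\<close>, because every
  cocycle extension cf-splits strongly.\<close>

lemma cf_split_classes:
  assumes "s \<Longrightarrow> t"
  shows "equiv_class s ` {X \<in> SA_extensions A E. cf_split t (X :: ('k, 'a, 'e, 'm) extension)} =
    (\<lambda>T. equiv_class s (cocycle_extension A E T) :: ('k, 'a, 'e, 'm) extension set) ` Z2K A E"
    (is "?L = ?R")
proof (intro equalityI subsetI)
  fix C assume "C \<in> ?L"
  then obtain X :: "('k, 'a, 'e, 'm) extension"
    where X: "X \<in> SA_extensions A E" "cf_split t X" "C = equiv_class s X" by blast
  then have "cf_split s X" using assms unfolding cf_split_def by blast
  then obtain T where T: "T \<in> Z2K A E" "ext_equiv s E (cocycle_extension A E T) X"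
    using cf_split_equiv_cocycle_extension[OF X(1)] by metis
  then show "C \<in> ?R"
    using equiv_class_eq[OF cocycle_extension_SA X(1)] X(3) by blast
next
  fix C assume "C \<in> ?R"
  then obtain T where T: "T \<in> Z2K A E" "C = equiv_class s (cocycle_extension A E T)" by blast
  obtain Y :: "('k, 'a, 'e, 'm) extension" where Y: "Y \<in> SA_extensions A E" "cf_split True Y"
    "ext_equiv s E (cocycle_extension A E T) Y"
    using cocycle_extension_representative[OF T(1)] by metis
  then show "C \<in> ?L"
    using equiv_class_eq[OF cocycle_extension_SA[OF T(1)] Y(1,3)] T(2) cf_split_mono by blast
qed

text \<open>A class is also the class of each of its members, so one that contains a splitting
  extension can be represented by that extension.\<close>

lemma cf_split_class_family:
  assumes "s \<Longrightarrow> t"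
  shows "{C \<in> equiv_class s ` (SA_extensions A E :: ('k, 'a, 'e, 'm) extension set).
      \<exists>X\<in>C. cf_split t (X :: ('k, 'a, 'e, 'm) extension)} =
    (\<lambda>T. equiv_class s (cocycle_extension A E T)) ` Z2K A E"
    (is "?L = _")
proof -
  have "?L = equiv_class s ` {X \<in> SA_extensions A E. cf_split t (X :: ('k, 'a, 'e, 'm) extension)}"
    (is "_ = ?R")
  proof (intro equalityI subsetI)
    fix C :: "('k, 'a, 'e, 'm) extension set" assume "C \<in> ?L"
    then obtain X :: "('k, 'a, 'e, 'm) extension" where C: "C \<in> equiv_class s ` (SA_extensions A E :: ('k, 'a, 'e, 'm) extension set)"
      and X: "X \<in> C" "cf_split t X" by blast
    then show "C \<in> ?R" using equiv_class_mem_iff[OF C, of X] by blast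
  next
    fix C :: "('k, 'a, 'e, 'm) extension set" assume "C \<in> ?R"
    then obtain X :: "('k, 'a, 'e, 'm) extension"
      where X: "X \<in> SA_extensions A E" "cf_split t X" "C = equiv_class s X" by blast
    then have C: "C \<in> equiv_class s ` (SA_extensions A E :: ('k, 'a, 'e, 'm) extension set)" by blast
    then show "C \<in> ?L" using equiv_class_mem_iff[OF C, of X] X by blast
  qed
  then show ?thesis using cf_split_classes[OF assms] by simp
qed

end

text \<open>The implication from left to right makes \<open>\<Phi>\<close> independent of the chosen
  representative, the converse makes it injective.\<close>

lemma ex_bij_betw_of_eq_iff:
  assumes "\<And>x y. \<lbrakk>x \<in> Z; y \<in> Z\<rbrakk> \<Longrightarrow> f x = f y \<longleftrightarrow> g x = g y"
  shows "\<exists>\<Phi>. (\<forall>x\<in>Z. \<Phi> (f x) = g x) \<and> bij_betw \<Phi> {f x |x. x \<in> Z} (g ` Z)"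
proof -
  define \<Phi> where "\<Phi> c = g (SOME x. x \<in> Z \<and> f x = c)" for c
  have \<Phi>: "\<Phi> (f x) = g x" if "x \<in> Z" for x
  proof -
    have "(SOME y. y \<in> Z \<and> f y = f x) \<in> Z \<and> f (SOME y. y \<in> Z \<and> f y = f x) = f x"
      by (rule someI[of _ x]) (use that in simp)
    then show ?thesis using assms that unfolding \<Phi>_def by blast
  qed
  moreover have "inj_on \<Phi> {f x |x. x \<in> Z}"
    using \<Phi> assms by (auto simp: inj_on_def)
  moreover have "\<Phi> ` {f x |x. x \<in> Z} = g ` Z"
    using \<Phi> by force
  ultimately show ?thesis unfolding bij_betw_def by blast
qed

theorem theorem5p8:
  fixes A :: "('k::real_normed_field, 'a) normed_alg"
    and E :: "('k, 'a, 'e) bimodule"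
    and univ :: "'a \<times> 'e \<Rightarrow> 'm"
  assumes "banach_algebra A"
    and "banach_bimodule A E"
    and "inj_on univ (carrier A \<times> carrier E)"
  shows
    "(\<forall>T\<in>Z2K A E. cf_splits_strongly A (cocycle_extension A E T)) \<and>

     (\<forall>T\<in>Z2K A E. \<forall>T'\<in>Z2K A E. cochain_diff A E T T' \<in> N2K_tilde A E \<longrightarrow>
        equivalent_ext E (cocycle_extension A E T) (cocycle_extension A E T')) \<and>
     (\<exists>\<Phi>. (\<forall>T\<in>Z2K A E. \<Phi> (cochain_coset A E T (N2K_tilde A E)) =
               ext_class A E (cocycle_extension A E T)) \<and>
          bij_betw \<Phi> (H2K_tilde A E)
            {C \<in> ext_class A E ` (SA_extensions A E :: ('k, 'a, 'e, 'm) extension set).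
               \<exists>X\<in>C. cf_splits A (X :: ('k, 'a, 'e, 'm) extension)}) \<and>
     {C \<in> ext_class A E ` (SA_extensions A E :: ('k, 'a, 'e, 'm) extension set).
        \<exists>X\<in>C. cf_splits A (X :: ('k, 'a, 'e, 'm) extension)} =
     {C \<in> ext_class A E ` (SA_extensions A E :: ('k, 'a, 'e, 'm) extension set).
        \<exists>X\<in>C. cf_splits_strongly A (X :: ('k, 'a, 'e, 'm) extension)} \<and>

     (\<forall>T\<in>Z2K A E. \<forall>T'\<in>Z2K A E. cochain_diff A E T T' \<in> N2K A E \<longrightarrow>
        strongly_equivalent_ext E (cocycle_extension A E T) (cocycle_extension A E T')) \<and>
     (\<exists>\<Phi>. (\<forall>T\<in>Z2K A E. \<Phi> (cochain_coset A E T (N2K A E)) =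
               strong_ext_class A E (cocycle_extension A E T)) \<and>
          bij_betw \<Phi> (H2K A E)
            (strong_ext_class A E `
               {X \<in> SA_extensions A E. cf_splits_strongly A (X :: ('k, 'a, 'e, 'm) extension)}
             :: ('k, 'a, 'e, 'm) extension set set))"
proof -
  interpret bimodule_universe A E univ
    using assms(2,3) by (simp add: bimodule_universe_def bimodule_universe_axioms_def)
  \<comment> \<open>Both sides say that \<open>cochain_diff A E T T'\<close> is a coboundary: one
    because the coboundaries form a subgroup, the other by the description of equivalences between
    cocycle extensions.\<close>
  have coset_iff: "cochain_coset A E T (coboundaries s) = cochain_coset A E T' (coboundaries s) \<longleftrightarrow>
      (equiv_class s (cocycle_extension A E T) :: ('k, 'a, 'e, 'm) extension set) =
      equiv_class s (cocycle_extension A E T')"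
    if "T \<in> Z2K A E" "T' \<in> Z2K A E" for s T T'
    using that cochain_coset_eq_iff[OF N2K_subgroup] cochain_coset_eq_iff[OF N2K_tilde_subgroup]
      equiv_class_cocycle_extension_eq_iff[of T T' s] Z2K_bounded_cocycle(3)
    unfolding flag_simps by (cases s) simp_all
  have bij: "\<exists>\<Phi>. (\<forall>T\<in>Z2K A E. \<Phi> (cochain_coset A E T (coboundaries s)) =
        (equiv_class s (cocycle_extension A E T) :: ('k, 'a, 'e, 'm) extension set)) \<and>
      bij_betw \<Phi> {cochain_coset A E T (coboundaries s) |T. T \<in> Z2K A E}
        ((\<lambda>T. equiv_class s (cocycle_extension A E T)) ` Z2K A E)" for s
    by (rule ex_bij_betw_of_eq_iff) (rule coset_iff)
  \<comment> \<open>Valid for both values of \<open>t\<close>, so the family for cf-splitting and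
    the one for strong cf-splitting are rewritten to the same set; this settles the word
    "equivalently" in (b).\<close>
  have plain: "{C \<in> equiv_class False ` (SA_extensions A E :: ('k, 'a, 'e, 'm) extension set).
        \<exists>X\<in>C. cf_split t (X :: ('k, 'a, 'e, 'm) extension)} =
      (\<lambda>T. equiv_class False (cocycle_extension A E T)) ` Z2K A E" for t
    by (rule cf_split_class_family) simp
  have strong: "equiv_class True ` {X \<in> SA_extensions A E. cf_split True (X :: ('k, 'a, 'e, 'm) extension)} =
      (\<lambda>T. equiv_class True (cocycle_extension A E T) :: ('k, 'a, 'e, 'm) extension set) ` Z2K A E"
    by (rule cf_split_classes)
  show ?thesis
    unfolding flag_simps H2K_def H2K_tilde_def plain strong
    by (intro conjI ballI impI cocycle_extension_cf_split bij refl)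
      (simp_all only: cocycle_extension_equiv_iff)
qed

end
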